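(* Let $q$ be a primitive root of unity of even order $N=2n>2$ and $\mathrm u_q=\mathrm u_q(\mathfrak{sl}_{2,\mathbb I})$, $\mathbb I=\{1,2\}$. The modules $L(i,j)$, $0\le i,j<N$, form a complete list of pairwise non-isomorphic simple $\mathrm u_q$-modules, and they are described as follows (weights are in $\Lambda=(\mathbb Z/N)^2$). (1) $L(0,0)=\mathbf 1$ is the tensor unit, the unique one-dimensional simple module, of weight $(0,0)$. (2) For $0<j<N$, $L(0,j)$ has a $\Lambda$-homogeneous basis $w_0,\dots,w_{2j}$ with $\deg w_{2m}=(-m,j-m)$ for $0\le m\le j$ and $\deg w_{2m+1}=(-m-1,j-m)$ for $0\le m<j$, where $w_0$ is a highest weight generator, $y_1$ maps $w_{2m}$ ($m<j$) to a non-zero vector of degree $\deg w_{2m+1}$, $y_2$ maps $w_{2m+1}$ to a non-zero vector of degree $\deg w_{2m+2}$, and $w_{2j}$, of weight $(-j,0)$, is annihilated by $y_1$ and $y_2$. (3) For $0<i<N$, $L(i,0)$ has a $\Lambda$-homogeneous basis $w_0,\dots,w_{2i}$ with $\deg w_{2m}=(i-m,-m)$ for $0\le m\le i$ and $\deg w_{2m+1}=(i-m,-m-1)$ for $0\le m<i$, where $w_0$ is a highest weight generator, $y_2$ maps $w_{2m}$ ($m<i$) to a non-zero vector of degree $\deg w_{2m+1}$, $y_1$ maps $w_{2m+1}$ to a non-zero vector of degree $\deg w_{2m+2}$, and $w_{2i}$, of weight $(0,-i)$, is annihilated by $y_1$ and $y_2$. (4) For $0<i,j<N$, let $1\le k\le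 N$ be the unique representative of $i+j$ modulo $N$. Then $L(i,j)$ has a $\Lambda$-homogeneous basis consisting of $4k$ vectors $w_0$, $w_{2k}$ and $w_s,w_s'$ for $1\le s\le 2k-1$, with (setting $w_0'=w_0$, $w_{2k}'=w_{2k}$) $\deg w_{2m}=\deg w_{2m}'=(i-m,j-m)$, $\deg w_{2m+1}=(i-m,j-m-1)$, $\deg w_{2m+1}'=(i-m-1,j-m)$, where $w_0$ is a highest weight generator; along the first chain $w_0,w_1,\dots,w_{2k}$, $y_2$ maps $w_{2m}$ and $y_1$ maps $w_{2m+1}$ to a non-zero vector of the degree of the next basis vector in the chain; along the second chain $w_0,w_1',\dots,w_{2k}$, $y_1$ maps $w_{2m}'$ and $y_2$ maps $w_{2m+1}'$ to a non-zero vector of the degree of the next basis vector in the chain; and $w_{2k}$, of weight $(i-k,j-k)=(-j,-i)$, is annihilated by $y_1$ and $y_2$. In particular, if $i+j=N$, then $L(i,j)=M(i,j)$.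
   Context: $\Bbbk$ is an algebraically closed field of characteristic zero. $\mathrm u_q=\mathrm u_q(\mathfrak{sl}_{2,\mathbb I})$ is the Hopf algebra over $\Bbbk$ generated by $x_1,x_2,y_1,y_2,\kappa_1,\kappa_2$ with relations $\kappa_1\kappa_2=\kappa_2\kappa_1$, $\kappa_i^N=1$, $\kappa_ix_j=q^{\delta_{ij}}x_j\kappa_i$, $\kappa_iy_j=q^{-\delta_{ij}}y_j\kappa_i$, $x_1^2=x_2^2=0$, $(x_1x_2)^N=-(x_2x_1)^N$, $y_1^2=y_2^2=0$, $(y_1y_2)^N=-(y_2y_1)^N$, $y_1x_1+x_1y_1=1-\kappa_2$, $y_2x_2+x_2y_2=1-\kappa_1$, $y_2x_1=q\,x_1y_2$, $y_1x_2=x_2y_1$, and coproduct $\Delta(\kappa_i)=\kappa_i\otimes\kappa_i$, $\Delta(x_1)=x_1\otimes1+\kappa_1^n\kappa_2\otimes x_1$, $\Delta(x_2)=x_2\otimes1+\kappa_2^n\otimes x_2$, $\Delta(y_1)=y_1\otimes1+\kappa_1^n\otimes y_1$, $\Delta(y_2)=y_2\otimes1+\kappa_1\kappa_2^n\otimes y_2$. A vector $v$ of a $\mathrm u_q$-module has weight (or $\Lambda$-degree) $(a,b)\in\Lambda$ if $\kappa_1v=q^av$, $\kappa_2v=q^bv$. A highest weight vector is a non-zero $\Lambda$-homogeneous vector annihilated by $x_1,x_2$. Let $\mathrm u_q^+$ be the subalgebra generated by $x_1,x_2,\kappa_1,\kappa_2$. The standard module is $M(i,j)=\mathrm u_q\otimes_{\mathrm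 u_q^+}\Bbbk_{(i,j)}$, where $\Bbbk_{(i,j)}$ is one-dimensional of weight $(i,j)$ with $x_1,x_2$ acting by zero; it has dimension $4N$ and a unique maximal submodule, and $L(i,j)$ denotes its simple quotient. *)

theory Defs
  imports
    "HOL-Library.Poly_Mapping"
    "HOL-Computational_Algebra.Polynomial"
    "HOL-Algebra.QuotRing"
    "HOL-Algebra.Module"
    "HOL-Algebra.Generated_Groups"
    "HOL-Algebra.Generated_Rings"
begin

section \<open>Modules over a noncommutative ring\<close>

text \<open>
  \<^locale>\<open>module\<close> of HOL-Algebra requires a commutative ring of scalars; the axioms below are
  the same ones over an arbitrary ring. The record type and the locale \<^locale>\<open>submodule\<close> of
  the library do not depend on commutativity and are reused. The fields \<open>mult\<close> and
  \<open>one\<close> of a module record carry no meaning.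
\<close>

locale left_module = R?: ring R + M?: abelian_group M
  for R :: "('r, 'm) ring_scheme" (structure) and M :: "('r, 'v, 'n) module_scheme" (structure) +
  assumes smult_closed [simp, intro]:
      "\<lbrakk>a \<in> carrier R; x \<in> carrier M\<rbrakk> \<Longrightarrow> a \<odot>\<^bsub>M\<^esub> x \<in> carrier M"
    and smult_l_distr:
      "\<lbrakk>a \<in> carrier R; b \<in> carrier R; x \<in> carrier M\<rbrakk> \<Longrightarrow>
        (a \<oplus> b) \<odot>\<^bsub>M\<^esub> x = a \<odot>\<^bsub>M\<^esub> x \<oplus>\<^bsub>M\<^esub> b \<odot>\<^bsub>M\<^esub> x"
    and smult_r_distr:
      "\<lbrakk>a \<in> carrier R; x \<in> carrier M; y \<in> carrier M\<rbrakk> \<Longrightarrow>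
        a \<odot>\<^bsub>M\<^esub> (x \<oplus>\<^bsub>M\<^esub> y) = a \<odot>\<^bsub>M\<^esub> x \<oplus>\<^bsub>M\<^esub> a \<odot>\<^bsub>M\<^esub> y"
    and smult_assoc1:
      "\<lbrakk>a \<in> carrier R; b \<in> carrier R; x \<in> carrier M\<rbrakk> \<Longrightarrow>
        (a \<otimes> b) \<odot>\<^bsub>M\<^esub> x = a \<odot>\<^bsub>M\<^esub> (b \<odot>\<^bsub>M\<^esub> x)"
    and smult_one [simp]:
      "x \<in> carrier M \<Longrightarrow> \<one> \<odot>\<^bsub>M\<^esub> x = x"

definition simple_module :: "('r, 'm) ring_scheme \<Rightarrow> ('r, 'v, 'n) module_scheme \<Rightarrow> bool" where
  "simple_module R M \<longleftrightarrow> left_module R M \<and> carrier M \<noteq> {\<zero>\<^bsub>M\<^esub>} \<and>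
     (\<forall>H. submodule H R M \<longrightarrow> H = {\<zero>\<^bsub>M\<^esub>} \<or> H = carrier M)"

definition module_isos ::
  "('r, 'm) ring_scheme \<Rightarrow> ('r, 'v, 'n) module_scheme \<Rightarrow> ('r, 'w, 'l) module_scheme \<Rightarrow> ('v \<Rightarrow> 'w) set" where
  "module_isos R M M' = {f. bij_betw f (carrier M) (carrier M') \<and>
     (\<forall>v\<in>carrier M. \<forall>w\<in>carrier M. f (v \<oplus>\<^bsub>M\<^esub> w) = f v \<oplus>\<^bsub>M'\<^esub> f w) \<and>
     (\<forall>a\<in>carrier R. \<forall>v\<in>carrier M. f (a \<odot>\<^bsub>M\<^esub> v) = a \<odot>\<^bsub>M'\<^esub> f v)}"

definition isomorphic_modules ::
  "('r, 'm) ring_scheme \<Rightarrow> ('r, 'v, 'n) module_scheme \<Rightarrow> ('r, 'w, 'l) module_scheme \<Rightarrow> bool" where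
  "isomorphic_modules R M M' \<longleftrightarrow> module_isos R M M' \<noteq> {}"

definition generates_module :: "('r, 'm) ring_scheme \<Rightarrow> ('r, 'v, 'n) module_scheme \<Rightarrow> 'v \<Rightarrow> bool" where
  "generates_module R M v \<longleftrightarrow> v \<in> carrier M \<and> {a \<odot>\<^bsub>M\<^esub> v | a. a \<in> carrier R} = carrier M"

definition maximal_submodule :: "('r, 'm) ring_scheme \<Rightarrow> ('r, 'v, 'n) module_scheme \<Rightarrow> 'v set \<Rightarrow> bool" where
  "maximal_submodule R M H \<longleftrightarrow> submodule H R M \<and> H \<noteq> carrier M \<and>
     (\<forall>H'. submodule H' R M \<and> H \<subseteq> H' \<and> H' \<noteq> carrier M \<longrightarrow> H' = H)"

definition quot_module :: "('r, 'v, 'n) module_scheme \<Rightarrow> 'v set \<Rightarrow> ('r, 'v set) module" where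
  "quot_module M H =
     \<lparr>carrier = a_rcosets\<^bsub>M\<^esub> H, monoid.mult = undefined, one = undefined, zero = H, add = set_add M,
      module.smult = (\<lambda>a X. \<Union>v\<in>X. H +>\<^bsub>M\<^esub> (a \<odot>\<^bsub>M\<^esub> v))\<rparr>"

text \<open>
  For a subring \<open>S\<close> of \<open>R\<close> and a left \<open>S\<close>-module \<open>V\<close>, the induced module
  \<open>R \<otimes>\<^sub>S V\<close> is the free abelian group on pairs \<open>(a, v)\<close> modulo biadditivity and
  \<open>S\<close>-balancedness; \<open>R\<close> acts on the first factor from the left.
\<close>

definition free_on_pairs ::
  "('r, 'm) ring_scheme \<Rightarrow> ('r, 'v, 'n) module_scheme \<Rightarrow> ('r, ('r \<times> 'v) \<Rightarrow>\<^sub>0 int) module" where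
  "free_on_pairs R V =
     \<lparr>carrier = {c. Poly_Mapping.keys c \<subseteq> carrier R \<times> carrier V},
      monoid.mult = undefined, one = undefined, zero = 0, add = (+),
      module.smult = (\<lambda>r. frag_extend (\<lambda>(a, v). frag_of (r \<otimes>\<^bsub>R\<^esub> a, v)))\<rparr>"

definition tensor_rels ::
  "('r, 'm) ring_scheme \<Rightarrow> 'r set \<Rightarrow> ('r, 'v, 'n) module_scheme \<Rightarrow> (('r \<times> 'v) \<Rightarrow>\<^sub>0 int) set" where
  "tensor_rels R S V =
     {frag_of (a \<oplus>\<^bsub>R\<^esub> b, v) - frag_of (a, v) - frag_of (b, v) | a b v.
        a \<in> carrier R \<and> b \<in> carrier R \<and> v \<in> carrier V} \<union>
     {frag_of (a, v \<oplus>\<^bsub>V\<^esub> w) - frag_of (a, v) - frag_of (a, w) | a v w.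
        a \<in> carrier R \<and> v \<in> carrier V \<and> w \<in> carrier V} \<union>
     {frag_of (a \<otimes>\<^bsub>R\<^esub> s, v) - frag_of (a, s \<odot>\<^bsub>V\<^esub> v) | a s v.
        a \<in> carrier R \<and> s \<in> S \<and> v \<in> carrier V}"

definition induced_module ::
  "('r, 'm) ring_scheme \<Rightarrow> 'r set \<Rightarrow> ('r, 'v, 'n) module_scheme \<Rightarrow> ('r, (('r \<times> 'v) \<Rightarrow>\<^sub>0 int) set) module" where
  "induced_module R S V =
     quot_module (free_on_pairs R V) (generate (add_monoid (free_on_pairs R V)) (tensor_rels R S V))"


section \<open>The algebra\<close>

datatype gen = X1 | X2 | Y1 | Y2 | K1 | K2

datatype word = Word "gen list"

text \<open>
  Words form a monoid under concatenation, written additively so that the convolution product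
  on \<^typ>\<open>word \<Rightarrow>\<^sub>0 'k\<close> is the free associative algebra on \<^typ>\<open>gen\<close>.
\<close>

instantiation word :: monoid_add
begin
definition zero_word :: word where "0 = Word []"
fun plus_word :: "word \<Rightarrow> word \<Rightarrow> word" where "Word u + Word v = Word (u @ v)"
instance
proof
  fix a b c :: word
  show "a + b + c = a + (b + c)" by (cases a; cases b; cases c) simp
  show "0 + a = a" by (cases a) (simp add: zero_word_def)
  show "a + 0 = a" by (cases a) (simp add: zero_word_def)
qed
end

type_synonym 'k falg = "word \<Rightarrow>\<^sub>0 'k"

definition fgen :: "gen \<Rightarrow> 'k::field falg" where
  "fgen g = Poly_Mapping.single (Word [g]) 1"

definition fconst :: "'k::field \<Rightarrow> 'k falg" where
  "fconst c = Poly_Mapping.single 0 c"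

definition type_ring :: "'a::ring_1 ring" where
  "type_ring = \<lparr>carrier = UNIV, monoid.mult = (*), one = 1, zero = 0, add = (+)\<rparr>"

text \<open>Here \<open>q\<close> has order \<open>N = 2n\<close>; a relation \<open>a = b\<close> is encoded as the element \<open>a - b\<close>.\<close>

definition uq_rels :: "'k::field \<Rightarrow> nat \<Rightarrow> 'k falg set" where
  "uq_rels q n =
    (let N = 2 * n; x1 = fgen X1; x2 = fgen X2; y1 = fgen Y1; y2 = fgen Y2;
         \<kappa>1 = fgen K1; \<kappa>2 = fgen K2; Q = fconst q; Q' = fconst (inverse q)
     in {\<kappa>1 * \<kappa>2 - \<kappa>2 * \<kappa>1, \<kappa>1 ^ N - 1, \<kappa>2 ^ N - 1,
         \<kappa>1 * x1 - Q * x1 * \<kappa>1, \<kappa>1 * x2 - x2 * \<kappa>1,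
         \<kappa>2 * x1 - x1 * \<kappa>2, \<kappa>2 * x2 - Q * x2 * \<kappa>2,
         \<kappa>1 * y1 - Q' * y1 * \<kappa>1, \<kappa>1 * y2 - y2 * \<kappa>1,
         \<kappa>2 * y1 - y1 * \<kappa>2, \<kappa>2 * y2 - Q' * y2 * \<kappa>2,
         x1 ^ 2, x2 ^ 2, (x1 * x2) ^ N + (x2 * x1) ^ N,
         y1 ^ 2, y2 ^ 2, (y1 * y2) ^ N + (y2 * y1) ^ N,
         y1 * x1 + x1 * y1 - (1 - \<kappa>2), y2 * x2 + x2 * y2 - (1 - \<kappa>1),
         y2 * x1 - Q * x1 * y2, y1 * x2 - x2 * y1})"

definition uq_ideal :: "'k::field \<Rightarrow> nat \<Rightarrow> 'k falg set" where
  "uq_ideal q n = genideal type_ring (uq_rels q n)"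

definition uq :: "'k::field \<Rightarrow> nat \<Rightarrow> ('k falg set) ring" where
  "uq q n = type_ring Quot (uq_ideal q n)"

definition uq_of :: "'k::field \<Rightarrow> nat \<Rightarrow> 'k falg \<Rightarrow> 'k falg set" where
  "uq_of q n p = uq_ideal q n +>\<^bsub>type_ring\<^esub> p"

definition uq_scalar :: "'k::field \<Rightarrow> nat \<Rightarrow> 'k \<Rightarrow> 'k falg set" where
  "uq_scalar q n c = uq_of q n (fconst c)"

definition uq_gen :: "'k::field \<Rightarrow> nat \<Rightarrow> gen \<Rightarrow> 'k falg set" where
  "uq_gen q n g = uq_of q n (fgen g)"

definition uq_plus :: "'k::field \<Rightarrow> nat \<Rightarrow> 'k falg set set" where
  "uq_plus q n = generate_ring (uq q n) (range (uq_scalar q n) \<union> uq_gen q n ` {X1, X2, K1, K2})"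

text \<open>
  Algebra homomorphisms to the ground field from a subalgebra \<open>A\<close>, taken extensional
  so that such a homomorphism is determined by its values on \<open>A\<close>.
\<close>

definition characters :: "'k::field \<Rightarrow> nat \<Rightarrow> 'k falg set set \<Rightarrow> ('k falg set \<Rightarrow> 'k) set" where
  "characters q n A =
     {\<chi> \<in> ring_hom ((uq q n)\<lparr>carrier := A\<rparr>) type_ring \<inter> extensional A. \<forall>c. \<chi> (uq_scalar q n c) = c}"

definition character_module :: "('r \<Rightarrow> 'k::field) \<Rightarrow> ('r, 'k) module" where
  "character_module \<chi> =
     \<lparr>carrier = UNIV, monoid.mult = undefined, one = undefined, zero = 0, add = (+), module.smult = (\<lambda>a c. \<chi> a * c)\<rparr>"

text \<open>
  The coproduct of a generator as a list of pure tensors. Its only use is the counit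
  \<open>\<epsilon>\<close>, i.e. the algebra map with \<open>(\<epsilon> \<otimes> id) \<Delta> = id = (id \<otimes> \<epsilon>) \<Delta>\<close>
  (an identity of algebra maps, hence to be imposed on generators only), through which the algebra
  acts on the unit object of its module category.
\<close>

fun coproduct_gen :: "nat \<Rightarrow> gen \<Rightarrow> ('k::field falg \<times> 'k falg) list" where
  "coproduct_gen n K1 = [(fgen K1, fgen K1)]"
| "coproduct_gen n K2 = [(fgen K2, fgen K2)]"
| "coproduct_gen n X1 = [(fgen X1, 1), (fgen K1 ^ n * fgen K2, fgen X1)]"
| "coproduct_gen n X2 = [(fgen X2, 1), (fgen K2 ^ n, fgen X2)]"
| "coproduct_gen n Y1 = [(fgen Y1, 1), (fgen K1 ^ n, fgen Y1)]"
| "coproduct_gen n Y2 = [(fgen Y2, 1), (fgen K1 * fgen K2 ^ n, fgen Y2)]"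

definition counit :: "'k::field \<Rightarrow> nat \<Rightarrow> 'k falg set \<Rightarrow> 'k" where
  "counit q n = (THE \<epsilon>. \<epsilon> \<in> characters q n (carrier (uq q n)) \<and>
     (\<forall>g. uq_of q n (\<Sum>(a, b)\<leftarrow>coproduct_gen n g. fconst (\<epsilon> (uq_of q n a)) * b) = uq_gen q n g \<and>
          uq_of q n (\<Sum>(a, b)\<leftarrow>coproduct_gen n g. fconst (\<epsilon> (uq_of q n b)) * a) = uq_gen q n g))"

definition tensor_unit :: "'k::field \<Rightarrow> nat \<Rightarrow> ('k falg set, 'k) module" where
  "tensor_unit q n = character_module (counit q n)"


section \<open>Weights, bases, standard and simple modules\<close>

definition act :: "'k::field \<Rightarrow> nat \<Rightarrow> ('k falg set, 'v, 'm) module_scheme \<Rightarrow> gen \<Rightarrow> 'v \<Rightarrow> 'v" where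
  "act q n M g v = uq_gen q n g \<odot>\<^bsub>M\<^esub> v"

text \<open>
  Weights in \<open>(\<int>/N)\<^sup>2\<close> are given by integer representatives, which is harmless since
  \<open>q\<close> has order \<open>N\<close>.
\<close>

definition has_weight ::
  "'k::field \<Rightarrow> nat \<Rightarrow> ('k falg set, 'v, 'm) module_scheme \<Rightarrow> 'v \<Rightarrow> int \<times> int \<Rightarrow> bool" where
  "has_weight q n M v d \<longleftrightarrow> v \<in> carrier M \<and>
     act q n M K1 v = uq_scalar q n (q powi fst d) \<odot>\<^bsub>M\<^esub> v \<and>
     act q n M K2 v = uq_scalar q n (q powi snd d) \<odot>\<^bsub>M\<^esub> v"

definition highest_weight_vector ::
  "'k::field \<Rightarrow> nat \<Rightarrow> ('k falg set, 'v, 'm) module_scheme \<Rightarrow> 'v \<Rightarrow> bool" where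
  "highest_weight_vector q n M v \<longleftrightarrow> v \<noteq> \<zero>\<^bsub>M\<^esub> \<and> (\<exists>d. has_weight q n M v d) \<and>
     act q n M X1 v = \<zero>\<^bsub>M\<^esub> \<and> act q n M X2 v = \<zero>\<^bsub>M\<^esub>"

definition is_basis ::
  "'k::field \<Rightarrow> nat \<Rightarrow> ('k falg set, 'v, 'm) module_scheme \<Rightarrow> 'i set \<Rightarrow> ('i \<Rightarrow> 'v) \<Rightarrow> bool" where
  "is_basis q n M I w \<longleftrightarrow> finite I \<and> w \<in> I \<rightarrow> carrier M \<and>
     (\<forall>v\<in>carrier M. \<exists>!c. c \<in> extensional I \<and> v = (\<Oplus>\<^bsub>M\<^esub>s\<in>I. uq_scalar q n (c s) \<odot>\<^bsub>M\<^esub> w s))"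

definition one_dimensional :: "'k::field \<Rightarrow> nat \<Rightarrow> ('k falg set, 'v, 'm) module_scheme \<Rightarrow> bool" where
  "one_dimensional q n M \<longleftrightarrow> (\<exists>w. is_basis q n M {0::nat} w)"

definition weight_character :: "'k::field \<Rightarrow> nat \<Rightarrow> nat \<Rightarrow> nat \<Rightarrow> 'k falg set \<Rightarrow> 'k" where
  "weight_character q n i j = (THE \<chi>. \<chi> \<in> characters q n (uq_plus q n) \<and>
     \<chi> (uq_gen q n X1) = 0 \<and> \<chi> (uq_gen q n X2) = 0 \<and>
     \<chi> (uq_gen q n K1) = q ^ i \<and> \<chi> (uq_gen q n K2) = q ^ j)"

definition standard_module ::
  "'k::field \<Rightarrow> nat \<Rightarrow> nat \<Rightarrow> nat \<Rightarrow> ('k falg set, (('k falg set \<times> 'k) \<Rightarrow>\<^sub>0 int) set) module" where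
  "standard_module q n i j =
     induced_module (uq q n) (uq_plus q n) (character_module (weight_character q n i j))"

definition standard_radical ::
  "'k::field \<Rightarrow> nat \<Rightarrow> nat \<Rightarrow> nat \<Rightarrow> (('k falg set \<times> 'k) \<Rightarrow>\<^sub>0 int) set set" where
  "standard_radical q n i j = (THE H. maximal_submodule (uq q n) (standard_module q n i j) H)"

definition simple_L ::
  "'k::field \<Rightarrow> nat \<Rightarrow> nat \<Rightarrow> nat \<Rightarrow> ('k falg set, (('k falg set \<times> 'k) \<Rightarrow>\<^sub>0 int) set set) module" where
  "simple_L q n i j = quot_module (standard_module q n i j) (standard_radical q n i j)"

definition standard_proj ::
  "'k::field \<Rightarrow> nat \<Rightarrow> nat \<Rightarrow> nat \<Rightarrow> (('k falg set \<times> 'k) \<Rightarrow>\<^sub>0 int) set \<Rightarrow> (('k falg set \<times> 'k) \<Rightarrow>\<^sub>0 int) set set" where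
  "standard_proj q n i j v = standard_radical q n i j +>\<^bsub>standard_module q n i j\<^esub> v"

definition maps_nonzero ::
  "'k::field \<Rightarrow> nat \<Rightarrow> ('k falg set, 'v, 'm) module_scheme \<Rightarrow> gen \<Rightarrow> 'v \<Rightarrow> int \<times> int \<Rightarrow> bool" where
  "maps_nonzero q n M g v d \<longleftrightarrow> act q n M g v \<noteq> \<zero>\<^bsub>M\<^esub> \<and> has_weight q n M (act q n M g v) d"

end

theory Submission
  imports Defs
begin

text \<open>
  A cyclic module is the free algebra modulo a left ideal \<open>I\<close> containing the defining relations,
  so everything is computed with congruences modulo \<open>I\<close>. If a highest weight vector generates,
  every element is congruent to a combination of words in \<open>y\<^sub>1, y\<^sub>2\<close>, and combinations without
  constant term are nilpotent. Hence proper left ideals contain no element with non-zero constant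
  term, so there is a greatest one, and in a simple module an element below the highest weight
  vector that is killed by \<open>x\<^sub>1, x\<^sub>2\<close> must vanish. The action of \<open>x\<^sub>1, x\<^sub>2\<close> on the alternating
  words \<open>(y\<^sub>2 y\<^sub>1)\<^sup>m\<close>, \<open>(y\<^sub>1 y\<^sub>2)\<^sup>m\<close>, \<open>y\<^sub>1 (y\<^sub>2 y\<^sub>1)\<^sup>m\<close>, \<open>y\<^sub>2 (y\<^sub>1 y\<^sub>2)\<^sup>m\<close> is explicit, and its
  degeneracies (the determinant vanishes exactly at \<open>m = i + j\<close> modulo \<open>N\<close>) give the bases. That
  standard modules are non-zero follows from an explicit representation with a vector of
  weight \<open>(i, j)\<close>.
\<close>

section \<open>The free algebra and left ideals\<close>

text \<open>Abstract simple modules, quotients of induced modules and the field itself have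
  different types. They are compared only through the annihilator of a generator, which is always a
  left ideal of the same free algebra: isomorphism becomes equality of left ideals. Two obstacles
  shape the argument. Weights live modulo N, so they cannot separate a highest weight vector from
  what lies below it: for i + j = N the lowest vector has the weight of the highest one. Word length
  takes over this task; long words vanish, so 1 is never congruent to a combination of non-empty
  words unless the quotient is zero. Secondly, the relations bound a module only from above, and a
  spanning set of words might still collapse. Lower bounds come from climbing back up: x1 and x2
  take alternating words to shorter ones with explicit scalars, and as long as these (or a 2 by 2
  determinant of them) are non-zero, non-vanishing is inherited from the highest weight
  vector.\<close>

lemma poly_mapping_sum_single:
  fixes p :: "'a \<Rightarrow>\<^sub>0 'b::comm_monoid_add"
  shows "p = (\<Sum>w\<in>Poly_Mapping.keys p. Poly_Mapping.single w (Poly_Mapping.lookup p w))"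
proof (rule poly_mapping_eqI)
  fix k
  show "Poly_Mapping.lookup p k =
      Poly_Mapping.lookup (\<Sum>w\<in>Poly_Mapping.keys p. Poly_Mapping.single w (Poly_Mapping.lookup p w)) k"
    by (auto simp: lookup_sum lookup_single when_def in_keys_iff if_distrib sum.If_cases
        intro!: sum.cong)
qed

text \<open>The \<open>single\<close> case keeps the membership of \<open>w\<close> in the keys of
  \<open>p\<close>, so that facts known only for the words of \<open>p\<close>, such as their
  letters or their length, remain available.\<close>

lemma poly_mapping_span_induct:
  fixes p :: "'a \<Rightarrow>\<^sub>0 'b::comm_monoid_add"
  assumes zero: "P 0"
    and add: "\<And>a b. P a \<Longrightarrow> P b \<Longrightarrow> P (a + b)"
    and single: "\<And>w c. w \<in> Poly_Mapping.keys p \<Longrightarrow> P (Poly_Mapping.single w c)"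
  shows "P p"
proof -
  have "P (\<Sum>w\<in>S. Poly_Mapping.single w (Poly_Mapping.lookup p w))"
    if "finite S" "S \<subseteq> Poly_Mapping.keys p" for S
    using that by (induction S) (auto intro: zero add single)
  from this[OF finite_keys subset_refl] show ?thesis
    using poly_mapping_sum_single[of p] by simp
qed

text \<open>A constant of its own, so that rewriting can collect scalars in front without touching
  the order of noncommutative products.\<close>

definition scale :: "'k::field \<Rightarrow> 'k falg \<Rightarrow> 'k falg" where
  "scale c p = fconst c * p"

lemma fconst_central: "fconst c * p = p * fconst c"
proof -
  have "fconst c * (a + b) = (a + b) * fconst c"
    if "fconst c * a = a * fconst c" "fconst c * b = b * fconst c" for a b
    using that by (simp add: algebra_simps)
  then show ?thesis
    by (rule poly_mapping_span_induct[rotated 1]) (auto simp: fconst_def mult_single mult.commute)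
qed

lemma fconst_simps:
  "fconst (a + b) = fconst a + fconst b" "fconst (a - b) = fconst a - fconst b"
  "fconst (a * b) = fconst a * fconst b" "fconst 0 = 0" "fconst 1 = 1" "fconst (- a) = - fconst a"
  by (auto simp: fconst_def single_add single_diff mult_single single_uminus)

lemma scale_mult_left: "scale c p * r = scale c (p * r)"
  and scale_mult_right: "p * scale c r = scale c (p * r)"
  by (metis scale_def mult.assoc) (metis scale_def mult.assoc fconst_central)

lemma scale_simps [simp]:
  "scale c (a + b) = scale c a + scale c b" "scale c (a - b) = scale c a - scale c b"
  "scale c (- a) = - scale c a"
  "scale c (scale d a) = scale (c * d) a" "scale 0 a = 0" "scale 1 a = a" "scale c 0 = 0"
  "scale (- c) a = - scale c a"
  by (auto simp: scale_def algebra_simps fconst_simps)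

lemma scale_add_left: "scale (c + d) a = scale c a + scale d a"
  and scale_diff_left: "scale (c - d) a = scale c a - scale d a"
  by (auto simp: scale_def algebra_simps fconst_simps)

lemma scale_sum: "scale c (sum f S) = (\<Sum>s\<in>S. scale c (f s))"
  by (simp add: scale_def sum_distrib_left)

lemma scale_sum_left: "scale (sum f S) p = (\<Sum>s\<in>S. scale (f s) p)"
  by (induction S rule: infinite_finite_induct) (auto simp: scale_add_left)

lemma scale_single: "scale c (Poly_Mapping.single w d) = Poly_Mapping.single w (c * d)"
  by (simp add: scale_def fconst_def mult_single)

lemma single_word_Cons:
  "Poly_Mapping.single (Word (g # u)) c = fgen g * (Poly_Mapping.single (Word u) c)"
  by (simp add: fgen_def mult_single)

lemma single_word_Nil: "Poly_Mapping.single (Word []) c = scale c 1"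
  by (simp add: scale_def fconst_def zero_word_def)

text \<open>Induction over the left module generated by \<open>z\<close>: a word acts on
  \<open>z\<close> one letter at a time, starting with its last letter.\<close>

lemma falg_left_induct:
  assumes base: "P z"
    and add: "\<And>a b. P a \<Longrightarrow> P b \<Longrightarrow> P (a + b)"
    and scale: "\<And>c a. P a \<Longrightarrow> P (scale c a)"
    and gen: "\<And>g a. P a \<Longrightarrow> P (fgen g * a)"
  shows "P (p * z)"
proof -
  have *: "P (Poly_Mapping.single (Word u) c * z)" for u c
    by (induction u)
      (auto simp: single_word_Cons single_word_Nil scale_mult_left mult.assoc intro: base scale gen)
  have "P (0 * z)" using scale[OF base, of 0] by simp
  then show ?thesis
    by (rule poly_mapping_span_induct[where P = "\<lambda>p. P (p * z)"])
      (auto simp: distrib_right intro: add *[of "case w of Word u \<Rightarrow> u" for w, simplified] split: word.splits,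
        metis * word.exhaust)
qed

section \<open>Left ideals and maximal left ideals\<close>

definition left_ideal :: "'a::ring_1 set \<Rightarrow> bool" where
  "left_ideal I \<longleftrightarrow> 0 \<in> I \<and> (\<forall>a\<in>I. \<forall>b\<in>I. a + b \<in> I) \<and> (\<forall>p. \<forall>a\<in>I. p * a \<in> I)"

lemma left_idealD:
  assumes "left_ideal I"
  shows "0 \<in> I" "a \<in> I \<Longrightarrow> b \<in> I \<Longrightarrow> a + b \<in> I" "a \<in> I \<Longrightarrow> p * a \<in> I" "a \<in> I \<Longrightarrow> - a \<in> I"
    "a \<in> I \<Longrightarrow> b \<in> I \<Longrightarrow> a - b \<in> I"
proof -
  show 1: "0 \<in> I" "a \<in> I \<Longrightarrow> b \<in> I \<Longrightarrow> a + b \<in> I" "a \<in> I \<Longrightarrow> p * a \<in> I" for a b p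
    using assms unfolding left_ideal_def by blast+
  show 2: "a \<in> I \<Longrightarrow> - a \<in> I" for a using 1(3)[of a "- 1"] by simp
  show "a \<in> I \<Longrightarrow> b \<in> I \<Longrightarrow> a - b \<in> I" using 1(2)[of a "- b"] 2[of b] by simp
qed

lemma left_ideal_scale: "left_ideal I \<Longrightarrow> a \<in> I \<Longrightarrow> scale c a \<in> I"
  by (simp add: scale_def left_idealD)

lemma left_ideal_scaleD: "left_ideal I \<Longrightarrow> scale c a \<in> I \<Longrightarrow> c \<noteq> 0 \<Longrightarrow> a \<in> I"
  using left_ideal_scale[of I "scale c a" "inverse c"] by simp

lemma left_ideal_sum: "left_ideal I \<Longrightarrow> (\<And>s. s \<in> S \<Longrightarrow> f s \<in> I) \<Longrightarrow> sum f S \<in> I"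
  by (induction S rule: infinite_finite_induct) (auto simp: left_idealD)

lemma left_ideal_UNIV: "left_ideal I \<Longrightarrow> 1 \<in> I \<Longrightarrow> p \<in> I"
  using left_idealD(3)[of I 1 p] by simp

text \<open>This is the annihilator of the class of \<open>z\<close> in the quotient by
  \<open>I\<close>; it transfers statements about the generator 1 to any other vector
  \<open>z\<close>.\<close>

lemma left_ideal_colon: "left_ideal I \<Longrightarrow> left_ideal {p. p * z \<in> I}"
  by (auto simp: left_ideal_def distrib_right mult.assoc)

definition maximal_left_ideal :: "'a::ring_1 set \<Rightarrow> bool" where
  "maximal_left_ideal I \<longleftrightarrow> left_ideal I \<and> 1 \<notin> I \<and> (\<forall>I'. left_ideal I' \<and> I \<subseteq> I' \<and> 1 \<notin> I' \<longrightarrow> I' = I)"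

text \<open>In a simple quotient every non-zero vector generates, so some multiple of
  \<open>z\<close> is congruent to 1.\<close>

lemma maximal_left_ideal_generate:
  assumes "maximal_left_ideal I" "z \<notin> I"
  obtains p where "p * z - 1 \<in> I"
proof -
  have I: "left_ideal I" and max: "\<And>I'. left_ideal I' \<Longrightarrow> I \<subseteq> I' \<Longrightarrow> 1 \<notin> I' \<Longrightarrow> I' = I"
    using assms by (auto simp: maximal_left_ideal_def)
  \<comment> \<open>Everything congruent modulo \<open>I\<close> to a left multiple of
    \<open>z\<close>, that is, the preimage of the submodule generated by \<open>z\<close>.\<close>
  let ?I' = "{x. \<exists>p. p * z - x \<in> I}"
  have "left_ideal ?I'"
    unfolding left_ideal_def
  proof (intro conjI ballI allI)
    show "0 \<in> ?I'" using I by (auto simp: left_idealD intro!: exI[of _ 0])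
    fix a b assume "a \<in> ?I'" "b \<in> ?I'"
    then obtain p r where "p * z - a \<in> I" "r * z - b \<in> I" by auto
    from left_idealD(2)[OF I this] show "a + b \<in> ?I'"
      by (auto intro!: exI[of _ "p + r"] simp: algebra_simps)
  next
    fix r a assume "a \<in> ?I'"
    then obtain p where "p * z - a \<in> I" by auto
    from left_idealD(3)[OF I this, of r] show "r * a \<in> ?I'"
      by (auto intro!: exI[of _ "r * p"] simp: algebra_simps)
  qed
  moreover have "I \<subseteq> ?I'" using I by (auto intro!: exI[of _ 0] simp: left_idealD)
  moreover have "z \<in> ?I'" using I by (auto intro!: exI[of _ 1] simp: left_idealD)
  ultimately have "1 \<in> ?I'" using max[of ?I'] assms(2) by blast
  then show thesis using that by auto
qed

section \<open>The quotient algebra\<close>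

lemma ring_type_ring: "ring (type_ring :: 'a::ring_1 ring)"
proof (rule ringI)
  show "abelian_group (type_ring :: 'a ring)"
    by (rule abelian_groupI) (auto simp: type_ring_def add_ac intro: exI[of _ "- x" for x])
  show "Group.monoid (type_ring :: 'a ring)"
    by (rule monoidI) (auto simp: type_ring_def mult.assoc)
qed (auto simp: type_ring_def algebra_simps)

lemma carrier_type_ring [simp]: "carrier type_ring = UNIV"
  and add_type_ring [simp]: "x \<oplus>\<^bsub>type_ring\<^esub> y = x + y"
  and mult_type_ring [simp]: "x \<otimes>\<^bsub>type_ring\<^esub> y = x * y"
  and one_type_ring [simp]: "\<one>\<^bsub>type_ring\<^esub> = 1"
  and zero_type_ring [simp]: "\<zero>\<^bsub>type_ring\<^esub> = 0"
  by (auto simp: type_ring_def)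

lemma a_inv_type_ring [simp]: "\<ominus>\<^bsub>type_ring\<^esub> x = - (x :: 'a::ring_1)"
proof -
  interpret ring "type_ring :: 'a ring" by (rule ring_type_ring)
  show ?thesis using minus_equality[of "- x" x] by simp
qed

lemma ideal_type_ringI:
  fixes I :: "'a::ring_1 set"
  assumes "left_ideal I" "\<And>a p. a \<in> I \<Longrightarrow> a * p \<in> I"
  shows "ideal I type_ring"
proof (rule idealI)
  show "ring (type_ring :: 'a ring)" by (rule ring_type_ring)
  show "subgroup I (add_monoid type_ring)"
  proof (rule group.subgroupI[OF abelian_group.a_group[OF ring.is_abelian_group[OF ring_type_ring]]])
    show "I \<noteq> {}" using left_idealD(1)[OF assms(1)] by auto
    show "inv\<^bsub>add_monoid type_ring\<^esub> a \<in> I" if "a \<in> I" for a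
      unfolding a_inv_def[symmetric] using that left_idealD(4)[OF assms(1)] by simp
    show "a \<otimes>\<^bsub>add_monoid type_ring\<^esub> b \<in> I" if "a \<in> I" "b \<in> I" for a b
      using left_idealD(2)[OF assms(1) that] by simp
  qed auto
qed (auto simp: left_idealD[OF assms(1)] assms(2))

lemma ideal_uq_ideal: "ideal (uq_ideal q n) type_ring"
  unfolding uq_ideal_def by (rule ring.genideal_ideal[OF ring_type_ring]) auto

lemma uq_rels_ideal: "r \<in> uq_rels q n \<Longrightarrow> r \<in> uq_ideal q n"
  unfolding uq_ideal_def using ring.genideal_self[OF ring_type_ring, of "uq_rels q n"] by auto

lemma left_ideal_uq_ideal: "left_ideal (uq_ideal q n)"
  and uq_ideal_right: "a \<in> uq_ideal q n \<Longrightarrow> a * p \<in> uq_ideal q n"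
proof -
  interpret ideal "uq_ideal q n" type_ring by (rule ideal_uq_ideal)
  show "left_ideal (uq_ideal q n)"
    unfolding left_ideal_def
    using I_l_closed additive_subgroup.zero_closed[OF is_additive_subgroup]
      additive_subgroup.a_closed[OF is_additive_subgroup] by auto
  show "a \<in> uq_ideal q n \<Longrightarrow> a * p \<in> uq_ideal q n" using I_r_closed[of a p] by auto
qed

lemma uq_ideal_minimal:
  assumes "left_ideal I" "\<And>a p. a \<in> I \<Longrightarrow> a * p \<in> I" "uq_rels q n \<subseteq> I"
  shows "uq_ideal q n \<subseteq> I"
  unfolding uq_ideal_def
  by (rule ring.genideal_minimal[OF ring_type_ring]) (use assms ideal_type_ringI in auto)

lemma ring_uq: "ring (uq q n)"
  unfolding uq_def by (rule ideal.quotient_is_ring[OF ideal_uq_ideal])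

lemma uq_of_eq: "uq_of q n p = (\<lambda>x. x + p) ` uq_ideal q n"
  by (auto simp: uq_of_def a_r_coset_def')

lemma uq_of_eq_iff: "uq_of q n p = uq_of q n r \<longleftrightarrow> p - r \<in> uq_ideal q n"
proof
  note J = left_idealD[OF left_ideal_uq_ideal[of q n]]
  assume "uq_of q n p = uq_of q n r"
  moreover have "p \<in> uq_of q n p" unfolding uq_of_eq using J(1) by force
  ultimately obtain x where "x \<in> uq_ideal q n" "p = x + r" unfolding uq_of_eq by auto
  then show "p - r \<in> uq_ideal q n" by simp
next
  note J = left_idealD[OF left_ideal_uq_ideal[of q n]]
  assume *: "p - r \<in> uq_ideal q n"
  show "uq_of q n p = uq_of q n r"
    unfolding uq_of_eq
  proof (intro equalityI subsetI; clarify)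
    fix x assume "x \<in> uq_ideal q n"
    from J(2)[OF this *] show "x + p \<in> (\<lambda>x. x + r) ` uq_ideal q n"
      by (rule rev_image_eqI) simp
  next
    fix x assume "x \<in> uq_ideal q n"
    from J(5)[OF this *] show "x + r \<in> (\<lambda>x. x + p) ` uq_ideal q n"
      by (rule rev_image_eqI) simp
  qed
qed

lemma carrier_uq: "carrier (uq q n) = range (uq_of q n)"
  by (auto simp: uq_def FactRing_def A_RCOSETS_def' uq_of_def)

lemma uq_of_closed [simp, intro]: "uq_of q n p \<in> carrier (uq q n)"
  by (simp add: carrier_uq)

lemma uq_of_hom: "uq_of q n \<in> ring_hom type_ring (uq q n)"
  unfolding uq_of_def uq_def using ideal.rcos_ring_hom[OF ideal_uq_ideal] by auto

lemma uq_of_add: "uq_of q n (a + b) = uq_of q n a \<oplus>\<^bsub>uq q n\<^esub> uq_of q n b"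
  and uq_of_mult: "uq_of q n (a * b) = uq_of q n a \<otimes>\<^bsub>uq q n\<^esub> uq_of q n b"
  using ring_hom_add[OF uq_of_hom, of a b] ring_hom_mult[OF uq_of_hom, of a b] by auto

lemma uq_of_one: "uq_of q n 1 = \<one>\<^bsub>uq q n\<^esub>"
  using ring_hom_one[OF uq_of_hom, of q n] by simp

lemma uq_of_zero: "uq_of q n 0 = \<zero>\<^bsub>uq q n\<^esub>"
  by (simp add: uq_of_eq uq_def FactRing_def)

lemma uq_of_uminus: "uq_of q n (- a) = \<ominus>\<^bsub>uq q n\<^esub> uq_of q n a"
proof -
  interpret ring "uq q n" by (rule ring_uq)
  show ?thesis using minus_equality[of "uq_of q n (- a)" "uq_of q n a"]
    by (simp flip: uq_of_add uq_of_zero)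
qed

lemma uq_scalar_eq: "uq_scalar q n c = uq_of q n (scale c 1)"
  by (simp add: uq_scalar_def scale_def)

section \<open>A highest weight representation\<close>

fun word_act :: "(gen \<Rightarrow> ('x \<Rightarrow> 'k::field) \<Rightarrow> 'x \<Rightarrow> 'k) \<Rightarrow> word \<Rightarrow> ('x \<Rightarrow> 'k) \<Rightarrow> 'x \<Rightarrow> 'k" where
  "word_act \<rho> (Word u) = foldr \<rho> u"

definition falg_act :: "(gen \<Rightarrow> ('x \<Rightarrow> 'k::field) \<Rightarrow> 'x \<Rightarrow> 'k) \<Rightarrow> 'k falg \<Rightarrow> ('x \<Rightarrow> 'k) \<Rightarrow> 'x \<Rightarrow> 'k" where
  "falg_act \<rho> p f x = (\<Sum>w\<in>Poly_Mapping.keys p. Poly_Mapping.lookup p w * word_act \<rho> w f x)"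

text \<open>The keys over which \<open>falg_act\<close> sums change under addition; a common finite
  superset makes the sums comparable.\<close>

lemma falg_act_superset:
  assumes "finite S" "Poly_Mapping.keys p \<subseteq> S"
  shows "falg_act \<rho> p f x = (\<Sum>w\<in>S. Poly_Mapping.lookup p w * word_act \<rho> w f x)"
  unfolding falg_act_def by (rule sum.mono_neutral_left) (use assms in \<open>auto simp: in_keys_iff\<close>)

lemma falg_act_add: "falg_act \<rho> (a + b) f = (\<lambda>x. falg_act \<rho> a f x + falg_act \<rho> b f x)"
proof
  fix x
  let ?S = "Poly_Mapping.keys a \<union> Poly_Mapping.keys b"
  show "falg_act \<rho> (a + b) f x = falg_act \<rho> a f x + falg_act \<rho> b f x"
    using keys_add[of a b]
    by (simp add: falg_act_superset[of ?S] lookup_add distrib_right sum.distrib)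
qed

lemma falg_act_single:
  "falg_act \<rho> (Poly_Mapping.single w c) f = (\<lambda>x. c * word_act \<rho> w f x)"
  by (rule ext) (simp add: falg_act_superset[of "{w}"])

lemma falg_act_zero: "falg_act \<rho> 0 f = (\<lambda>x. 0)"
  by (rule ext) (simp add: falg_act_def)

lemma falg_act_diff: "falg_act \<rho> (a - b) f = (\<lambda>x. falg_act \<rho> a f x - falg_act \<rho> b f x)"
  using falg_act_add[of \<rho> "a - b" b f] by (auto simp: fun_eq_iff)

lemma falg_act_fconst: "falg_act \<rho> (fconst c) f = (\<lambda>x. c * f x)"
  by (simp add: fconst_def falg_act_single zero_word_def)

lemma falg_act_one: "falg_act \<rho> 1 f = f"
  using falg_act_fconst[of \<rho> 1 f] by (simp add: fconst_simps)

lemma falg_act_fgen: "falg_act \<rho> (fgen g) f = \<rho> g f"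
  by (simp add: fgen_def falg_act_single)

locale falg_rep =
  fixes \<rho> :: "gen \<Rightarrow> ('x \<Rightarrow> 'k::field) \<Rightarrow> 'x \<Rightarrow> 'k"
  assumes gen_add: "\<rho> g (\<lambda>x. f x + f' x) = (\<lambda>x. \<rho> g f x + \<rho> g f' x)"
    and gen_scale: "\<rho> g (\<lambda>x. c * f x) = (\<lambda>x. c * \<rho> g f x)"
begin

text \<open>Linearity reduces the first factor to a word, which is then peeled letter by letter; the
  case of one letter is itself reduced by linearity in the second factor.\<close>

lemma act_mult: "falg_act \<rho> (p * z) f = falg_act \<rho> p (falg_act \<rho> z f)"
proof -
  have gen: "falg_act \<rho> (fgen g * a) f = \<rho> g (falg_act \<rho> a f)" for g a f
  proof (rule poly_mapping_span_induct[of "\<lambda>a. falg_act \<rho> (fgen g * a) f = \<rho> g (falg_act \<rho> a f)"])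
    show "falg_act \<rho> (fgen g * 0) f = \<rho> g (falg_act \<rho> 0 f)"
      using gen_scale[of g 0 f] by (simp add: falg_act_zero)
  next
    fix w c
    show "falg_act \<rho> (fgen g * Poly_Mapping.single w c) f = \<rho> g (falg_act \<rho> (Poly_Mapping.single w c) f)"
      by (cases w) (simp add: falg_act_single gen_scale flip: single_word_Cons)
  qed (simp add: distrib_left falg_act_add gen_add)
  have word: "falg_act \<rho> (Poly_Mapping.single (Word u) c * z) f =
      falg_act \<rho> (Poly_Mapping.single (Word u) c) (falg_act \<rho> z f)" for u c
  proof (induction u)
    case Nil
    have "Poly_Mapping.single (Word []) c * z = fconst c * z"
      by (simp add: fconst_def zero_word_def)
    moreover have "falg_act \<rho> (fconst c * z) f = (\<lambda>x. c * falg_act \<rho> z f x)"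
    proof (rule poly_mapping_span_induct[of "\<lambda>z. falg_act \<rho> (fconst c * z) f = (\<lambda>x. c * falg_act \<rho> z f x)"])
    qed (auto simp: falg_act_zero distrib_left falg_act_add fconst_def mult_single falg_act_single)
    ultimately show ?case by (simp add: falg_act_single)
  next
    case (Cons g u)
    show ?case unfolding single_word_Cons mult.assoc gen Cons ..
  qed
  show ?thesis
  proof (rule poly_mapping_span_induct[of "\<lambda>p. falg_act \<rho> (p * z) f = falg_act \<rho> p (falg_act \<rho> z f)"])
    fix w c
    show "falg_act \<rho> (Poly_Mapping.single w c * z) f = falg_act \<rho> (Poly_Mapping.single w c) (falg_act \<rho> z f)"
      by (cases w) (simp add: word)
  qed (simp_all add: falg_act_zero distrib_right falg_act_add)
qed

lemma act_zero: "falg_act \<rho> p (\<lambda>x. 0) = (\<lambda>x. 0)"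
proof -
  have "falg_act \<rho> p (falg_act \<rho> 0 (\<lambda>x. 0)) = (\<lambda>x. 0)"
    by (simp only: act_mult[symmetric]) (simp add: falg_act_zero)
  then show ?thesis by (simp add: falg_act_zero)
qed

lemma act_power: "falg_act \<rho> (p ^ k) f = (falg_act \<rho> p ^^ k) f"
  by (induction k) (auto simp: falg_act_one act_mult)

text \<open>The elements that act as zero on every function form a two-sided ideal, so it suffices
  that the relations act as zero.\<close>

lemma act_uq_ideal:
  assumes "\<And>r f. r \<in> uq_rels q n \<Longrightarrow> falg_act \<rho> r f = (\<lambda>x. 0)" "a \<in> uq_ideal q n"
  shows "falg_act \<rho> a f = (\<lambda>x. 0)"
proof -
  let ?I = "{a. \<forall>f. falg_act \<rho> a f = (\<lambda>x. 0)}"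
  have "uq_ideal q n \<subseteq> ?I"
    by (rule uq_ideal_minimal)
      (auto simp: left_ideal_def falg_act_zero falg_act_add act_mult act_zero assms(1))
  then show ?thesis using assms(2) by auto
qed

end

text \<open>With \<open>t = y\<^sub>1 y\<^sub>2 + y\<^sub>2 y\<^sub>1\<close>, which is central among the \<open>y\<close>'s, the coordinates
  \<open>CE, CP, CR, CS\<close> belong to the vectors \<open>t\<^sup>m v\<close>, \<open>t\<^sup>m y\<^sub>1 v\<close>, \<open>t\<^sup>m y\<^sub>2 v\<close>, \<open>t\<^sup>m y\<^sub>1 y\<^sub>2 v\<close>
  of the standard module with highest weight vector \<open>v\<close>. Here \<open>m\<close> runs through all naturals
  and \<open>t\<close> is cut off at every multiple of \<open>N\<close>, so that coordinate
  functions form a type and no carrier is needed.\<close>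

datatype corner = CE | CP | CR | CS

locale verma_model =
  fixes q :: "'k::field" and n N i j :: nat
  assumes N: "N = 2 * n" "N > 0" and qN: "q ^ N = 1"
begin

text \<open>Structure constants of the model: 1 - kappa2 acts on t^m v by \<open>vu m\<close>; for m
  > 0, x1 t^m v = \<open>vf m\<close> t^(m-1) y2 v and x2 t^m v = \<open>vg m\<close> t^(m-1) y1 v;
  and \<open>vh m\<close> is the coefficient of t^m v in x2 t^m y2 v.\<close>

definition vu :: "nat \<Rightarrow> 'k" where "vu m = 1 - q ^ j / q ^ m"
definition vh :: "nat \<Rightarrow> 'k" where "vh m = (-1) ^ m * (1 - q ^ i)"
definition vg :: "nat \<Rightarrow> 'k" where "vg m = 1 - q ^ i / q ^ m - vh m"
definition vf :: "nat \<Rightarrow> 'k" where "vf m = vu m - (1 - q ^ j) / (- q) ^ m"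

fun verma :: "gen \<Rightarrow> (corner \<times> nat \<Rightarrow> 'k) \<Rightarrow> corner \<times> nat \<Rightarrow> 'k" where
  "verma K1 f (c, m) = (if c \<in> {CE, CR} then q ^ i / q ^ m else q ^ i / q ^ Suc m) * f (c, m)"
| "verma K2 f (c, m) = (if c \<in> {CE, CP} then q ^ j / q ^ m else q ^ j / q ^ Suc m) * f (c, m)"
| "verma Y1 f (CE, m) = 0"
| "verma Y1 f (CP, m) = f (CE, m)"
| "verma Y1 f (CR, m) = 0"
| "verma Y1 f (CS, m) = f (CR, m)"
| "verma Y2 f (CE, m) = (if N dvd m then 0 else f (CP, m - 1))"
| "verma Y2 f (CP, m) = 0"
| "verma Y2 f (CR, m) = f (CE, m) + (if N dvd m then 0 else f (CS, m - 1))"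
| "verma Y2 f (CS, m) = - f (CP, m)"
| "verma X1 f (CE, m) = vu m * f (CP, m)"
| "verma X1 f (CP, m) = 0"
| "verma X1 f (CR, m) = vf (Suc m) * f (CE, Suc m) + vu (Suc m) * f (CS, m)"
| "verma X1 f (CS, m) = - vf (Suc m) * f (CP, Suc m)"
| "verma X2 f (CE, m) = vh m * f (CR, m)"
| "verma X2 f (CP, m) = vg (Suc m) * f (CE, Suc m) + vh m * f (CS, m)"
| "verma X2 f (CR, m) = 0"
| "verma X2 f (CS, m) = vg (Suc m) * f (CR, Suc m)"

lemma falg_rep_verma: "falg_rep verma"
proof
  fix g f f' c
  show "verma g (\<lambda>x. f x + f' x) = (\<lambda>x. verma g f x + verma g f' x)"
  proof
    fix x :: "corner \<times> nat"
    obtain d m where [simp]: "x = (d, m)" by fastforce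
    show "verma g (\<lambda>x. f x + f' x) x = verma g f x + verma g f' x"
      by (cases g; cases d) (simp_all add: algebra_simps add_divide_distrib)
  qed
  show "verma g (\<lambda>x. c * f x) = (\<lambda>x. c * verma g f x)"
  proof
    fix x :: "corner \<times> nat"
    obtain d m where [simp]: "x = (d, m)" by fastforce
    show "verma g (\<lambda>x. c * f x) x = c * verma g f x"
      by (cases g; cases d) (simp_all add: algebra_simps add_divide_distrib)
  qed
qed

sublocale V: falg_rep verma by (rule falg_rep_verma)

section \<open>Periodicity and nilpotency in the model\<close>

lemma q0: "q \<noteq> 0"
  using qN N by (cases "q = 0") (auto simp: zero_power)

lemma qN_dvd: "N dvd m \<Longrightarrow> q ^ m = 1"
  and minus_one_dvd: "N dvd m \<Longrightarrow> (-1) ^ m = (1::'k)"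
  using N qN by (auto simp: power_mult)

lemma periodic: "vu (m + N) = vu m" "vh (m + N) = vh m" "vg (m + N) = vg m" "vf (m + N) = vf m"
proof -
  have 1: "q ^ (m + N) = q ^ m" "(-1) ^ (m + N) = ((-1) ^ m :: 'k)"
    using qN minus_one_dvd[of N] by (auto simp: power_add)
  have 2: "(- q) ^ k = (-1) ^ k * q ^ k" for k by (rule power_minus)
  show "vu (m + N) = vu m" "vh (m + N) = vh m" "vg (m + N) = vg m" "vf (m + N) = vf m"
    unfolding vu_def vh_def vg_def vf_def 2 by (simp_all only: 1)
qed

text \<open>Since y1 y2 y1 y2 = t y1 y2, the k-th powers of y1 y2 and of y2 y1 are t^(k-1) y1 y2 and
  t^(k-1) y2 y1 for k > 0. Their sum is t^k, and t^N = 0 because the shift is cut at multiples of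
  \<open>N\<close>.\<close>

lemma verma_y_nilpotent:
  "((verma Y1 \<circ> verma Y2) ^^ N) f x + ((verma Y2 \<circ> verma Y1) ^^ N) f x = 0"
proof -
  \<comment> \<open>Multiplication by t on one family of coordinates: a shift, cut off at every
    multiple of \<open>N\<close>.\<close>
  define sh where "sh g m = (if N dvd m then 0 else g (m - 1))" for g :: "nat \<Rightarrow> 'k" and m
  have sh0: "(sh ^^ k) g m = 0" if "N dvd l" "l \<le> m" "m < l + k" for k g m l
    using that
  proof (induction k arbitrary: m)
    case (Suc k)
    show ?case
    proof (cases "N dvd m")
      case False
      with Suc.prems have "l \<le> m - 1" "m - 1 < l + k" by (auto simp: le_less)
      then show ?thesis using Suc.IH Suc.prems(1) by (simp add: sh_def)
    qed (simp add: sh_def)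
  qed simp
  \<comment> \<open>Going N steps down from \<open>m\<close> passes the multiple
    \<open>N * (m div N)\<close>.\<close>
  have shN: "(sh ^^ N) g m = 0" for g m
    by (rule sh0[of "N * (m div N)"]) (use N(2) dividend_less_times_div[of N m] in auto)
  have 1: "((verma Y1 \<circ> verma Y2) ^^ Suc k) f =
     (\<lambda>(c, m). case c of CE \<Rightarrow> 0 | CP \<Rightarrow> (sh ^^ Suc k) (\<lambda>m. f (CP, m)) m | CR \<Rightarrow> 0
       | CS \<Rightarrow> (sh ^^ k) (\<lambda>m. f (CE, m)) m + (sh ^^ Suc k) (\<lambda>m. f (CS, m)) m)" for k
  proof (induction k)
    case (Suc k)
    show ?case
      unfolding funpow.simps(2)[of "Suc k" "verma Y1 \<circ> verma Y2"] comp_apply[of _ "(verma Y1 \<circ> verma Y2) ^^ Suc k"] Suc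
      by (auto simp: fun_eq_iff sh_def split: corner.split)
  qed (auto simp: fun_eq_iff sh_def split: corner.split)
  have 2: "((verma Y2 \<circ> verma Y1) ^^ Suc k) f =
     (\<lambda>(c, m). case c of CP \<Rightarrow> 0 | CE \<Rightarrow> (sh ^^ Suc k) (\<lambda>m. f (CE, m)) m
       | CR \<Rightarrow> (sh ^^ Suc k) (\<lambda>m. f (CR, m)) m | CS \<Rightarrow> - (sh ^^ k) (\<lambda>m. f (CE, m)) m)" for k
  proof (induction k)
    case (Suc k)
    show ?case
      unfolding funpow.simps(2)[of "Suc k" "verma Y2 \<circ> verma Y1"] comp_apply[of _ "(verma Y2 \<circ> verma Y1) ^^ Suc k"] Suc
      by (auto simp: fun_eq_iff sh_def split: corner.split)
  qed (auto simp: fun_eq_iff sh_def split: corner.split)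
  obtain k where k: "N = Suc k" using N(2) by (cases N) auto
  obtain c m where x: "x = (c, m)" by fastforce
  show ?thesis
    using shN 1[of k, folded k] 2[of k, folded k] unfolding x by (cases c) auto
qed

text \<open>X2 X1 on the \<open>CP\<close> coordinates and X1 X2 on the \<open>CR\<close>
  coordinates both lower the index by one and multiply by this scalar.\<close>

definition vd :: "nat \<Rightarrow> 'k" where "vd m = vu m * vg m + vf m * vh m"

lemma vh_Suc: "vh (Suc m) = - vh m" by (simp add: vh_def)

text \<open>Among N consecutive indices one is a multiple of \<open>N\<close>, where both
  \<open>vf\<close> and \<open>vg\<close> vanish.\<close>

lemma vd_period: "(\<Prod>l<N. vd (m + l)) = 0"
proof -
  define l where "l = (if N dvd m then 0 else N - m mod N)"
  have "l < N" using N(2) by (auto simp: l_def dvd_eq_mod_eq_0)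
  moreover have "N dvd m + l"
  proof (cases "N dvd m")
    case False
    have l_eq: "l = N - m mod N" using False by (simp add: l_def)
    have "m mod N \<le> N" using N(2) by (simp add: less_imp_le)
    then have "m + l = N * (m div N) + N"
      using mult_div_mod_eq[of N m] unfolding l_eq by linarith
    then show ?thesis by simp
  qed (simp add: l_def)
  then have "vd (m + l) = 0"
    unfolding vd_def vu_def vf_def vg_def vh_def power_minus[of q "m + l"] by (simp add: qN_dvd minus_one_dvd)
  ultimately show ?thesis by (intro prod_zero) auto
qed

lemma verma_x_power_P:
  assumes "\<And>c m. c \<noteq> CP \<Longrightarrow> f (c, m) = 0"
  shows "((verma X2 \<circ> verma X1) ^^ k) f =
    (\<lambda>(c, m). case c of CP \<Rightarrow> (\<Prod>l<k. vd (Suc m + l)) * f (CP, m + k) | _ \<Rightarrow> 0)"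
proof (induction k)
  case 0
  then show ?case using assms by (auto simp: fun_eq_iff split: corner.split)
next
  case (Suc k)
  have step: "verma X2 (verma X1 (\<lambda>(c, m). case c of CP \<Rightarrow> g m | _ \<Rightarrow> 0)) =
      (\<lambda>(c, m). case c of CP \<Rightarrow> vd (Suc m) * g (Suc m) | _ \<Rightarrow> 0)" for g
    by (auto simp: fun_eq_iff vd_def vh_Suc algebra_simps split: corner.split)
  have "(\<Prod>l<Suc k. vd (Suc m + l)) = vd (Suc m) * (\<Prod>l<k. vd (Suc (Suc m) + l))" for m
    by (simp only: prod.lessThan_Suc_shift) simp
  note prod = this
  have "((verma X2 \<circ> verma X1) ^^ Suc k) f = verma X2 (verma X1 (((verma X2 \<circ> verma X1) ^^ k) f))"
    by simp
  also have "\<dots> = (\<lambda>(c, m). case c of CP \<Rightarrow> vd (Suc m) * ((\<Prod>l<k. vd (Suc (Suc m) + l)) * f (CP, Suc m + k)) | _ \<Rightarrow> 0)"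
    by (simp only: Suc.IH step)
  finally show ?case by (simp only: prod) (auto simp: fun_eq_iff split: corner.split)
qed

lemma verma_x_power_R:
  assumes "\<And>c m. c \<noteq> CR \<Longrightarrow> f (c, m) = 0"
  shows "((verma X1 \<circ> verma X2) ^^ k) f =
    (\<lambda>(c, m). case c of CR \<Rightarrow> (\<Prod>l<k. vd (Suc m + l)) * f (CR, m + k) | _ \<Rightarrow> 0)"
proof (induction k)
  case 0
  then show ?case using assms by (auto simp: fun_eq_iff split: corner.split)
next
  case (Suc k)
  have step: "verma X1 (verma X2 (\<lambda>(c, m). case c of CR \<Rightarrow> g m | _ \<Rightarrow> 0)) =
      (\<lambda>(c, m). case c of CR \<Rightarrow> vd (Suc m) * g (Suc m) | _ \<Rightarrow> 0)" for g
    by (auto simp: fun_eq_iff vd_def vh_Suc algebra_simps split: corner.split)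
  have "(\<Prod>l<Suc k. vd (Suc m + l)) = vd (Suc m) * (\<Prod>l<k. vd (Suc (Suc m) + l))" for m
    by (simp only: prod.lessThan_Suc_shift) simp
  note prod = this
  have "((verma X1 \<circ> verma X2) ^^ Suc k) f = verma X1 (verma X2 (((verma X1 \<circ> verma X2) ^^ k) f))"
    by simp
  also have "\<dots> = (\<lambda>(c, m). case c of CR \<Rightarrow> vd (Suc m) * ((\<Prod>l<k. vd (Suc (Suc m) + l)) * f (CR, Suc m + k)) | _ \<Rightarrow> 0)"
    by (simp only: Suc.IH step)
  finally show ?case by (simp only: prod) (auto simp: fun_eq_iff split: corner.split)
qed

text \<open>Coordinates are split by parity of the word length. On odd ones one of the two products
  dies at once and the other carries \<open>vd\<close> over a full period. On even ones each product
  contains only N - 1 factors \<open>vd\<close>; the outer operators supply the missing factor when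
  the two products are added.\<close>

lemma verma_x_nilpotent:
  "((verma X1 \<circ> verma X2) ^^ N) f x + ((verma X2 \<circ> verma X1) ^^ N) f x = 0"
proof -
  define T1 where "T1 = (verma X1 \<circ> verma X2) ^^ N"
  define T2 where "T2 = (verma X2 \<circ> verma X1) ^^ N"
  obtain k where k: "N = Suc k" using N(2) by (cases N) auto
  have T1k: "T1 = (verma X1 \<circ> verma X2) ^^ Suc k" and T2k: "T2 = (verma X2 \<circ> verma X1) ^^ Suc k"
    unfolding T1_def T2_def by (simp_all only: k)
  have add12: "T1 (\<lambda>x. f x + f' x) = (\<lambda>x. T1 f x + T1 f' x)" "T2 (\<lambda>x. f x + f' x) = (\<lambda>x. T2 f x + T2 f' x)"
    for f f'
  proof -
    have "((verma g \<circ> verma g') ^^ k) (\<lambda>x. f x + f' x) =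
        (\<lambda>x. ((verma g \<circ> verma g') ^^ k) f x + ((verma g \<circ> verma g') ^^ k) f' x)" for g g' k
      by (induction k) (simp_all add: V.gen_add)
    then show "T1 (\<lambda>x. f x + f' x) = (\<lambda>x. T1 f x + T1 f' x)"
      "T2 (\<lambda>x. f x + f' x) = (\<lambda>x. T2 f x + T2 f' x)"
      by (auto simp only: T1_def T2_def)
  qed
  have odd: "T1 f x + T2 f x = 0" if f: "\<And>m. f (CE, m) = 0" "\<And>m. f (CS, m) = 0" for f x
  proof -
    define fp where "fp = (\<lambda>(c, m). if c = CP then f (CP, m) else 0)"
    define fr where "fr = (\<lambda>(c, m). if c = CR then f (CR, m) else 0)"
    have f_eq: "f = (\<lambda>x. fp x + fr x)"
    proof
      fix x :: "corner \<times> nat"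
      obtain c m where "x = (c, m)" by fastforce
      then show "f x = fp x + fr x" by (cases c) (auto simp: fp_def fr_def f)
    qed
    have per: "(\<Prod>l<N. vd (Suc m + l)) = 0" for m by (rule vd_period)
    have fp0: "fp (c, m) = 0" if "c \<noteq> CP" for c m using that by (simp add: fp_def)
    have fr0: "fr (c, m) = 0" if "c \<noteq> CR" for c m using that by (simp add: fr_def)
    have zero: "verma g (\<lambda>x. 0) = (\<lambda>x. 0)" for g using V.gen_scale[of g 0 "\<lambda>x. 0"] by simp
    have zero': "((verma g \<circ> verma g') ^^ l) (\<lambda>x. 0) = (\<lambda>x. 0)" for g g' l
      by (induction l) (auto simp: zero)
    have "verma X2 fp = (\<lambda>x. 0)" "verma X1 fr = (\<lambda>x. 0)"
      unfolding fun_eq_iff split_paired_All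
      by (intro allI; rename_tac c m; case_tac c; simp add: fp_def fr_def)+
    then have "T1 fp = (\<lambda>x. 0)" "T2 fr = (\<lambda>x. 0)"
      unfolding T1k T2k funpow_Suc_right by (simp_all add: zero zero')
    moreover have "T2 fp = (\<lambda>x. 0)" "T1 fr = (\<lambda>x. 0)"
      unfolding T1_def T2_def
       by (subst verma_x_power_P, erule fp0, auto simp only: fun_eq_iff per mult_zero_left split: corner.split prod.split)
         (subst verma_x_power_R, erule fr0, auto simp only: fun_eq_iff per mult_zero_left split: corner.split prod.split)
    moreover have "T1 f = (\<lambda>x. T1 fp x + T1 fr x)" "T2 f = (\<lambda>x. T2 fp x + T2 fr x)"
      using add12[of fp fr] unfolding f_eq[symmetric] by auto
    ultimately show ?thesis by simp
  qed
  have even: "T1 f x + T2 f x = 0" if f: "\<And>m. f (CP, m) = 0" "\<And>m. f (CR, m) = 0" for f x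
  proof -
    \<comment> \<open>Regrouping (ab)^(k+1) as a (ba)^k b leaves the inner power acting on odd
      coordinates, where it is known.\<close>
    have shift: "((a \<circ> b) ^^ Suc k) f = a (((b \<circ> a) ^^ k) (b f))"
      for a b :: "(corner \<times> nat \<Rightarrow> 'k) \<Rightarrow> corner \<times> nat \<Rightarrow> 'k" and k f
      by (induction k) auto
    have T1: "T1 f = verma X1 (\<lambda>(c, m). case c of CP \<Rightarrow> (\<Prod>l<k. vd (Suc m + l)) * verma X2 f (CP, m + k) | _ \<Rightarrow> 0)"
    proof -
      have "verma X2 f (c, m) = 0" if "c \<noteq> CP" for c m
        using that by (cases c) (auto simp: f)
      then show ?thesis unfolding T1k shift by (subst verma_x_power_P) simp_all
    qed
    have T2: "T2 f = verma X2 (\<lambda>(c, m). case c of CR \<Rightarrow> (\<Prod>l<k. vd (Suc m + l)) * verma X1 f (CR, m + k) | _ \<Rightarrow> 0)"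
    proof -
      have "verma X1 f (c, m) = 0" if "c \<noteq> CR" for c m
        using that by (cases c) (auto simp: f)
      then show ?thesis unfolding T2k shift by (subst verma_x_power_R) simp_all
    qed
    define pr where "pr m = (\<Prod>l<k. vd (Suc m + l))" for m
    \<comment> \<open>The N - 1 factors of \<open>pr m\<close> together with \<open>vd m\<close> run
      over a full period.\<close>
    have per: "vd m * pr m = 0" for m
      using vd_period[of m] unfolding k pr_def by (simp only: prod.lessThan_Suc_shift) simp
    have sh: "Suc (m + k) = m + N" for m by (simp add: k)
    have hk: "vh (m + k) = - vh m" for m
      using vh_Suc[of "m + k"] periodic(2)[of m] unfolding sh by simp
    obtain c m where x: "x = (c, m)" by fastforce
    show ?thesis
    proof (cases c)
      case CE
      have "T1 f x = vu m * (pr m * (vg m * f (CE, m + N) - vh m * f (CS, m + k)))"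
        unfolding T1 x CE pr_def[symmetric] by (simp add: sh periodic hk)
      moreover have "T2 f x = vh m * (pr m * (vf m * f (CE, m + N) + vu m * f (CS, m + k)))"
        unfolding T2 x CE pr_def[symmetric] by (simp add: sh periodic)
      ultimately have "T1 f x + T2 f x = (vd m * pr m) * f (CE, m + N)"
        by (simp add: vd_def algebra_simps)
      then show ?thesis by (simp only: per mult_zero_left)
    next
      case CS
      define l where "l = Suc m"
      have "T1 f x = - vf l * (pr l * (vg (Suc (l + k)) * f (CE, Suc (l + k)) + vh (l + k) * f (CS, l + k)))"
        unfolding T1 x CS pr_def[symmetric] l_def by simp
      then have 1: "T1 f x = - vf l * (pr l * (vg l * f (CE, l + N) - vh l * f (CS, l + k)))"
        by (simp only: sh hk periodic) simp
      have "T2 f x = vg l * (pr l * (vf (Suc (l + k)) * f (CE, Suc (l + k)) + vu (Suc (l + k)) * f (CS, l + k)))"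
        unfolding T2 x CS pr_def[symmetric] l_def by simp
      then have 2: "T2 f x = vg l * (pr l * (vf l * f (CE, l + N) + vu l * f (CS, l + k)))"
        by (simp only: sh hk periodic)
      have "T1 f x + T2 f x = (vd l * pr l) * f (CS, l + k)"
        unfolding 1 2 by (simp add: vd_def algebra_simps)
      then show ?thesis by (simp only: per mult_zero_left)
    qed (simp_all add: T1 T2 x)
  qed
  define fe where "fe = (\<lambda>(c, m). if c = CE \<or> c = CS then f (c, m) else 0)"
  define fo where "fo = (\<lambda>(c, m). if c = CE \<or> c = CS then 0 else f (c, m))"
  have f_eq: "f = (\<lambda>x. fe x + fo x)" by (auto simp: fe_def fo_def)
  have "T1 fe x + T2 fe x = 0" "T1 fo x + T2 fo x = 0"
    by (rule even odd; simp add: fe_def fo_def)+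
  moreover have "T1 f = (\<lambda>x. T1 fe x + T1 fo x)" "T2 f = (\<lambda>x. T2 fe x + T2 fo x)"
    using add12[of fe fo] unfolding f_eq[symmetric] by auto
  ultimately have "T1 f x + T2 f x = 0"
    by (simp add: algebra_simps)
  then show ?thesis by (simp add: T1_def T2_def)
qed

text \<open>Together with \<open>vg0\<close> this decouples the blocks of N indices: X1 and X2 never
  lead across a multiple of \<open>N\<close>, where multiplication by t is cut.\<close>

lemma vf0: "N dvd m \<Longrightarrow> vf m = 0"
  unfolding vu_def vf_def power_minus[of q m] by (simp add: qN_dvd minus_one_dvd)

lemma vh0: "N dvd m \<Longrightarrow> vh m = 1 - q ^ i"
  by (simp add: vh_def minus_one_dvd)

lemma vg0: "N dvd m \<Longrightarrow> vg m = 0"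
  by (simp add: vg_def vh0 qN_dvd)

text \<open>The scalar identity behind y2 x1 = q x1 y2: the term subtracted from \<open>vu\<close>
  in \<open>vf\<close> is multiplied by -1/q at each step.\<close>

lemma vf_step: "vu m - vf m = q * (vf (Suc m) - vu (Suc m))"
  using q0 by (simp add: vf_def)

lemma verma_rels:
  assumes "r \<in> uq_rels q n"
  shows "falg_act verma r f = (\<lambda>x. 0)"
proof
  fix x :: "corner \<times> nat"
  obtain c m where x: "x = (c, m)" by fastforce
  have p: "falg_act verma (a ^ k) f = (falg_act verma a ^^ k) f" for a k f by (rule V.act_power)
  have comp: "falg_act verma (fgen g * fgen g') = verma g \<circ> verma g'" for g g'
    by (simp add: fun_eq_iff V.act_mult falg_act_fgen)
  have gen: "falg_act verma (fgen g) = verma g" for g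
    by (simp add: fun_eq_iff falg_act_fgen)
  have K: "(verma K1 ^^ k) f (c, m) = (if c \<in> {CE, CR} then q ^ i / q ^ m else q ^ i / q ^ Suc m) ^ k * f (c, m)"
    "(verma K2 ^^ k) f (c, m) = (if c \<in> {CE, CP} then q ^ j / q ^ m else q ^ j / q ^ Suc m) ^ k * f (c, m)"
    for k f c m
    by (induction k) auto
  have q1: "(q ^ a) ^ N = 1" for a
    by (simp add: qN mult.commute[of a] flip: power_mult) (simp add: qN power_mult)
  have KN: "(verma K1 ^^ N) f (c, m) = f (c, m)" "(verma K2 ^^ N) f (c, m) = f (c, m)" for f c m
    unfolding K by (simp_all add: power_divide q1 power_mult_distrib qN del: power_Suc)
  have N1: "N \<noteq> Suc 0" unfolding N(1) by presburger
  have vg_simp [simp]: "vg m = vh m * (-1) + (1 - q ^ i / q ^ m)" for m by (simp add: vg_def)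
  \<comment> \<open>Expressing the eigenvalue of kappa1 through \<open>vg\<close> and
    \<open>vh\<close> makes the relation for y2 x2 + x2 y2 a linear identity in these
    coefficients.\<close>
  have kq: "q ^ i / q ^ m = 1 - vg m - vh m" "q ^ i / q ^ Suc m = 1 - vg (Suc m) + vh m" for m
    by (simp_all add: vg_def vh_Suc)
  have kq0: "q ^ i * y / q = (1 - vg (Suc 0) + vh 0) * y" for y
    using kq(2)[of 0] by (metis power_one_right One_nat_def times_divide_eq_left)
  show "falg_act verma r f x = 0"
    using assms unfolding uq_rels_def Let_def N(1)[symmetric] insert_iff empty_iff
    apply (elim disjE)
    apply (simp_all only: falg_act_diff falg_act_add p comp gen KN falg_act_fconst falg_act_one power2_eq_square
        V.act_mult verma_x_nilpotent verma_y_nilpotent x diff_self comp_apply)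
    apply (cases c; simp add: q0 field_simps; fail)+
    apply ((cases c; cases m; simp add: q0 field_simps vh_Suc vu_def; fail))+
    subgoal
      using N1 kq0[of "f (CP, 0)"] kq0[of "f (CS, 0)"]
      by (cases c; cases m; cases "N dvd m"; cases "N dvd Suc m";
          simp del: vg_simp power_Suc add: kq vh_Suc vg0 vh0 algebra_simps)
    subgoal
      using N1 arg_cong[OF vf_step[of m], of "\<lambda>y. y * f (CP, m)"]
      by (cases c; cases m; cases "N dvd m"; cases "N dvd Suc m"; simp add: vf0 algebra_simps)
    subgoal by (cases c; cases m; simp add: q0 field_simps vh_Suc)
    done
qed

definition vac :: "corner \<times> nat \<Rightarrow> 'k" where
  "vac x = (if x = (CE, 0) then 1 else 0)"

lemma verma_vac:
  "verma X1 vac = (\<lambda>x. 0)" "verma X2 vac = (\<lambda>x. 0)"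
  "verma K1 vac = (\<lambda>x. q ^ i * vac x)" "verma K2 vac = (\<lambda>x. q ^ j * vac x)"
  unfolding fun_eq_iff split_paired_All
  by (intro allI; rename_tac c m; case_tac c; simp add: vac_def)+

end

text \<open>Reads off the coefficient of v in \<open>a\<close> v. It is compatible with right
  multiplication by the raising generators and the kappas, which makes it the source both of the
  weight characters and of the non-vanishing of standard modules.\<close>

lemma highest_weight_functional:
  fixes q :: "'k::field"
  assumes "N = 2 * n" "N > 0" "q ^ N = 1"
  obtains \<epsilon> :: "'k falg \<Rightarrow> 'k" where
    "\<And>a b. \<epsilon> (a + b) = \<epsilon> a + \<epsilon> b" "\<And>c a. \<epsilon> (scale c a) = c * \<epsilon> a"
    "\<And>a. a \<in> uq_ideal q n \<Longrightarrow> \<epsilon> a = 0" "\<epsilon> 1 = 1"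
    "\<And>a. \<epsilon> (a * fgen X1) = 0" "\<And>a. \<epsilon> (a * fgen X2) = 0"
    "\<And>a. \<epsilon> (a * fgen K1) = q ^ i * \<epsilon> a" "\<And>a. \<epsilon> (a * fgen K2) = q ^ j * \<epsilon> a"
proof -
  interpret verma_model q n N i j by unfold_locales (use assms in auto)
  have act_scale: "falg_act verma a (\<lambda>x. c * f x) = (\<lambda>x. c * falg_act verma a f x)" for a c f
    using V.act_mult[of a "fconst c" f] V.act_mult[of "fconst c" a f]
    by (simp add: falg_act_fconst fconst_central)
  show thesis
  proof (rule that[of "\<lambda>a. falg_act verma a vac (CE, 0)"])
  qed (simp_all add: falg_act_add scale_def V.act_mult falg_act_fconst falg_act_one falg_act_fgen
      V.act_uq_ideal[OF verma_rels] verma_vac V.act_zero act_scale, simp add: vac_def)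
qed

section \<open>Calculus modulo a left ideal\<close>

locale uq_root =
  fixes q :: "'k::field_char_0" and n N :: nat
  assumes N_eq: "N = 2 * n" and N_gt: "N > 2" and q_N: "q ^ N = 1"
    and q_prim: "\<And>m. 0 < m \<Longrightarrow> m < N \<Longrightarrow> q ^ m \<noteq> 1"
begin

lemma q_nonzero: "q \<noteq> 0"
  using q_N N_gt by (cases "q = 0") (auto simp: zero_power)

lemma q_power_eq_iff: "i < N \<Longrightarrow> j < N \<Longrightarrow> q ^ i = q ^ j \<longleftrightarrow> i = j"
proof (induction i j rule: linorder_wlog)
  case (le i j)
  have "q ^ i = q ^ j \<Longrightarrow> i = j"
  proof (rule ccontr)
    assume *: "q ^ i = q ^ j" "i \<noteq> j"
    have "q ^ j = q ^ i * q ^ (j - i)" using le(1) by (simp flip: power_add)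
    with * have "q ^ (j - i) = 1" using q_nonzero by simp
    then show False using q_prim[of "j - i"] le *(2) by auto
  qed
  then show ?case by auto
qed auto

lemma q_power_mod: "q ^ (k mod N) = q ^ k"
proof -
  have "q ^ k = q ^ (N * (k div N) + k mod N)" by simp
  also have "\<dots> = q ^ (k mod N)" unfolding power_add power_mult by (simp add: q_N)
  finally show ?thesis ..
qed

end

locale uq_left_ideal = uq_root q n N for q :: "'k::field_char_0" and n N :: nat +
  fixes I :: "'k falg set"
  assumes left_ideal: "left_ideal I" and uq_ideal: "uq_ideal q n \<subseteq> I"
begin

text \<open>Congruence modulo a left ideal respects multiplication from the left only; hence the
  relations below carry an arbitrary right factor \<open>z\<close>.\<close>

definition eqv :: "'k falg \<Rightarrow> 'k falg \<Rightarrow> bool" (infix "\<approx>" 50) where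
  "a \<approx> b \<longleftrightarrow> a - b \<in> I"

lemmas ideal_simps = left_idealD[OF left_ideal]

lemma eqv_refl [simp, intro]: "a \<approx> a"
  by (simp add: eqv_def ideal_simps)

lemma eqv_sym: "a \<approx> b \<Longrightarrow> b \<approx> a"
  using ideal_simps(4)[of "a - b"] by (simp add: eqv_def)

lemma eqv_trans [trans]: "a \<approx> b \<Longrightarrow> b \<approx> c \<Longrightarrow> a \<approx> c"
  using ideal_simps(2)[of "a - b" "b - c"] by (simp add: eqv_def)

lemma eqv_add: "a \<approx> b \<Longrightarrow> c \<approx> d \<Longrightarrow> a + c \<approx> b + d"
  using ideal_simps(2)[of "a - b" "c - d"] by (simp add: eqv_def algebra_simps)

lemma eqv_diff: "a \<approx> b \<Longrightarrow> c \<approx> d \<Longrightarrow> a - c \<approx> b - d"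
  using ideal_simps(5)[of "a - b" "c - d"] by (simp add: eqv_def algebra_simps)

lemma eqv_mult: "a \<approx> b \<Longrightarrow> p * a \<approx> p * b"
  using ideal_simps(3)[of "a - b" p] by (simp add: eqv_def algebra_simps)

lemma eqv_scale: "a \<approx> b \<Longrightarrow> scale c a \<approx> scale c b"
  by (simp add: scale_def eqv_mult)

lemma eqv_zero_iff: "a \<approx> 0 \<longleftrightarrow> a \<in> I"
  by (simp add: eqv_def)

lemma eqv_mem: "a \<approx> b \<Longrightarrow> b \<in> I \<Longrightarrow> a \<in> I"
  using eqv_trans[of a b 0] by (simp add: eqv_zero_iff)

lemma eqv_mem_iff: "a \<approx> b \<Longrightarrow> a \<in> I \<longleftrightarrow> b \<in> I"
  using eqv_mem eqv_sym by blast

text \<open>A relation times \<open>z\<close> stays in \<open>I\<close> because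
  \<open>uq_ideal\<close> is two-sided, although \<open>I\<close> need not be.\<close>

lemma eqv_relI: "r \<in> uq_rels q n \<Longrightarrow> a - b = r * z \<Longrightarrow> a \<approx> b"
  using uq_ideal_right[OF uq_rels_ideal, of r q n z] uq_ideal by (auto simp: eqv_def)

lemma rel_kk: "fgen K1 * (fgen K2 * z) \<approx> fgen K2 * (fgen K1 * z)"
  by (rule eqv_relI[of "fgen K1 * fgen K2 - fgen K2 * fgen K1"])
    (auto simp: uq_rels_def Let_def algebra_simps)

lemma rel_kN: "fgen K1 ^ N * z \<approx> z" "fgen K2 ^ N * z \<approx> z"
proof -
  show "fgen K1 ^ N * z \<approx> z"
    by (rule eqv_relI[of "fgen K1 ^ N - 1" _ _ z]) (auto simp: uq_rels_def Let_def algebra_simps N_eq)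
  show "fgen K2 ^ N * z \<approx> z"
    by (rule eqv_relI[of "fgen K2 ^ N - 1" _ _ z]) (auto simp: uq_rels_def Let_def algebra_simps N_eq)
qed

lemma rel_kx:
  "fgen K1 * (fgen X1 * z) \<approx> scale q (fgen X1 * (fgen K1 * z))"
  "fgen K1 * (fgen X2 * z) \<approx> fgen X2 * (fgen K1 * z)"
  "fgen K2 * (fgen X1 * z) \<approx> fgen X1 * (fgen K2 * z)"
  "fgen K2 * (fgen X2 * z) \<approx> scale q (fgen X2 * (fgen K2 * z))"
proof -
  show "fgen K1 * (fgen X1 * z) \<approx> scale q (fgen X1 * (fgen K1 * z))"
    by (rule eqv_relI[of "fgen K1 * fgen X1 - fconst q * fgen X1 * fgen K1" _ _ z])
      (auto simp: uq_rels_def Let_def algebra_simps scale_def)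
  show "fgen K1 * (fgen X2 * z) \<approx> fgen X2 * (fgen K1 * z)"
    by (rule eqv_relI[of "fgen K1 * fgen X2 - fgen X2 * fgen K1" _ _ z])
      (auto simp: uq_rels_def Let_def algebra_simps scale_def)
  show "fgen K2 * (fgen X1 * z) \<approx> fgen X1 * (fgen K2 * z)"
    by (rule eqv_relI[of "fgen K2 * fgen X1 - fgen X1 * fgen K2" _ _ z])
      (auto simp: uq_rels_def Let_def algebra_simps scale_def)
  show "fgen K2 * (fgen X2 * z) \<approx> scale q (fgen X2 * (fgen K2 * z))"
    by (rule eqv_relI[of "fgen K2 * fgen X2 - fconst q * fgen X2 * fgen K2" _ _ z])
      (auto simp: uq_rels_def Let_def algebra_simps scale_def)
qed

lemma rel_ky:
  "fgen K1 * (fgen Y1 * z) \<approx> scale (inverse q) (fgen Y1 * (fgen K1 * z))"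
  "fgen K1 * (fgen Y2 * z) \<approx> fgen Y2 * (fgen K1 * z)"
  "fgen K2 * (fgen Y1 * z) \<approx> fgen Y1 * (fgen K2 * z)"
  "fgen K2 * (fgen Y2 * z) \<approx> scale (inverse q) (fgen Y2 * (fgen K2 * z))"
proof -
  show "fgen K1 * (fgen Y1 * z) \<approx> scale (inverse q) (fgen Y1 * (fgen K1 * z))"
    by (rule eqv_relI[of "fgen K1 * fgen Y1 - fconst (inverse q) * fgen Y1 * fgen K1" _ _ z])
      (auto simp: uq_rels_def Let_def algebra_simps scale_def)
  show "fgen K1 * (fgen Y2 * z) \<approx> fgen Y2 * (fgen K1 * z)"
    by (rule eqv_relI[of "fgen K1 * fgen Y2 - fgen Y2 * fgen K1" _ _ z])
      (auto simp: uq_rels_def Let_def algebra_simps scale_def)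
  show "fgen K2 * (fgen Y1 * z) \<approx> fgen Y1 * (fgen K2 * z)"
    by (rule eqv_relI[of "fgen K2 * fgen Y1 - fgen Y1 * fgen K2" _ _ z])
      (auto simp: uq_rels_def Let_def algebra_simps scale_def)
  show "fgen K2 * (fgen Y2 * z) \<approx> scale (inverse q) (fgen Y2 * (fgen K2 * z))"
    by (rule eqv_relI[of "fgen K2 * fgen Y2 - fconst (inverse q) * fgen Y2 * fgen K2" _ _ z])
      (auto simp: uq_rels_def Let_def algebra_simps scale_def)
qed

text \<open>Oriented so that \<open>X1\<close> and \<open>X2\<close> move to the right through words
  in \<open>Y1\<close>, \<open>Y2\<close>.\<close>

lemma rel_xy:
  "fgen X1 * (fgen Y1 * z) \<approx> z - fgen K2 * z - fgen Y1 * (fgen X1 * z)"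
  "fgen X1 * (fgen Y2 * z) \<approx> scale (inverse q) (fgen Y2 * (fgen X1 * z))"
  "fgen X2 * (fgen Y1 * z) \<approx> fgen Y1 * (fgen X2 * z)"
  "fgen X2 * (fgen Y2 * z) \<approx> z - fgen K1 * z - fgen Y2 * (fgen X2 * z)"
proof -
  show "fgen X1 * (fgen Y1 * z) \<approx> z - fgen K2 * z - fgen Y1 * (fgen X1 * z)"
    by (rule eqv_relI[of "fgen Y1 * fgen X1 + fgen X1 * fgen Y1 - (1 - fgen K2)" _ _ z])
      (auto simp: uq_rels_def Let_def algebra_simps scale_def)
  have "fgen Y2 * (fgen X1 * z) \<approx> scale q (fgen X1 * (fgen Y2 * z))"
    by (rule eqv_relI[of "fgen Y2 * fgen X1 - fconst q * fgen X1 * fgen Y2" _ _ z])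
      (auto simp: uq_rels_def Let_def algebra_simps scale_def)
  then have "scale (inverse q) (fgen Y2 * (fgen X1 * z)) \<approx> scale (inverse q) (scale q (fgen X1 * (fgen Y2 * z)))"
    by (rule eqv_scale)
  then show "fgen X1 * (fgen Y2 * z) \<approx> scale (inverse q) (fgen Y2 * (fgen X1 * z))"
    using q_nonzero by (intro eqv_sym[of "scale (inverse q) (fgen Y2 * (fgen X1 * z))"]) simp
  show "fgen X2 * (fgen Y1 * z) \<approx> fgen Y1 * (fgen X2 * z)"
    by (rule eqv_sym, rule eqv_relI[of "fgen Y1 * fgen X2 - fgen X2 * fgen Y1" _ _ z])
      (auto simp: uq_rels_def Let_def algebra_simps scale_def)
  show "fgen X2 * (fgen Y2 * z) \<approx> z - fgen K1 * z - fgen Y2 * (fgen X2 * z)"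
    by (rule eqv_relI[of "fgen Y2 * fgen X2 + fgen X2 * fgen Y2 - (1 - fgen K1)" _ _ z])
      (auto simp: uq_rels_def Let_def algebra_simps scale_def)
qed

lemma rel_sq:
  "g \<in> {X1, X2, Y1, Y2} \<Longrightarrow> fgen g * (fgen g * z) \<approx> 0"
  by (rule eqv_relI[of "fgen g ^ 2" _ _ z])
    (auto simp: uq_rels_def Let_def power2_eq_square mult.assoc)

lemma rel_nil:
  "(g, h) \<in> {(X1, X2), (X2, X1), (Y1, Y2), (Y2, Y1)} \<Longrightarrow> (fgen g * fgen h) ^ N * z + (fgen h * fgen g) ^ N * z \<approx> 0"
  by (rule eqv_relI[of "(fgen g * fgen h) ^ N + (fgen h * fgen g) ^ N" _ _ z])
    (auto simp: uq_rels_def Let_def N_eq distrib_right add.commute)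

end

text \<open>In the free algebra on the two letters this is the k-th power of the augmentation ideal;
  for \<open>k\<close> = 1 it consists of the combinations without constant term.\<close>

definition word_span :: "gen \<Rightarrow> gen \<Rightarrow> nat \<Rightarrow> 'k::field falg set" where
  "word_span g h k = {p. \<forall>w\<in>Poly_Mapping.keys p. \<exists>u. w = Word u \<and> set u \<subseteq> {g, h} \<and> k \<le> length u}"

abbreviation word_of :: "gen list \<Rightarrow> 'k::field falg" where
  "word_of u \<equiv> Poly_Mapping.single (Word u) 1"

lemma word_of_Cons: "word_of (g # u) = fgen g * word_of u"
  by (rule single_word_Cons)

lemma word_of_Nil: "word_of [] = 1"
  by (simp add: single_word_Nil)

lemma word_span_word_of: "set u \<subseteq> {g, h} \<Longrightarrow> k \<le> length u \<Longrightarrow> word_of u \<in> word_span g h k"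
  by (auto simp: word_span_def)

lemma word_span_add: "a \<in> word_span g h k \<Longrightarrow> b \<in> word_span g h k \<Longrightarrow> a + b \<in> word_span g h k"
  using keys_add[of a b] unfolding word_span_def by blast

lemma word_span_zero: "0 \<in> word_span g h k"
  by (simp add: word_span_def)

lemma word_span_mult: "a \<in> word_span g h k \<Longrightarrow> b \<in> word_span g h l \<Longrightarrow> a * b \<in> word_span g h (k + l)"
  unfolding word_span_def
proof (intro CollectI ballI)
  fix w
  assume a: "a \<in> {p. \<forall>w\<in>Poly_Mapping.keys p. \<exists>u. w = Word u \<and> set u \<subseteq> {g, h} \<and> k \<le> length u}"
    and b: "b \<in> {p. \<forall>w\<in>Poly_Mapping.keys p. \<exists>u. w = Word u \<and> set u \<subseteq> {g, h} \<and> l \<le> length u}"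
    and "w \<in> Poly_Mapping.keys (a * b)"
  then obtain w1 w2 where "w = w1 + w2" "w1 \<in> Poly_Mapping.keys a" "w2 \<in> Poly_Mapping.keys b"
    using keys_mult[of a b] by auto
  with a b obtain u1 u2 where "w1 = Word u1" "set u1 \<subseteq> {g, h}" "k \<le> length u1"
    "w2 = Word u2" "set u2 \<subseteq> {g, h}" "l \<le> length u2" by blast
  then show "\<exists>u. w = Word u \<and> set u \<subseteq> {g, h} \<and> k + l \<le> length u"
    using \<open>w = w1 + w2\<close> by (intro exI[of _ "u1 @ u2"]) auto
qed

lemma word_span_scale: "a \<in> word_span g h k \<Longrightarrow> scale c a \<in> word_span g h k"
  using word_span_mult[of "fconst c" g h 0 a k]
  by (auto simp: scale_def fconst_def word_span_def zero_word_def split: if_splits)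

lemma word_span_uminus: "a \<in> word_span g h k \<Longrightarrow> - a \<in> word_span g h k"
  by (simp add: word_span_def)

lemma word_span_diff: "a \<in> word_span g h k \<Longrightarrow> b \<in> word_span g h k \<Longrightarrow> a - b \<in> word_span g h k"
  using word_span_add[of a g h k "- b"] word_span_uminus[of b] by auto

lemma word_span_le: "a \<in> word_span g h k \<Longrightarrow> l \<le> k \<Longrightarrow> a \<in> word_span g h l"
  unfolding word_span_def by (blast intro: le_trans)

lemma word_span_power: "a \<in> word_span g h 1 \<Longrightarrow> a ^ k \<in> word_span g h k"
proof (induction k)
  case (Suc k)
  then show ?case using word_span_mult[of a g h 1 "a ^ k" k] by simp
qed (use word_span_word_of[of "[]" g h 0] in \<open>simp add: word_of_Nil\<close>)

lemma word_span_gen: "x \<in> {g, h} \<Longrightarrow> a \<in> word_span g h k \<Longrightarrow> fgen x * a \<in> word_span g h (Suc k)"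
  using word_span_mult[of "fgen x" g h 1 a k] word_span_word_of[of "[x]" g h 1]
  by (simp add: word_of_Cons word_of_Nil)

lemma word_span_induct [consumes 1, case_names zero add scale word_of]:
  fixes p :: "'k::field falg"
  assumes "p \<in> word_span g h k" and zero: "P 0"
    and add: "\<And>a b. P a \<Longrightarrow> P b \<Longrightarrow> P (a + b)" and scale: "\<And>c a. P a \<Longrightarrow> P (scale c a)"
    and word_of: "\<And>u. set u \<subseteq> {g, h} \<Longrightarrow> k \<le> length u \<Longrightarrow> P (word_of u)"
  shows "P p"
proof (rule poly_mapping_span_induct[of P p])
  fix w and c :: 'k assume "w \<in> Poly_Mapping.keys p"
  then obtain u where u: "w = Word u" "set u \<subseteq> {g, h}" "k \<le> length u"
    using assms(1) by (auto simp: word_span_def)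
  have "Poly_Mapping.single w c = scale c (word_of u)" by (simp add: scale_single u)
  then show "P (Poly_Mapping.single w c)" using scale word_of u by simp
qed fact+

lemma word_span_split:
  assumes "p \<in> word_span g h 0"
  obtains c \<nu> where "\<nu> \<in> word_span g h 1" "p = scale c 1 + \<nu>"
proof -
  have "\<exists>c. \<exists>\<nu>\<in>word_span g h 1. p = scale c 1 + \<nu>"
    using assms
  proof (induction rule: word_span_induct)
    case zero
    show ?case by (auto intro!: exI[of _ 0] simp: word_span_zero)
  next
    case (add a b)
    then obtain c \<nu> c' \<nu>' where "\<nu> \<in> word_span g h 1" "\<nu>' \<in> word_span g h 1"
      "a = scale c 1 + \<nu>" "b = scale c' 1 + \<nu>'" by blast
    then show ?case
      by (intro exI[of _ "c + c'"] bexI[of _ "\<nu> + \<nu>'"]) (auto simp: scale_add_left word_span_add)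
  next
    case (scale d a)
    then obtain c \<nu> where "\<nu> \<in> word_span g h 1" "a = scale c 1 + \<nu>" by blast
    then show ?case
      by (intro exI[of _ "d * c"] bexI[of _ "scale d \<nu>"]) (auto simp: word_span_scale)
  next
    case (word_of u)
    show ?case
    proof (cases u)
      case Nil
      then show ?thesis by (auto intro!: exI[of _ 1] bexI[of _ 0] simp: word_of_Nil word_span_zero)
    next
      case (Cons x v)
      with word_of show ?thesis
        by (intro exI[of _ 0] bexI[of _ "word_of u"] word_span_word_of) auto
    qed
  qed
  then show thesis using that by blast
qed

section \<open>Vanishing of long words\<close>

context uq_left_ideal
begin

text \<open>Multiplying (gh)^N + (hg)^N by g from the left kills the first summand, because g^2 = 0,
  and thus isolates g (hg)^N.\<close>

lemma long_alternating_mem: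
  assumes "(g, h) \<in> {(X1, X2), (X2, X1), (Y1, Y2), (Y2, Y1)}" "m \<ge> N"
  shows "fgen g * (fgen h * fgen g) ^ m \<in> I"
  using assms(2)
proof (induction m rule: dec_induct)
  case base
  obtain N' where N': "N = Suc N'" using N_gt by (cases N) auto
  have "(fgen g * fgen h) ^ N * 1 + (fgen h * fgen g) ^ N * 1 \<approx> 0"
    by (rule rel_nil) (use assms in auto)
  from eqv_mult[OF this, of "fgen g"]
  have "fgen g * (fgen g * fgen h) ^ N + fgen g * (fgen h * fgen g) ^ N \<in> I"
    by (simp add: eqv_zero_iff distrib_left)
  moreover have "fgen g * (fgen g * fgen h) ^ N \<in> I"
    using rel_sq[of g] assms(1) unfolding N' by (auto simp: eqv_zero_iff mult.assoc)
  ultimately show ?case using ideal_simps(5) by fastforce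
next
  case (step m)
  then show ?case using ideal_simps(3)[of _ "fgen g * fgen h"] by (simp add: mult.assoc)
qed

text \<open>A repeated letter makes a word vanish, so at most the two alternating words of each
  length survive.\<close>

lemma word_alternating:
  assumes g: "(g, h) \<in> {(X1, X2), (X2, X1), (Y1, Y2), (Y2, Y1)}" and u: "set u \<subseteq> {g, h}"
  shows "word_of u \<in> I \<or> (\<exists>m. length u = 2 * m \<and> (word_of u :: 'k falg) \<in> {(fgen g * fgen h) ^ m, (fgen h * fgen g) ^ m})
    \<or> (\<exists>m. length u = 2 * m + 1 \<and> (word_of u :: 'k falg) \<in> {fgen h * (fgen g * fgen h) ^ m, fgen g * (fgen h * fgen g) ^ m})"
  using u
proof (induction u)
  case Nil
  then show ?case by (auto simp: word_of_Nil)
next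
  case (Cons x u)
  have sq: "fgen g * (fgen g * z) \<in> I" "fgen h * (fgen h * z) \<in> I" for z
    using rel_sq[of g z] rel_sq[of h z] g by (auto simp: eqv_zero_iff)
  from Cons.IH Cons.prems consider "word_of u \<in> I"
    | m where "length u = 2 * m" "(word_of u :: 'k falg) \<in> {(fgen g * fgen h) ^ m, (fgen h * fgen g) ^ m}"
    | m where "length u = 2 * m + 1" "(word_of u :: 'k falg) \<in> {fgen h * (fgen g * fgen h) ^ m, fgen g * (fgen h * fgen g) ^ m}"
    by auto
  then show ?case
  proof cases
    case 1
    then show ?thesis by (simp add: word_of_Cons ideal_simps)
  next
    case 2
    show ?thesis
    proof (cases m)
      case 0
      with 2 Cons.prems show ?thesis by (auto simp: word_of_Cons)
    next
      case (Suc l)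
      from 2 Cons.prems consider "x = g" "(word_of u :: 'k falg) = (fgen g * fgen h) ^ m"
        | "x = h" "(word_of u :: 'k falg) = (fgen h * fgen g) ^ m"
        | "(word_of (x # u) :: 'k falg) \<in> {fgen h * (fgen g * fgen h) ^ m, fgen g * (fgen h * fgen g) ^ m}"
        unfolding word_of_Cons by auto
      then show ?thesis
      proof cases
        case 3
        moreover have "length (x # u) = 2 * m + 1" using 2(1) by simp
        ultimately show ?thesis by blast
      qed (simp_all add: word_of_Cons Suc mult.assoc sq)
    qed
  next
    case 3
    with Cons.prems consider "x = g" "(word_of u :: 'k falg) = fgen h * (fgen g * fgen h) ^ m"
      | "x = h" "(word_of u :: 'k falg) = fgen h * (fgen g * fgen h) ^ m"
      | "x = g" "(word_of u :: 'k falg) = fgen g * (fgen h * fgen g) ^ m"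
      | "x = h" "(word_of u :: 'k falg) = fgen g * (fgen h * fgen g) ^ m" by auto
    then show ?thesis
    proof cases
      case 1
      have "(word_of (x # u) :: 'k falg) = (fgen g * fgen h) ^ Suc m"
        unfolding word_of_Cons 1 power_Suc mult.assoc ..
      moreover have "length (x # u) = 2 * Suc m" using 3(1) by simp
      ultimately show ?thesis by blast
    next
      case 4
      have "(word_of (x # u) :: 'k falg) = (fgen h * fgen g) ^ Suc m"
        unfolding word_of_Cons 4 power_Suc mult.assoc ..
      moreover have "length (x # u) = 2 * Suc m" using 3(1) by simp
      ultimately show ?thesis by blast
    qed (auto simp: word_of_Cons sq)
  qed
qed

text \<open>From length 2N + 1 on both alternating words vanish; in length 2N the relations only
  make them opposite to each other.\<close>

lemma long_word_mem:
  assumes g: "(g, h) \<in> {(X1, X2), (X2, X1), (Y1, Y2), (Y2, Y1)}" and u: "set u \<subseteq> {g, h}" "2 * N + 1 \<le> length u"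
  shows "word_of u \<in> I"
proof -
  have g': "(h, g) \<in> {(X1, X2), (X2, X1), (Y1, Y2), (Y2, Y1)}" using g by auto
  have odd: "fgen g * (fgen h * fgen g) ^ m \<in> I" "fgen h * (fgen g * fgen h) ^ m \<in> I" if "m \<ge> N" for m
    using long_alternating_mem[OF g that] long_alternating_mem[OF g' that] by auto
  have even: "(fgen g * fgen h) ^ m \<in> I" "(fgen h * fgen g) ^ m \<in> I" if m: "m > N" for m
  proof -
    obtain l where l: "m = Suc l" "l \<ge> N" using m by (cases m) auto
    show "(fgen g * fgen h) ^ m \<in> I" "(fgen h * fgen g) ^ m \<in> I"
      using ideal_simps(3)[OF odd(1)[OF l(2)], of "fgen h"] ideal_simps(3)[OF odd(2)[OF l(2)], of "fgen g"]
      by (simp_all add: l(1) mult.assoc)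
  qed
  show ?thesis
    using word_alternating[OF g u(1)] u(2) odd even by auto
qed

lemma word_span_mem:
  assumes "(g, h) \<in> {(X1, X2), (X2, X1), (Y1, Y2), (Y2, Y1)}" "p \<in> word_span g h (2 * N + 1)"
  shows "p \<in> I"
  using assms(2)
  by (induction rule: word_span_induct)
    (auto simp: ideal_simps left_ideal_scale[OF left_ideal] intro: long_word_mem[OF assms(1)])

text \<open>Modulo \<open>I\<close> the element 1 equals \<open>\<nu>\<close>, hence every power of
  \<open>\<nu>\<close>, and a high power vanishes. The telescoping multiplies by
  \<open>\<nu>\<close> on the left, as a left ideal demands.\<close>

lemma one_minus_nilpotent:
  assumes "\<nu> \<in> word_span Y1 Y2 1" "1 - \<nu> \<in> I"
  shows "1 \<in> I"
proof -
  have pow: "1 - \<nu> ^ m \<in> I" for m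
  proof (induction m)
    case (Suc m)
    have eq: "1 - \<nu> ^ Suc m = (1 - \<nu>) + \<nu> * (1 - \<nu> ^ m)" by (simp add: algebra_simps)
    show ?case unfolding eq by (intro ideal_simps(2,3) assms(2) Suc)
  qed (simp add: ideal_simps)
  moreover have "\<nu> ^ (2 * N + 1) \<in> I"
    by (rule word_span_mem[of Y1 Y2 "\<nu> ^ (2 * N + 1)", OF _ word_span_power[OF assms(1)]]) simp
  ultimately show ?thesis using ideal_simps(2)[OF pow[of "2 * N + 1"], of "\<nu> ^ (2 * N + 1)"] by simp
qed

text \<open>Otherwise division by \<open>c\<close> would make 1 congruent to a nilpotent combination
  of words.\<close>

lemma scalar_plus_nilpotent:
  assumes "\<nu> \<in> word_span Y1 Y2 1" "scale c 1 + \<nu> \<in> I" "1 \<notin> I"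
  shows "c = 0"
proof (rule ccontr)
  assume "c \<noteq> 0"
  then have "1 - scale (- inverse c) \<nu> = scale (inverse c) (scale c 1 + \<nu>)" by simp
  then have "1 - scale (- inverse c) \<nu> \<in> I"
    using left_ideal_scale[OF left_ideal assms(2), of "inverse c"] by metis
  then show False using one_minus_nilpotent word_span_scale assms by blast
qed

end

section \<open>Highest weight left ideals\<close>

text \<open>The class of 1 is a highest weight vector, possibly zero. Arbitrary eigenvalues instead
  of powers of \<open>q\<close> allow reuse for any weight vector killed by x1 and x2.\<close>

locale uq_hw = uq_left_ideal q n N I
  for q :: "'k::field_char_0" and n N :: nat and I :: "'k falg set" +
  fixes a b :: 'k
  assumes X_mem: "fgen X1 \<in> I" "fgen X2 \<in> I"
    and K_mem: "fgen K1 - fconst a \<in> I" "fgen K2 - fconst b \<in> I"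
begin

text \<open>The four families of alternating words; every word in \<open>Y1\<close>,
  \<open>Y2\<close> is congruent to one of them or to 0.\<close>

abbreviation A :: "nat \<Rightarrow> 'k falg" where "A m \<equiv> (fgen Y2 * fgen Y1) ^ m"
abbreviation B :: "nat \<Rightarrow> 'k falg" where "B m \<equiv> (fgen Y1 * fgen Y2) ^ m"
abbreviation C :: "nat \<Rightarrow> 'k falg" where "C m \<equiv> fgen Y1 * A m"
abbreviation D :: "nat \<Rightarrow> 'k falg" where "D m \<equiv> fgen Y2 * B m"

lemma A_Suc: "A (Suc m) = fgen Y2 * C m" and B_Suc: "B (Suc m) = fgen Y1 * D m"
  by (simp_all add: mult.assoc)

lemma Y_zero: "fgen Y1 * C m \<approx> 0" "fgen Y2 * D m \<approx> 0" "fgen Y1 * B (Suc m) \<approx> 0" "fgen Y2 * A (Suc m) \<approx> 0"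
  unfolding A_Suc B_Suc by (intro rel_sq; simp)+

lemma K1_step:
  assumes "fgen K1 * z \<approx> scale c z"
  shows "fgen K1 * (fgen Y1 * z) \<approx> scale (c / q) (fgen Y1 * z)" "fgen K1 * (fgen Y2 * z) \<approx> scale c (fgen Y2 * z)"
proof -
  have "fgen K1 * (fgen Y1 * z) \<approx> scale (inverse q) (fgen Y1 * (fgen K1 * z))" by (rule rel_ky)
  also have "\<dots> \<approx> scale (inverse q) (fgen Y1 * scale c z)" by (intro eqv_scale eqv_mult assms)
  finally show "fgen K1 * (fgen Y1 * z) \<approx> scale (c / q) (fgen Y1 * z)"
    by (simp add: scale_mult_right divide_inverse mult.commute)
  have "fgen K1 * (fgen Y2 * z) \<approx> fgen Y2 * (fgen K1 * z)" by (rule rel_ky)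
  also have "\<dots> \<approx> fgen Y2 * scale c z" by (intro eqv_mult assms)
  finally show "fgen K1 * (fgen Y2 * z) \<approx> scale c (fgen Y2 * z)" by (simp add: scale_mult_right)
qed

lemma K2_step:
  assumes "fgen K2 * z \<approx> scale c z"
  shows "fgen K2 * (fgen Y1 * z) \<approx> scale c (fgen Y1 * z)" "fgen K2 * (fgen Y2 * z) \<approx> scale (c / q) (fgen Y2 * z)"
proof -
  have "fgen K2 * (fgen Y2 * z) \<approx> scale (inverse q) (fgen Y2 * (fgen K2 * z))" by (rule rel_ky)
  also have "\<dots> \<approx> scale (inverse q) (fgen Y2 * scale c z)" by (intro eqv_scale eqv_mult assms)
  finally show "fgen K2 * (fgen Y2 * z) \<approx> scale (c / q) (fgen Y2 * z)"
    by (simp add: scale_mult_right divide_inverse mult.commute)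
  have "fgen K2 * (fgen Y1 * z) \<approx> fgen Y1 * (fgen K2 * z)" by (rule rel_ky)
  also have "\<dots> \<approx> fgen Y1 * scale c z" by (intro eqv_mult assms)
  finally show "fgen K2 * (fgen Y1 * z) \<approx> scale c (fgen Y1 * z)" by (simp add: scale_mult_right)
qed

lemma K_one: "fgen K1 * 1 \<approx> scale a 1" "fgen K2 * 1 \<approx> scale b 1"
  using K_mem by (simp_all add: eqv_def scale_def)

lemma K_A: "fgen K1 * A m \<approx> scale (a / q ^ m) (A m)" "fgen K2 * A m \<approx> scale (b / q ^ m) (A m)"
proof (induction m)
  case (Suc m)
  show "fgen K1 * A (Suc m) \<approx> scale (a / q ^ Suc m) (A (Suc m))"
    unfolding A_Suc using K1_step(2)[OF K1_step(1)[OF Suc(1)]] by (simp add: divide_divide_eq_left mult.commute)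
  show "fgen K2 * A (Suc m) \<approx> scale (b / q ^ Suc m) (A (Suc m))"
    unfolding A_Suc using K2_step(2)[OF K2_step(1)[OF Suc(2)]] by (simp add: divide_divide_eq_left mult.commute)
qed (use K_one in auto)

lemma K_B: "fgen K1 * B m \<approx> scale (a / q ^ m) (B m)" "fgen K2 * B m \<approx> scale (b / q ^ m) (B m)"
proof (induction m)
  case (Suc m)
  show "fgen K1 * B (Suc m) \<approx> scale (a / q ^ Suc m) (B (Suc m))"
    unfolding B_Suc using K1_step(1)[OF K1_step(2)[OF Suc(1)]] by (simp add: divide_divide_eq_left mult.commute)
  show "fgen K2 * B (Suc m) \<approx> scale (b / q ^ Suc m) (B (Suc m))"
    unfolding B_Suc using K2_step(1)[OF K2_step(2)[OF Suc(2)]] by (simp add: divide_divide_eq_left mult.commute)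
qed (use K_one in auto)

lemma K_C: "fgen K1 * C m \<approx> scale (a / q ^ Suc m) (C m)" "fgen K2 * C m \<approx> scale (b / q ^ m) (C m)"
  using K1_step(1)[OF K_A(1)] K2_step(1)[OF K_A(2)] by (simp_all add: divide_divide_eq_left mult.commute)

lemma K_D: "fgen K1 * D m \<approx> scale (a / q ^ m) (D m)" "fgen K2 * D m \<approx> scale (b / q ^ Suc m) (D m)"
  using K1_step(2)[OF K_B(1)] K2_step(2)[OF K_B(2)] by (simp_all add: divide_divide_eq_left mult.commute)

section \<open>Action of the raising generators on alternating words\<close>

definition \<alpha> :: "nat \<Rightarrow> 'k" where "\<alpha> m = (-1) ^ m * (1 - b) / q ^ Suc m"
definition \<beta> :: "nat \<Rightarrow> 'k" where "\<beta> m = (-1) ^ m * (1 - a)"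

lemma \<alpha>_Suc: "\<alpha> (Suc m) = - (inverse q * \<alpha> m)"
  using q_nonzero by (simp add: \<alpha>_def field_simps)

lemma X1_step_C:
  assumes "fgen X1 * A m \<approx> r"
  shows "fgen X1 * C m \<approx> scale (1 - b / q ^ m) (A m) - fgen Y1 * r"
proof -
  have "fgen X1 * C m \<approx> A m - fgen K2 * A m - fgen Y1 * (fgen X1 * A m)" by (rule rel_xy)
  also have "\<dots> \<approx> A m - scale (b / q ^ m) (A m) - fgen Y1 * r"
    by (intro eqv_diff eqv_mult eqv_refl K_A assms)
  finally show ?thesis by (simp add: scale_diff_left)
qed

text \<open>Passing x1 over y2 costs a factor 1/q; passing it over y1 leaves a term with 1 - kappa2.
  After the first step that term ends in y2 \<open>A (Suc m)\<close>, which vanishes, so only the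
  recursion for \<open>\<alpha>\<close> survives. The counterpart y1 x2 = x2 y1 contains no q, which
  is why \<open>\<beta>\<close> has no power of q.\<close>

lemma X1_A: "fgen X1 * A (Suc m) \<approx> scale (\<alpha> m) (D m)"
proof (induction m)
  case 0
  have "fgen X1 * A 0 \<approx> 0" using X_mem by (simp add: eqv_zero_iff)
  note c = X1_step_C[OF this]
  have "fgen X1 * A (Suc 0) \<approx> scale (inverse q) (fgen Y2 * (fgen X1 * C 0))"
    unfolding A_Suc by (rule rel_xy)
  also have "\<dots> \<approx> scale (inverse q) (fgen Y2 * (scale (1 - b / q ^ 0) (A 0) - fgen Y1 * 0))"
    by (intro eqv_scale eqv_mult c)
  finally show ?case
    by (simp add: scale_mult_right \<alpha>_def divide_inverse mult.commute)
next
  case (Suc m)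
  note c = X1_step_C[OF Suc]
  have "fgen X1 * A (Suc (Suc m)) \<approx> scale (inverse q) (fgen Y2 * (fgen X1 * C (Suc m)))"
    unfolding A_Suc[of "Suc m"] by (rule rel_xy)
  also have "\<dots> \<approx> scale (inverse q) (fgen Y2 * (scale (1 - b / q ^ Suc m) (A (Suc m)) - fgen Y1 * scale (\<alpha> m) (D m)))"
    by (intro eqv_scale eqv_mult c)
  also have "\<dots> = scale (inverse q) (scale (1 - b / q ^ Suc m) (fgen Y2 * A (Suc m)) - scale (\<alpha> m) (D (Suc m)))"
    unfolding B_Suc scale_mult_right right_diff_distrib ..
  also have "\<dots> \<approx> scale (inverse q) (scale (1 - b / q ^ Suc m) 0 - scale (\<alpha> m) (D (Suc m)))"
    by (intro eqv_scale eqv_diff Y_zero eqv_refl)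
  also have "\<dots> = scale (\<alpha> (Suc m)) (D (Suc m))"
    unfolding \<alpha>_Suc by simp
  finally show ?case .
qed

lemma X1_C: "fgen X1 * C (Suc m) \<approx> scale (1 - b / q ^ Suc m) (A (Suc m)) - scale (\<alpha> m) (B (Suc m))"
  using X1_step_C[OF X1_A] unfolding B_Suc scale_mult_right .

lemma X1_C0: "fgen X1 * C 0 \<approx> scale (1 - b) 1"
  using X1_step_C[of 0 0] X_mem by (simp add: eqv_zero_iff)

text \<open>As x2 commutes with y1, x2 \<open>C m\<close> = y1 x2 \<open>A m\<close>; for m > 0 this
  is by induction a multiple of y1 \<open>C (m - 1)\<close>, which contains y1 twice in a
  row.\<close>

lemma X2_AC: "fgen X2 * C m \<approx> 0" "fgen X2 * A (Suc m) \<approx> scale (1 - a / q ^ Suc m) (C m)"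
proof -
  have step: "fgen X2 * A (Suc m) \<approx> scale (1 - a / q ^ Suc m) (C m)" if "fgen X2 * C m \<approx> 0" for m
  proof -
    have "fgen X2 * A (Suc m) \<approx> C m - fgen K1 * C m - fgen Y2 * (fgen X2 * C m)"
      unfolding A_Suc by (rule rel_xy)
    also have "\<dots> \<approx> C m - scale (a / q ^ Suc m) (C m) - fgen Y2 * 0"
      by (intro eqv_diff eqv_mult eqv_refl K_C that)
    finally show ?thesis by (simp add: scale_diff_left)
  qed
  show C: "fgen X2 * C m \<approx> 0" for m
  proof (induction m)
    case 0
    have "fgen X2 * C 0 \<approx> fgen Y1 * (fgen X2 * A 0)" by (rule rel_xy)
    then show ?case using X_mem eqv_mem[of _ "fgen Y1 * fgen X2"] by (simp add: eqv_zero_iff ideal_simps)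
  next
    case (Suc m)
    have "fgen X2 * C (Suc m) \<approx> fgen Y1 * (fgen X2 * A (Suc m))" by (rule rel_xy)
    also have "\<dots> \<approx> fgen Y1 * scale (1 - a / q ^ Suc m) (C m)" by (intro eqv_mult step Suc)
    also have "\<dots> \<approx> scale (1 - a / q ^ Suc m) 0"
      unfolding scale_mult_right by (intro eqv_scale Y_zero)
    finally show ?case by simp
  qed
  show "fgen X2 * A (Suc m) \<approx> scale (1 - a / q ^ Suc m) (C m)" by (rule step[OF C])
qed

lemma X1_BD: "fgen X1 * D m \<approx> 0" "fgen X1 * B (Suc m) \<approx> scale (1 - b / q ^ Suc m) (D m)"
proof -
  have step: "fgen X1 * B (Suc m) \<approx> scale (1 - b / q ^ Suc m) (D m)" if "fgen X1 * D m \<approx> 0" for m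
  proof -
    have "fgen X1 * B (Suc m) \<approx> D m - fgen K2 * D m - fgen Y1 * (fgen X1 * D m)"
      unfolding B_Suc by (rule rel_xy)
    also have "\<dots> \<approx> D m - scale (b / q ^ Suc m) (D m) - fgen Y1 * 0"
      by (intro eqv_diff eqv_mult eqv_refl K_D that)
    finally show ?thesis by (simp add: scale_diff_left)
  qed
  show D: "fgen X1 * D m \<approx> 0" for m
  proof (induction m)
    case 0
    have "fgen X1 * D 0 \<approx> scale (inverse q) (fgen Y2 * (fgen X1 * B 0))" by (rule rel_xy)
    then show ?case
      using X_mem eqv_mem[of _ "scale (inverse q) (fgen Y2 * fgen X1)"]
      by (simp add: eqv_zero_iff ideal_simps left_ideal_scale[OF left_ideal])
  next
    case (Suc m)
    have "fgen X1 * D (Suc m) \<approx> scale (inverse q) (fgen Y2 * (fgen X1 * B (Suc m)))" by (rule rel_xy)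
    also have "\<dots> \<approx> scale (inverse q) (fgen Y2 * scale (1 - b / q ^ Suc m) (D m))"
      by (intro eqv_scale eqv_mult step Suc)
    also have "\<dots> \<approx> scale (inverse q) (scale (1 - b / q ^ Suc m) 0)"
      unfolding scale_mult_right by (intro eqv_scale Y_zero)
    finally show ?case by simp
  qed
  show "fgen X1 * B (Suc m) \<approx> scale (1 - b / q ^ Suc m) (D m)" by (rule step[OF D])
qed

lemma X2_step_D:
  assumes "fgen X2 * B m \<approx> r"
  shows "fgen X2 * D m \<approx> scale (1 - a / q ^ m) (B m) - fgen Y2 * r"
proof -
  have "fgen X2 * D m \<approx> B m - fgen K1 * B m - fgen Y2 * (fgen X2 * B m)" by (rule rel_xy)
  also have "\<dots> \<approx> B m - scale (a / q ^ m) (B m) - fgen Y2 * r"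
    by (intro eqv_diff eqv_mult eqv_refl K_B assms)
  finally show ?thesis by (simp add: scale_diff_left)
qed

lemma X2_B: "fgen X2 * B (Suc m) \<approx> scale (\<beta> m) (C m)"
proof (induction m)
  case 0
  have "fgen X2 * B 0 \<approx> 0" using X_mem by (simp add: eqv_zero_iff)
  note c = X2_step_D[OF this]
  have "fgen X2 * B (Suc 0) \<approx> fgen Y1 * (fgen X2 * D 0)"
    unfolding B_Suc by (rule rel_xy)
  also have "\<dots> \<approx> fgen Y1 * (scale (1 - a / q ^ 0) (B 0) - fgen Y2 * 0)"
    by (intro eqv_mult c)
  finally show ?case
    by (simp add: scale_mult_right \<beta>_def)
next
  case (Suc m)
  note c = X2_step_D[OF Suc]
  have "fgen X2 * B (Suc (Suc m)) \<approx> fgen Y1 * (fgen X2 * D (Suc m))"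
    unfolding B_Suc[of "Suc m"] by (rule rel_xy)
  also have "\<dots> \<approx> fgen Y1 * (scale (1 - a / q ^ Suc m) (B (Suc m)) - fgen Y2 * scale (\<beta> m) (C m))"
    by (intro eqv_mult c)
  also have "\<dots> = scale (1 - a / q ^ Suc m) (fgen Y1 * B (Suc m)) - scale (\<beta> m) (C (Suc m))"
    unfolding A_Suc scale_mult_right right_diff_distrib ..
  also have "\<dots> \<approx> scale (1 - a / q ^ Suc m) 0 - scale (\<beta> m) (C (Suc m))"
    by (intro eqv_scale eqv_diff Y_zero eqv_refl)
  also have "\<dots> = scale (\<beta> (Suc m)) (C (Suc m))"
    by (simp add: \<beta>_def)
  finally show ?case .
qed

lemma X2_D: "fgen X2 * D (Suc m) \<approx> scale (1 - a / q ^ Suc m) (B (Suc m)) - scale (\<beta> m) (A (Suc m))"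
  using X2_step_D[OF X2_B] unfolding A_Suc scale_mult_right .

lemma X2_D0: "fgen X2 * D 0 \<approx> scale (1 - a) 1"
  using X2_step_D[of 0 0] X_mem by (simp add: eqv_zero_iff)

text \<open>Up to sign the determinant of (x1, x2) from the span of \<open>A (Suc m)\<close>,
  \<open>B (Suc m)\<close> to the multiples of \<open>D m\<close> and \<open>C m\<close>. The signs
  (-1)^m in \<open>\<alpha>\<close> and \<open>\<beta>\<close> cancel. One factor vanishes for
  \<open>Suc m = N\<close>, the other where \<open>q ^ Suc m\<close> equals
  \<open>a * b\<close>.\<close>

lemma AB_det: "\<alpha> m * \<beta> m - (1 - b / q ^ Suc m) * (1 - a / q ^ Suc m) = (1 / q ^ Suc m - 1) * (1 - a * b / q ^ Suc m)"
proof -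
  have "(-1) ^ m * (-1) ^ m = (1 :: 'k)" by (simp flip: power_mult_distrib)
  then have "\<alpha> m * \<beta> m = (1 - b) * (1 - a) / q ^ Suc m"
    unfolding \<alpha>_def \<beta>_def by (metis (no_types, lifting) mult.assoc mult.left_commute mult_1 times_divide_eq_left)
  moreover have "(1 - b) * (1 - a) / x - (1 - b / x) * (1 - a / x) = (1 / x - 1) * (1 - a * b / x)"
    if "x \<noteq> 0" for x using that by (simp add: field_simps)
  ultimately show ?thesis using q_nonzero by simp
qed

lemma AB_N: "A N + B N \<in> I"
  using rel_nil[of Y1 Y2 1] by (simp add: eqv_zero_iff add.commute)

subsection \<open>Spanning by words in the lowering generators\<close>

lemma K_word_of:
  assumes "set u \<subseteq> {Y1, Y2}"
  shows "\<exists>c c'. fgen K1 * word_of u \<approx> scale c (word_of u) \<and> fgen K2 * word_of u \<approx> scale c' (word_of u)"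
  using assms
proof (induction u)
  case Nil
  then show ?case using K_one by (auto simp: word_of_Nil)
next
  case (Cons x u)
  then obtain c c' where 1: "fgen K1 * word_of u \<approx> scale c (word_of u)"
    and 2: "fgen K2 * word_of u \<approx> scale c' (word_of u)" by auto
  note K1_step[OF 1] K2_step[OF 2]
  then show ?case using Cons.prems unfolding word_of_Cons by auto
qed

text \<open>Level 0 turns out to be everything; level 1 is what lies strictly below the highest
  weight vector. Level 1 need not be a left ideal, since raising may lead back up.\<close>

definition spanned :: "nat \<Rightarrow> 'k falg set" where
  "spanned k = {p. \<exists>w\<in>word_span Y1 Y2 k. p \<approx> w}"

lemma spannedI: "p \<approx> w \<Longrightarrow> w \<in> word_span Y1 Y2 k \<Longrightarrow> p \<in> spanned k"
  by (auto simp: spanned_def)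

lemma spanned_eqv: "p \<approx> r \<Longrightarrow> r \<in> spanned k \<Longrightarrow> p \<in> spanned k"
  by (auto simp: spanned_def intro: eqv_trans)

lemma spanned_mem: "p \<in> I \<Longrightarrow> p \<in> spanned k"
  by (rule spannedI[of _ 0]) (auto simp: eqv_zero_iff word_span_zero)

lemma spanned_add: "p \<in> spanned k \<Longrightarrow> r \<in> spanned k \<Longrightarrow> p + r \<in> spanned k"
  unfolding spanned_def by (blast intro: eqv_add word_span_add)

lemma spanned_diff: "p \<in> spanned k \<Longrightarrow> r \<in> spanned k \<Longrightarrow> p - r \<in> spanned k"
  unfolding spanned_def by (blast intro: eqv_diff word_span_diff)

lemma spanned_scale: "p \<in> spanned k \<Longrightarrow> scale c p \<in> spanned k"
  unfolding spanned_def by (blast intro: eqv_scale word_span_scale)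

lemma spanned_gen: "p \<in> spanned k \<Longrightarrow> x \<in> {Y1, Y2} \<Longrightarrow> fgen x * p \<in> spanned (Suc k)"
  unfolding spanned_def by (blast intro: eqv_mult word_span_gen)

lemma spanned_le: "p \<in> spanned k \<Longrightarrow> l \<le> k \<Longrightarrow> p \<in> spanned l"
  unfolding spanned_def by (blast intro: word_span_le)

text \<open>Words in \<open>Y1\<close>, \<open>Y2\<close> are weight vectors, so their length is
  unaffected.\<close>

lemma spanned_K: "p \<in> spanned k \<Longrightarrow> g \<in> {K1, K2} \<Longrightarrow> fgen g * p \<in> spanned k"
proof -
  assume p: "p \<in> spanned k" and g: "g \<in> {K1, K2}"
  then obtain w where w: "w \<in> word_span Y1 Y2 k" "p \<approx> w" by (auto simp: spanned_def)
  from w(1) have "fgen g * w \<in> spanned k"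
  proof (induction rule: word_span_induct)
    case (word_of u)
    then show ?case
      using K_word_of[of u] g by (auto intro: spannedI word_span_scale word_span_word_of)
  qed (auto simp: distrib_left scale_mult_right intro: spanned_add spanned_scale spanned_mem ideal_simps)
  then show ?thesis using spanned_eqv eqv_mult w(2) by blast
qed

text \<open>Level 0 only, because moving x1 or x2 through a word may remove a letter from
  it.\<close>

lemma spanned_X: "p \<in> spanned 0 \<Longrightarrow> g \<in> {X1, X2} \<Longrightarrow> fgen g * p \<in> spanned 0"
proof -
  assume p: "p \<in> spanned 0" and g: "g \<in> {X1, X2}"
  then obtain w where w: "w \<in> word_span Y1 Y2 0" "p \<approx> w" by (auto simp: spanned_def)
  have "fgen X1 * word_of u \<in> spanned 0 \<and> fgen X2 * word_of u \<in> spanned 0" if "set u \<subseteq> {Y1, Y2}" for u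
    using that
  proof (induction u)
    case Nil
    then show ?case using X_mem by (simp add: word_of_Nil spanned_mem)
  next
    case (Cons x u)
    then have IH: "fgen X1 * word_of u \<in> spanned 0" "fgen X2 * word_of u \<in> spanned 0" and x: "x \<in> {Y1, Y2}"
      and u: "word_of u \<in> spanned 0" by (auto intro: spannedI word_span_word_of)
    have Y: "fgen y * z \<in> spanned 0" if "y \<in> {Y1, Y2}" "z \<in> spanned 0" for y z
      using spanned_gen[OF that(2,1)] spanned_le by blast
    note intros = spanned_diff spanned_scale spanned_K Y IH u
    have "fgen X1 * (fgen Y1 * word_of u) \<in> spanned 0" "fgen X1 * (fgen Y2 * word_of u) \<in> spanned 0"
      "fgen X2 * (fgen Y1 * word_of u) \<in> spanned 0" "fgen X2 * (fgen Y2 * word_of u) \<in> spanned 0"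
      by (rule spanned_eqv, rule rel_xy, (intro intros; simp))+
    then show ?case using x unfolding word_of_Cons by auto
  qed
  with g have gu: "fgen g * word_of u \<in> spanned 0" if "set u \<subseteq> {Y1, Y2}" for u using that by auto
  from w(1) have "fgen g * w \<in> spanned 0"
    by (induction rule: word_span_induct)
      (auto simp: distrib_left scale_mult_right intro: spanned_add spanned_scale spanned_mem ideal_simps gu)
  then show ?thesis using spanned_eqv eqv_mult w(2) by blast
qed

text \<open>The triangular decomposition in the form used here: the combinations of words in
  \<open>Y1\<close>, \<open>Y2\<close> contain 1 and are stable under all six generators.\<close>

lemma spanned_UNIV: "p \<in> spanned 0"
proof -
  have "p * 1 \<in> spanned 0"
  proof (rule falg_left_induct)
    show "1 \<in> spanned 0" using word_span_word_of[of "[]" Y1 Y2 0] by (auto simp: word_of_Nil intro: spannedI)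
    show "fgen g * a \<in> spanned 0" if "a \<in> spanned 0" for g a
      using that spanned_K[of a 0 g] spanned_X[of a g] spanned_le[OF spanned_gen[of a 0 g], of 0] by (cases g) auto
  qed (auto intro: spanned_add spanned_scale)
  then show ?thesis by simp
qed

lemma decompose:
  obtains c \<nu> where "\<nu> \<in> word_span Y1 Y2 1" "p \<approx> scale c 1 + \<nu>"
  using spanned_UNIV[of p] unfolding spanned_def by (auto elim: word_span_split)

lemma one_notin_spanned: "1 \<notin> I \<Longrightarrow> 1 \<notin> spanned 1"
  using one_minus_nilpotent by (auto simp: spanned_def eqv_def)

end

subsection \<open>Maximal left ideals\<close>

context uq_left_ideal
begin

text \<open>Makes everything known about the generator 1 applicable to a weight vector
  \<open>z\<close> that is killed by x1 and x2.\<close>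

lemma colon_hw:
  assumes "fgen X1 * z \<in> I" "fgen X2 * z \<in> I" "fgen K1 * z \<approx> scale c z" "fgen K2 * z \<approx> scale d z"
  shows "uq_hw q n N {p. p * z \<in> I} c d"
proof
  show "left_ideal {p. p * z \<in> I}" by (rule left_ideal_colon[OF left_ideal])
  show "uq_ideal q n \<subseteq> {p. p * z \<in> I}" using uq_ideal_right[of _ q n z] uq_ideal by blast
qed (use assms in \<open>auto simp: eqv_def scale_def algebra_simps\<close>)

text \<open>As g^N acts by 1, the elements \<open>e i\<close> are, up to the factor N, the
  projections to the eigenspaces. They sum to N, which is invertible in characteristic zero, so one
  of them does not kill \<open>z\<close>. The shape of \<open>r\<close> is recorded because a
  polynomial in one kappa preserves eigenvectors of the other.\<close>

lemma eigenvector: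
  assumes g: "g \<in> {K1, K2}" and z: "z \<notin> I"
  obtains r i where "r * z \<notin> I" "i < N" "fgen g * (r * z) \<approx> scale (q ^ i) (r * z)"
    "r \<in> range (\<lambda>c. \<Sum>k<N. scale (c k) (fgen g ^ k))"
proof -
  define e where "e i = (\<Sum>k<N. scale (inverse (q ^ (i * k))) (fgen g ^ k))" for i
  have eig: "fgen g * (e i * z) \<approx> scale (q ^ i) (e i * z)" for i
  proof -
    \<comment> \<open>Indexed so that \<open>fgen g\<close> shifts the summands by one; the sum
      closes up cyclically because the terms for N and 0 are congruent.\<close>
    define f where "f k = scale (q ^ i * inverse (q ^ (i * k))) (fgen g ^ k * z)" for k
    have "fgen g * (e i * z) = (\<Sum>k<N. f (Suc k))"
      using q_nonzero right_inverse[of "q ^ i"]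
      by (simp add: mult.assoc[of "q ^ i", symmetric] e_def f_def sum_distrib_left sum_distrib_right scale_mult_left scale_mult_right mult.assoc power_add)
    also have "\<dots> = (\<Sum>k<N. f k) + f N - f 0"
      using sum.lessThan_Suc_shift[of f N] sum.lessThan_Suc[of f N] by (simp add: algebra_simps)
    also have "\<dots> \<approx> (\<Sum>k<N. f k) + f 0 - f 0"
    proof (intro eqv_add eqv_diff eqv_refl)
      have "q ^ (i * N) = 1" by (simp add: mult.commute[of i] power_mult q_N)
      then show "f N \<approx> f 0"
        using g rel_kN[of z] by (auto simp: f_def intro: eqv_scale)
    qed
    also have "(\<Sum>k<N. f k) + f 0 - f 0 = scale (q ^ i) (e i * z)"
      by (simp add: e_def f_def sum_distrib_right scale_sum scale_mult_left)
    finally show ?thesis .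
  qed
  \<comment> \<open>A geometric sum over the root of unity \<open>?r\<close>, which differs from 1
    for 0 < k < N.\<close>
  have geo: "(\<Sum>i<N. inverse (q ^ (i * k))) = (if k = 0 then of_nat N else 0)" if "k < N" for k
  proof (cases "k = 0")
    case False
    let ?r = "inverse (q ^ k)"
    have "?r \<noteq> 1" using q_prim[of k] False that by auto
    moreover have "?r ^ N = 1"
      using q_N by (metis mult.commute power_inverse power_mult power_one inverse_1)
    ultimately have "(\<Sum>i<N. ?r ^ i) = 0" by (simp add: geometric_sum)
    moreover have "inverse (q ^ (i * k)) = ?r ^ i" for i
      by (simp add: power_inverse power_mult[symmetric] mult.commute)
    ultimately show ?thesis using False by simp
  qed simp
  have "(\<Sum>i<N. e i * z) = (\<Sum>k<N. scale (\<Sum>i<N. inverse (q ^ (i * k))) (fgen g ^ k)) * z"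
    unfolding e_def sum_distrib_right[symmetric] scale_sum_left by (subst sum.swap) simp
  also have "\<dots> = scale (of_nat N) z"
    using N_gt by (simp add: geo if_distrib[of "\<lambda>c. scale c _"] sum.delta cong: if_cong)
      (simp add: sum.If_cases scale_mult_left)
  finally have sum: "(\<Sum>i<N. e i * z) = scale (of_nat N) z" .
  have "\<exists>i<N. e i * z \<notin> I"
  proof (rule ccontr)
    assume "\<not> ?thesis"
    then have "(\<Sum>i<N. e i * z) \<in> I" by (intro left_ideal_sum[OF left_ideal]) auto
    then show False using sum z left_ideal_scaleD[OF left_ideal, of "of_nat N" z] N_gt by auto
  qed
  then obtain i where "i < N" "e i * z \<notin> I" by blast
  then show thesis by (intro that[of "e i" i] eig) (auto simp: e_def)
qed

lemma K_commute:
  assumes "fgen K1 * z \<approx> scale c z" "r \<in> range (\<lambda>c. \<Sum>k<N. scale (c k) (fgen K2 ^ k))"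
  shows "fgen K1 * (r * z) \<approx> scale c (r * z)"
proof -
  obtain d where r: "r = (\<Sum>k<N. scale (d k) (fgen K2 ^ k))" using assms(2) by blast
  have pow: "fgen K1 * (fgen K2 ^ k * z) \<approx> scale c (fgen K2 ^ k * z)" for k
  proof (induction k)
    case (Suc k)
    have "fgen K1 * (fgen K2 * (fgen K2 ^ k * z)) \<approx> fgen K2 * (fgen K1 * (fgen K2 ^ k * z))" by (rule rel_kk)
    also have "\<dots> \<approx> fgen K2 * scale c (fgen K2 ^ k * z)" by (intro eqv_mult Suc)
    finally show ?case by (simp add: scale_mult_right mult.assoc)
  qed (use assms in simp)
  have "(\<Sum>k<N. scale (d k) (fgen K1 * (fgen K2 ^ k * z) - scale c (fgen K2 ^ k * z))) \<in> I"
    using pow by (intro left_ideal_sum[OF left_ideal] left_ideal_scale[OF left_ideal]) (auto simp: eqv_def)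
  moreover have "(\<Sum>k<N. scale (d k) (fgen K1 * (fgen K2 ^ k * z) - scale c (fgen K2 ^ k * z)))
      = fgen K1 * (r * z) - scale c (r * z)"
    by (simp add: r sum_distrib_left sum_distrib_right scale_sum scale_mult_left scale_mult_right
        sum_subtractf mult.commute)
  ultimately show ?thesis by (simp add: eqv_def)
qed

lemma K_X_word:
  assumes "i < N" "j < N" "fgen K1 * z \<approx> scale (q ^ i) z" "fgen K2 * z \<approx> scale (q ^ j) z" "set u \<subseteq> {X1, X2}"
  shows "\<exists>i<N. \<exists>j<N. fgen K1 * (word_of u * z) \<approx> scale (q ^ i) (word_of u * z) \<and>
    fgen K2 * (word_of u * z) \<approx> scale (q ^ j) (word_of u * z)"
  using assms(5)
proof (induction u)
  case Nil
  then show ?case using assms by (auto simp: word_of_Nil)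
next
  case (Cons x u)
  then obtain i j where ij: "i < N" "j < N" "fgen K1 * (word_of u * z) \<approx> scale (q ^ i) (word_of u * z)"
    "fgen K2 * (word_of u * z) \<approx> scale (q ^ j) (word_of u * z)" by auto
  let ?z = "word_of u * z"
  have red: "scale q (scale (q ^ l) y) = scale (q ^ (Suc l mod N)) y" for l y
    by (simp add: q_power_mod)
  have 1: "fgen K1 * (fgen X1 * ?z) \<approx> scale (q ^ (Suc i mod N)) (fgen X1 * ?z)"
    "fgen K2 * (fgen X2 * ?z) \<approx> scale (q ^ (Suc j mod N)) (fgen X2 * ?z)"
    using eqv_trans[OF rel_kx(1) eqv_scale[OF eqv_mult[OF ij(3)]]]
      eqv_trans[OF rel_kx(4) eqv_scale[OF eqv_mult[OF ij(4)]]]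
    unfolding scale_mult_right red by simp_all
  have 2: "fgen K1 * (fgen X2 * ?z) \<approx> scale (q ^ i) (fgen X2 * ?z)"
    "fgen K2 * (fgen X1 * ?z) \<approx> scale (q ^ j) (fgen X1 * ?z)"
    using eqv_trans[OF rel_kx(2) eqv_mult[OF ij(3)]] eqv_trans[OF rel_kx(3) eqv_mult[OF ij(4)]]
    unfolding scale_mult_right by simp_all
  have lt: "Suc l mod N < N" for l using N_gt by simp
  show ?case
  proof (cases "x = X1")
    case True
    show ?thesis unfolding word_of_Cons mult.assoc True using 1(1) 2(2) ij(2) lt by blast
  next
    case False
    then have "x = X2" using Cons.prems by auto
    show ?thesis unfolding word_of_Cons mult.assoc \<open>x = X2\<close> using 1(2) 2(1) ij(1) lt by blast
  qed
qed

text \<open>Two projections give a common eigenvector of the kappas; a longest word in x1, x2 that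
  does not kill it leads to a highest weight vector.\<close>

lemma exists_highest_weight:
  assumes "1 \<notin> I"
  obtains p i j where "p \<notin> I" "i < N" "j < N" "uq_hw q n N {z. z * p \<in> I} (q ^ i) (q ^ j)"
proof -
  obtain z1 i where z1: "z1 \<notin> I" "i < N" "fgen K1 * z1 \<approx> scale (q ^ i) z1"
    using eigenvector[of K1 1] assms by (metis insertI1 mult_1_right)
  obtain r j where r: "r * z1 \<notin> I" "j < N" "fgen K2 * (r * z1) \<approx> scale (q ^ j) (r * z1)"
    "r \<in> range (\<lambda>c. \<Sum>k<N. scale (c k) (fgen K2 ^ k))"
    using eigenvector[of K2 z1] z1 by blast
  let ?z = "r * z1"
  have K1: "fgen K1 * ?z \<approx> scale (q ^ i) ?z" by (rule K_commute[OF z1(3) r(4)])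
  let ?P = "\<lambda>u. set u \<subseteq> {X1, X2} \<and> word_of u * ?z \<notin> I"
  \<comment> \<open>The long word appears as the left factor of a product with \<open>?z\<close>; it
    has to vanish in the two-sided ideal, which is closed under multiplication from the
    right.\<close>
  interpret J: uq_left_ideal q n N "uq_ideal q n"
    by unfold_locales (auto simp: left_ideal_uq_ideal)
  have "\<exists>u. ?P u \<and> (\<forall>u'. ?P u' \<longrightarrow> length u' \<le> length u)"
  proof (rule ex_has_greatest_nat[of ?P "[]" length "2 * N + 1"])
    show "?P []" using r(1) by (simp add: word_of_Nil)
    show "\<forall>u. ?P u \<longrightarrow> length u < 2 * N + 1"
    proof (intro allI impI, rule ccontr)
      fix u assume u: "?P u" "\<not> length u < 2 * N + 1"
      then have "word_of u \<in> uq_ideal q n" by (intro J.long_word_mem[of X1 X2]) auto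
      then show False using u(1) uq_ideal_right[of _ q n ?z] uq_ideal by blast
    qed
  qed
  then obtain u where u: "?P u" "\<And>u'. ?P u' \<Longrightarrow> length u' \<le> length u" by blast
  have X: "fgen x * (word_of u * ?z) \<in> I" if "x \<in> {X1, X2}" for x
    using u(2)[of "x # u"] u(1) that by (auto simp: word_of_Cons mult.assoc)
  obtain i' j' where "i' < N" "j' < N" "fgen K1 * (word_of u * ?z) \<approx> scale (q ^ i') (word_of u * ?z)"
    "fgen K2 * (word_of u * ?z) \<approx> scale (q ^ j') (word_of u * ?z)"
    using K_X_word[OF z1(2) r(2) K1 r(3), of u] u(1) by blast
  then show thesis using that[of "word_of u * ?z" i' j'] u(1) X colon_hw by blast
qed

end

context uq_hw
begin

text \<open>A vector annihilated by \<open>x\<^sub>1, x\<^sub>2\<close> strictly below the highest weight vector generates a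
  submodule below it as well, by the decomposition of the algebra.\<close>

lemma singular_mem:
  assumes max: "maximal_left_ideal I" and \<nu>: "\<nu> \<in> spanned 1"
    and X: "fgen X1 * \<nu> \<in> I" "fgen X2 * \<nu> \<in> I"
    and K: "fgen K1 * \<nu> \<approx> scale c \<nu>" "fgen K2 * \<nu> \<approx> scale d \<nu>"
  shows "\<nu> \<in> I"
proof (rule ccontr)
  assume "\<nu> \<notin> I"
  then obtain p where p: "p * \<nu> - 1 \<in> I" using maximal_left_ideal_generate[OF max] by blast
  interpret S: uq_hw q n N "{p. p * \<nu> \<in> I}" c d by (rule colon_hw[OF X K])
  obtain w where w: "w \<in> word_span Y1 Y2 0" "p * \<nu> - w * \<nu> \<in> I"
    using S.spanned_UNIV[of p] by (auto simp: S.spanned_def S.eqv_def algebra_simps)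
  obtain v where v: "v \<in> word_span Y1 Y2 1" "\<nu> \<approx> v" using \<nu> by (auto simp: spanned_def)
  have "1 \<approx> p * \<nu>" using p by (intro eqv_sym[of "p * \<nu>"]) (simp add: eqv_def)
  also have "p * \<nu> \<approx> w * \<nu>" using w(2) by (simp add: eqv_def)
  also have "\<dots> \<approx> w * v" by (intro eqv_mult v)
  finally have "1 - w * v \<in> I" by (simp add: eqv_def)
  moreover have "w * v \<in> word_span Y1 Y2 1" using word_span_mult[OF w(1) v(1)] by simp
  ultimately have "1 \<in> I" by (rule one_minus_nilpotent[rotated])
  then show False using max by (simp add: maximal_left_ideal_def)
qed

text \<open>Nilpotency in the larger ideal \<open>I'\<close> removes the constant term, while the
  congruence that remains is the finer one modulo \<open>I\<close>.\<close>

lemma proper_subset_spanned: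
  assumes I': "left_ideal I'" "I \<subseteq> I'" "1 \<notin> I'" and p: "p \<in> I'"
  shows "p \<in> spanned 1"
proof -
  interpret I': uq_hw q n N I' a b
    by unfold_locales (use I' uq_ideal X_mem K_mem in auto)
  obtain c \<nu> where c: "\<nu> \<in> word_span Y1 Y2 1" "p \<approx> scale c 1 + \<nu>" by (rule decompose)
  have "p - (p - (scale c 1 + \<nu>)) \<in> I'"
    by (rule I'.ideal_simps(5)[OF p]) (use I'(2) c(2) in \<open>unfold eqv_def, blast\<close>)
  then have "scale c 1 + \<nu> \<in> I'" by (simp add: add.commute)
  then have "c = 0" using I'.scalar_plus_nilpotent c(1) I'(3) by blast
  then show ?thesis using c by (auto simp: spanned_def)
qed

text \<open>The largest left ideal contained in \<open>spanned 1\<close>; quantifying over all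
  multipliers \<open>u\<close> forces closure under left multiplication.\<close>

definition radical :: "'k falg set" where
  "radical = {p. \<forall>u. u * p \<in> spanned 1}"

lemma radical_greatest:
  assumes "left_ideal I'" "I \<subseteq> I'" "1 \<notin> I'"
  shows "I' \<subseteq> radical"
  using proper_subset_spanned[OF assms] left_idealD(3)[OF assms(1)] by (auto simp: radical_def)

lemma left_ideal_radical: "left_ideal radical"
  using spanned_mem[of 0 1] ideal_simps(1)
  by (auto simp: left_ideal_def radical_def distrib_left spanned_add mult.assoc[symmetric])

lemma subset_radical: "I \<subseteq> radical"
  using ideal_simps(3) spanned_mem by (auto simp: radical_def)

lemma radical_proper: "1 \<notin> I \<Longrightarrow> 1 \<notin> radical"
  using one_notin_spanned by (auto simp: radical_def dest: spec[of _ 1])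

lemma maximal_radical: "1 \<notin> I \<Longrightarrow> maximal_left_ideal radical"
  unfolding maximal_left_ideal_def
  using left_ideal_radical radical_proper radical_greatest subset_radical by blast

lemma maximal_eq_radical:
  assumes "maximal_left_ideal I'" "I \<subseteq> I'"
  shows "I' = radical"
proof -
  have "left_ideal I'" "1 \<notin> I'" using assms by (auto simp: maximal_left_ideal_def)
  then have "I' \<subseteq> radical" "1 \<notin> I" using radical_greatest assms(2) by auto
  then show ?thesis
    using assms(1) left_ideal_radical radical_proper unfolding maximal_left_ideal_def by blast
qed

text \<open>By \<open>singular_mem\<close> a further highest weight vector has a non-zero constant
  term. Comparing constant terms in its eigenvalue equations then identifies the
  eigenvalues.\<close>

lemma weight_unique:
  assumes max: "maximal_left_ideal I" and p: "p \<notin> I" and hw: "uq_hw q n N {z. z * p \<in> I} a' b'"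
  shows "a' = a \<and> b' = b"
proof -
  interpret P: uq_hw q n N "{z. z * p \<in> I}" a' b' by (rule hw)
  have one: "1 \<notin> I" using max by (simp add: maximal_left_ideal_def)
  have X: "fgen X1 * p \<in> I" "fgen X2 * p \<in> I" using P.X_mem by auto
  have K: "fgen K1 * p \<approx> scale a' p" "fgen K2 * p \<approx> scale b' p"
    using P.K_mem by (auto simp: eqv_def scale_def algebra_simps)
  obtain c \<nu> where c: "\<nu> \<in> word_span Y1 Y2 1" "p \<approx> scale c 1 + \<nu>" by (rule decompose)
  have "c \<noteq> 0"
  proof
    assume "c = 0"
    then have "p \<in> spanned 1" using c by (auto simp: spanned_def)
    then show False using singular_mem[OF max _ X K] p by blast
  qed
  have eq: "d = e" if g: "g \<in> {K1, K2}" "fgen g * p \<approx> scale d p" "fgen g * 1 \<approx> scale e 1" for g d e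
  proof (rule ccontr)
    assume "d \<noteq> e"
    have 1: "fgen g * p \<approx> fgen g * (scale c 1 + \<nu>)" by (intro eqv_mult c)
    have 2: "fgen g * (scale c 1 + \<nu>) \<approx> scale c (scale e 1) + fgen g * \<nu>"
      unfolding distrib_left scale_mult_right by (intro eqv_add eqv_scale g eqv_refl)
    have 3: "scale d (scale c 1 + \<nu>) \<approx> scale d p" by (intro eqv_scale eqv_sym[OF c(2)])
    have "scale d (scale c 1 + \<nu>) \<approx> scale c (scale e 1) + fgen g * \<nu>"
      by (rule eqv_trans[OF 3 eqv_trans[OF eqv_sym[OF g(2)] eqv_trans[OF 1 2]]])
    then have "scale (c * (d - e)) 1 \<approx> fgen g * \<nu> - scale d \<nu>"
      by (simp add: eqv_def algebra_simps scale_diff_left)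
    moreover have "fgen g * \<nu> - scale d \<nu> \<in> spanned 1"
      using c(1) g(1) by (intro spanned_diff spanned_scale spanned_K) (auto intro: spannedI)
    ultimately have "scale (c * (d - e)) 1 \<in> spanned 1" by (rule spanned_eqv)
    then have "scale (inverse (c * (d - e))) (scale (c * (d - e)) 1) \<in> spanned 1" by (rule spanned_scale)
    moreover have "inverse (c * (d - e)) * (c * (d - e)) = 1"
      by (rule left_inverse) (use \<open>c \<noteq> 0\<close> \<open>d \<noteq> e\<close> in simp)
    ultimately have "1 \<in> spanned 1" by (simp only: scale_simps)
    then show False using one_notin_spanned one by blast
  qed
  show ?thesis using eq[OF _ K(1) K_one(1)] eq[OF _ K(2) K_one(2)] by auto
qed

end

text \<open>The intersection is again a highest weight left ideal for the same weight, and both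
  ideals are its \<open>radical\<close>.\<close>

lemma (in uq_root) maximal_hw_unique:
  assumes "uq_hw q n N I a b" "uq_hw q n N I' a b" "maximal_left_ideal I" "maximal_left_ideal I'"
  shows "I = I'"
proof -
  interpret I: uq_hw q n N I a b by fact
  interpret I': uq_hw q n N I' a b by fact
  interpret uq_hw q n N "I \<inter> I'" a b
    by unfold_locales
      (use I.X_mem I.K_mem I.uq_ideal I'.X_mem I'.K_mem I'.uq_ideal I.left_ideal I'.left_ideal in
        \<open>auto simp: left_ideal_def\<close>)
  show ?thesis
    using maximal_eq_radical[OF assms(3)] maximal_eq_radical[OF assms(4)] by blast
qed

subsection \<open>Bases of the simple quotients\<close>

context uq_left_ideal
begin

definition fspan :: "'s set \<Rightarrow> ('s \<Rightarrow> 'k falg) \<Rightarrow> 'k falg set" where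
  "fspan S w = {p. \<exists>c. p \<approx> (\<Sum>s\<in>S. scale (c s) (w s))}"

lemma fspan_eqv: "p \<approx> r \<Longrightarrow> r \<in> fspan S w \<Longrightarrow> p \<in> fspan S w"
  unfolding fspan_def by (blast intro: eqv_trans)

lemma fspan_zero: "p \<in> I \<Longrightarrow> p \<in> fspan S w"
  unfolding fspan_def by (intro CollectI exI[of _ "\<lambda>_. 0"]) (simp add: eqv_zero_iff)

lemma fspan_add: "p \<in> fspan S w \<Longrightarrow> r \<in> fspan S w \<Longrightarrow> p + r \<in> fspan S w"
proof -
  assume "p \<in> fspan S w" "r \<in> fspan S w"
  then obtain c d where "p \<approx> (\<Sum>s\<in>S. scale (c s) (w s))" "r \<approx> (\<Sum>s\<in>S. scale (d s) (w s))"
    by (auto simp: fspan_def)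
  from eqv_add[OF this] have "p + r \<approx> (\<Sum>s\<in>S. scale (c s + d s) (w s))"
    by (simp add: scale_add_left sum.distrib)
  then show ?thesis unfolding fspan_def by (intro CollectI exI)
qed

lemma fspan_scale: "p \<in> fspan S w \<Longrightarrow> scale d p \<in> fspan S w"
proof -
  assume "p \<in> fspan S w"
  then obtain c where "p \<approx> (\<Sum>s\<in>S. scale (c s) (w s))" by (auto simp: fspan_def)
  from eqv_scale[OF this, of d] have "scale d p \<approx> (\<Sum>s\<in>S. scale (d * c s) (w s))"
    by (simp add: scale_sum)
  then show ?thesis unfolding fspan_def by (intro CollectI exI)
qed

lemma fspan_sum: "(\<And>t. t \<in> T \<Longrightarrow> f t \<in> fspan S w) \<Longrightarrow> sum f T \<in> fspan S w"
  by (induction T rule: infinite_finite_induct) (simp_all add: fspan_add fspan_zero ideal_simps(1))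

lemma fspan_base: "finite S \<Longrightarrow> s \<in> S \<Longrightarrow> w s \<in> fspan S w"
proof -
  assume "finite S" "s \<in> S"
  then have "(\<Sum>t\<in>S. scale (if t = s then 1 else 0) (w t)) = w s"
    by (simp add: if_distrib[of "\<lambda>c. scale c _"] cong: if_cong)
  then have "w s \<approx> (\<Sum>t\<in>S. scale (if t = s then 1 else 0) (w t))" by simp
  then show ?thesis unfolding fspan_def by (intro CollectI exI)
qed

text \<open>Applying \<open>fgen g\<close> minus the eigenvalue at \<open>t\<close> eliminates one
  weight; two different weights differ in at least one coordinate, so one of the two kappas
  works.\<close>

lemma weight_separation:
  assumes "finite T" and "\<And>c. c \<in> T \<Longrightarrow> fgen K1 * h c \<approx> scale (fst c) (h c)"
    and "\<And>c. c \<in> T \<Longrightarrow> fgen K2 * h c \<approx> scale (snd c) (h c)"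
    and "(\<Sum>c\<in>T. h c) \<in> I" "c \<in> T"
  shows "h c \<in> I"
  using assms
proof (induction T arbitrary: h c rule: finite_induct)
  case (insert t T)
  have step: "scale (e c - e t) (h c) \<in> I"
    if e: "\<And>c. c \<in> insert t T \<Longrightarrow> fgen g * h c \<approx> scale (e c) (h c)" and c: "c \<in> T" for g e c
  proof (rule insert.IH[of "\<lambda>c. scale (e c - e t) (h c)"])
    show "fgen K1 * scale (e c - e t) (h c) \<approx> scale (fst c) (scale (e c - e t) (h c))" if "c \<in> T" for c
      using eqv_scale[OF insert.prems(1)[of c], of "e c - e t"] that by (simp add: scale_mult_right mult.commute)
    show "fgen K2 * scale (e c - e t) (h c) \<approx> scale (snd c) (scale (e c - e t) (h c))" if "c \<in> T" for c
      using eqv_scale[OF insert.prems(2)[of c], of "e c - e t"] that by (simp add: scale_mult_right mult.commute)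
    have "fgen g * (\<Sum>c\<in>insert t T. h c) - scale (e t) (\<Sum>c\<in>insert t T. h c) \<in> I"
      by (intro ideal_simps(3,5) left_ideal_scale[OF left_ideal] insert.prems(3))
    moreover have "(\<Sum>c\<in>insert t T. fgen g * h c - scale (e c) (h c)) \<in> I"
      using e by (intro left_ideal_sum[OF left_ideal]) (auto simp: eqv_def)
    ultimately have "(fgen g * (\<Sum>c\<in>insert t T. h c) - scale (e t) (\<Sum>c\<in>insert t T. h c))
        - (\<Sum>c\<in>insert t T. fgen g * h c - scale (e c) (h c)) \<in> I" by (rule ideal_simps(5))
    also have "(fgen g * (\<Sum>c\<in>insert t T. h c) - scale (e t) (\<Sum>c\<in>insert t T. h c))
        - (\<Sum>c\<in>insert t T. fgen g * h c - scale (e c) (h c)) = (\<Sum>c\<in>insert t T. scale (e c - e t) (h c))"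
      unfolding scale_sum sum_distrib_left scale_diff_left sum_subtractf by simp
    also have "\<dots> = (\<Sum>c\<in>T. scale (e c - e t) (h c))" using insert.hyps by simp
    finally show "(\<Sum>c\<in>T. scale (e c - e t) (h c)) \<in> I" .
  qed (fact c)
  have T: "h c \<in> I" if "c \<in> T" for c
  proof -
    have "c \<noteq> t" using insert.hyps that by auto
    then have "fst c - fst t \<noteq> 0 \<or> snd c - snd t \<noteq> 0" by (auto simp: prod_eq_iff)
    then show ?thesis
      using step[of K1 fst, OF insert.prems(1) that] step[of K2 snd, OF insert.prems(2) that]
        left_ideal_scaleD[OF left_ideal] by blast
  qed
  then have "(\<Sum>c\<in>T. h c) \<in> I" by (intro left_ideal_sum[OF left_ideal])
  with insert.prems(3) insert.hyps have "h t \<in> I"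
    using ideal_simps(5)[of "\<Sum>c\<in>insert t T. h c" "\<Sum>c\<in>T. h c"] by simp
  then show ?case using T insert.prems(4) by blast
qed simp

text \<open>Several vectors may share a weight, so a linear relation splits only into one relation
  for each weight.\<close>

lemma weight_classes:
  assumes "finite S" and "\<And>s. s \<in> S \<Longrightarrow> fgen K1 * w s \<approx> scale (fst (wt s)) (w s)"
    and "\<And>s. s \<in> S \<Longrightarrow> fgen K2 * w s \<approx> scale (snd (wt s)) (w s)"
    and "(\<Sum>s\<in>S. scale (c s) (w s)) \<in> I"
  shows "(\<Sum>s | s \<in> S \<and> wt s = e. scale (c s) (w s)) \<in> I"
proof (cases "e \<in> wt ` S")
  case True
  let ?h = "\<lambda>e. \<Sum>s | s \<in> S \<and> wt s = e. scale (c s) (w s)"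
  have eig: "fgen g * ?h e \<approx> scale (f e) (?h e)"
    if "\<And>s. s \<in> S \<Longrightarrow> fgen g * w s \<approx> scale (f (wt s)) (w s)" for g f e
  proof -
    have "(\<Sum>s | s \<in> S \<and> wt s = e. scale (c s) (fgen g * w s - scale (f e) (w s))) \<in> I"
      using that by (intro left_ideal_sum[OF left_ideal] left_ideal_scale[OF left_ideal]) (auto simp: eqv_def)
    then show ?thesis
      by (simp add: eqv_def scale_sum sum_distrib_left scale_mult_right sum_subtractf mult.commute)
  qed
  show ?thesis
  proof (rule weight_separation[of "wt ` S" ?h e])
    show "finite (wt ` S)" using assms(1) by simp
    show "fgen K1 * ?h d \<approx> scale (fst d) (?h d)" "fgen K2 * ?h d \<approx> scale (snd d) (?h d)" for d
      using eig[of K1 fst] eig[of K2 snd] assms(2,3) by auto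
    show "(\<Sum>d\<in>wt ` S. ?h d) \<in> I" using assms(4) sum.image_gen[OF assms(1), of "\<lambda>s. scale (c s) (w s)" wt] by simp
  qed (fact True)
next
  case False
  then have "{s. s \<in> S \<and> wt s = e} = {}" by auto
  then show ?thesis by (simp only: sum.empty ideal_simps)
qed

end

context uq_hw
begin

text \<open>Every element is congruent to a combination of words in \<open>Y1\<close>,
  \<open>Y2\<close>, so stability under these two letters decides.\<close>

lemma fspan_UNIV:
  assumes "finite S" "1 \<in> fspan S w"
    and Y: "\<And>s. s \<in> S \<Longrightarrow> fgen Y1 * w s \<in> fspan S w" "\<And>s. s \<in> S \<Longrightarrow> fgen Y2 * w s \<in> fspan S w"
  shows "p \<in> fspan S w"
proof -
  have step: "fgen y * r \<in> fspan S w" if y: "y \<in> {Y1, Y2}" and r: "r \<in> fspan S w" for y r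
  proof -
    obtain c where c: "r \<approx> (\<Sum>s\<in>S. scale (c s) (w s))" using r by (auto simp: fspan_def)
    have "fgen y * r \<approx> (\<Sum>s\<in>S. scale (c s) (fgen y * w s))"
      using eqv_mult[OF c, of "fgen y"] by (simp add: sum_distrib_left scale_mult_right)
    moreover have "(\<Sum>s\<in>S. scale (c s) (fgen y * w s)) \<in> fspan S w"
      using y Y by (intro fspan_sum fspan_scale) auto
    ultimately show ?thesis by (rule fspan_eqv)
  qed
  have word: "word_of u \<in> fspan S w" if "set u \<subseteq> {Y1, Y2}" for u
    using that by (induction u) (auto simp: word_of_Nil word_of_Cons assms(2) intro: step)
  obtain v where v: "v \<in> word_span Y1 Y2 0" "p \<approx> v" using spanned_UNIV[of p] by (auto simp: spanned_def)
  from v(1) have "v \<in> fspan S w"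
    by (induction rule: word_span_induct) (simp_all add: fspan_add fspan_scale word fspan_zero ideal_simps(1))
  with v(2) show ?thesis by (rule fspan_eqv)
qed

end

locale uq_simple = uq_hw q n N I "q ^ i" "q ^ j"
  for q :: "'k::field_char_0" and n N I i j +
  assumes maximal: "maximal_left_ideal I" and ij: "i < N" "j < N"
begin

lemma one_notin: "1 \<notin> I"
  using maximal by (simp add: maximal_left_ideal_def)

lemma scale_one_mem: "scale c 1 \<in> I \<longleftrightarrow> c = 0"
  using left_ideal_scaleD[OF left_ideal, of c 1] one_notin by (auto simp: ideal_simps)

lemma q_ratio_eq_one: "a < N \<Longrightarrow> b < N \<Longrightarrow> q ^ a / q ^ b = 1 \<longleftrightarrow> a = b"
  using q_power_eq_iff[of a b] q_nonzero by (simp add: divide_eq_1_iff)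

lemma spanned_words: "C m \<in> spanned 1" "D m \<in> spanned 1" "A (Suc m) \<in> spanned 1" "B (Suc m) \<in> spanned 1"
proof -
  have Y: "fgen y * p \<in> spanned 1" if "y \<in> {Y1, Y2}" for y p
    using spanned_gen[OF spanned_UNIV that] by simp
  then show "C m \<in> spanned 1" "D m \<in> spanned 1" "A (Suc m) \<in> spanned 1" "B (Suc m) \<in> spanned 1"
    unfolding A_Suc B_Suc by auto
qed

text \<open>For \<open>i = 0\<close> the scalar 1 - q^i vanishes, so y2 v is killed by x2 as well as
  by x1 and is zero in the simple quotient; the other words considered are left multiples of
  it.\<close>

lemma D_zero: "i = 0 \<Longrightarrow> D m \<in> I" and B_zero: "i = 0 \<Longrightarrow> B (Suc m) \<in> I"
proof -
  assume i: "i = 0"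
  have D0: "D 0 \<in> I"
  proof (rule singular_mem[OF maximal spanned_words(2) _ _ K_D])
    show "fgen X1 * D 0 \<in> I" using X1_BD(1)[of 0] by (simp add: eqv_zero_iff)
    show "fgen X2 * D 0 \<in> I" using X2_D0 i by (simp add: eqv_zero_iff)
  qed
  have B: "B (Suc l) \<in> I" for l
    unfolding power_Suc2 using D0 by (intro ideal_simps(3)) (simp add: ideal_simps)
  show "B (Suc m) \<in> I" by (rule B)
  show "D m \<in> I"
  proof (cases m)
    case (Suc l)
    show ?thesis unfolding Suc by (rule ideal_simps(3)[OF B])
  qed (use D0 in simp)
qed

lemma C_zero: "j = 0 \<Longrightarrow> C m \<in> I" and A_zero: "j = 0 \<Longrightarrow> A (Suc m) \<in> I"
proof -
  assume j: "j = 0"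
  have C0: "C 0 \<in> I"
  proof (rule singular_mem[OF maximal spanned_words(1) _ _ K_C])
    show "fgen X2 * C 0 \<in> I" using X2_AC(1)[of 0] by (simp add: eqv_zero_iff)
    show "fgen X1 * C 0 \<in> I" using X1_C0 j by (simp add: eqv_zero_iff)
  qed
  have A: "A (Suc l) \<in> I" for l
    unfolding power_Suc2 using C0 by (intro ideal_simps(3)) (simp add: ideal_simps)
  show "A (Suc m) \<in> I" by (rule A)
  show "C m \<in> I"
  proof (cases m)
    case (Suc l)
    show ?thesis unfolding Suc by (rule ideal_simps(3)[OF A])
  qed (use C0 in simp)
qed

text \<open>The words 1, y1, y2 y1, y1 y2 y1, ... with y1 as last letter, indexed by their length;
  \<open>wB\<close> is the mirror image.\<close>

definition wA :: "nat \<Rightarrow> 'k falg" where "wA s = (if even s then A (s div 2) else C (s div 2))"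
definition wB :: "nat \<Rightarrow> 'k falg" where "wB s = (if even s then B (s div 2) else D (s div 2))"

lemma wA_simps: "wA (2 * m) = A m" "wA (Suc (2 * m)) = C m" "wA 0 = 1"
  and wB_simps: "wB (2 * m) = B m" "wB (Suc (2 * m)) = D m" "wB 0 = 1"
  by (auto simp: wA_def wB_def)

text \<open>The numbers of letters \<open>Y1\<close> and \<open>Y2\<close>, that is, the drops of
  the two weight coordinates.\<close>

definition eA :: "nat \<Rightarrow> nat \<times> nat" where "eA s = (if even s then (s div 2, s div 2) else (Suc (s div 2), s div 2))"
definition eB :: "nat \<Rightarrow> nat \<times> nat" where "eB s = (if even s then (s div 2, s div 2) else (s div 2, Suc (s div 2)))"

definition wt :: "nat \<times> nat \<Rightarrow> 'k \<times> 'k" where "wt e = (q ^ i / q ^ fst e, q ^ j / q ^ snd e)"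

lemma K_wA: "fgen K1 * wA s \<approx> scale (fst (wt (eA s))) (wA s)" "fgen K2 * wA s \<approx> scale (snd (wt (eA s))) (wA s)"
  unfolding wA_def eA_def wt_def using K_A[of "s div 2"] K_C[of "s div 2"]
  by (cases "even s"; simp only: if_True if_False fst_conv snd_conv simp_thms)+

lemma K_wB: "fgen K1 * wB s \<approx> scale (fst (wt (eB s))) (wB s)" "fgen K2 * wB s \<approx> scale (snd (wt (eB s))) (wB s)"
  unfolding wB_def eB_def wt_def using K_B[of "s div 2"] K_D[of "s div 2"]
  by (cases "even s"; simp only: if_True if_False fst_conv snd_conv simp_thms)+

lemma independentI:
  assumes "finite S" "inj_on wt' S"
    and "\<And>s. s \<in> S \<Longrightarrow> fgen K1 * w s \<approx> scale (fst (wt' s)) (w s)"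
    and "\<And>s. s \<in> S \<Longrightarrow> fgen K2 * w s \<approx> scale (snd (wt' s)) (w s)"
    and "\<And>s. s \<in> S \<Longrightarrow> w s \<notin> I" "(\<Sum>s\<in>S. scale (c s) (w s)) \<in> I" "s \<in> S"
  shows "c s = 0"
proof -
  have "{t. t \<in> S \<and> wt' t = wt' s} = {s}" using assms(2,7) by (auto dest: inj_onD)
  then have "scale (c s) (w s) \<in> I"
    using weight_classes[OF assms(1,3,4,6), of "wt' s"] by simp
  then show ?thesis using left_ideal_scaleD[OF left_ideal] assms(5,7) by blast
qed

section \<open>The case i = 0: a single chain\<close>

context
  assumes i0: "i = 0" and j0: "0 < j"
begin

text \<open>In x1 \<open>C j\<close> the coefficient of \<open>A j\<close> is 1 - q^j / q^j = 0 and
  the term with \<open>B j\<close> vanishes for \<open>i = 0\<close>; so \<open>C j\<close> is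
  killed by x1 and x2.\<close>

lemma left_chain_end: "C j \<in> I"
proof -
  obtain j' where j': "j = Suc j'" using j0 by (cases j) auto
  have "fgen X1 * C j \<approx> scale (1 - q ^ j / q ^ j) (A j) - scale (\<alpha> j') (B j)"
    using X1_C[of j'] by (simp only: j')
  moreover have "scale (1 - q ^ j / q ^ j) (A j) - scale (\<alpha> j') (B j) \<in> I"
    using B_zero[OF i0, of j'] q_nonzero
    by (simp only: j') (simp add: ideal_simps left_ideal_scale[OF left_ideal])
  ultimately have "fgen X1 * C j \<in> I" by (rule eqv_mem)
  moreover have "fgen X2 * C j \<in> I" using X2_AC(1)[of j] by (simp add: eqv_zero_iff)
  ultimately show ?thesis by (rule singular_mem[OF maximal spanned_words(1) _ _ K_C])
qed

text \<open>Climbing up the chain: x2 takes \<open>A (Suc m)\<close> to \<open>C m\<close>, and x1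
  takes \<open>C (Suc m)\<close> to \<open>A (Suc m)\<close> up to a term that is zero here, with
  non-zero scalars because the exponents lie strictly between the degenerate ones.\<close>

lemma left_chain_nonzero: "m < j \<Longrightarrow> A m \<notin> I \<and> C m \<notin> I"
proof (induction m)
  case 0
  have "q ^ j \<noteq> 1" using q_power_eq_iff[of j 0] ij j0 by auto
  then show ?case using one_notin eqv_mem_iff[OF X1_C0] scale_one_mem ideal_simps(3)[of "C 0" "fgen X1"] by auto
next
  case (Suc m)
  have "A (Suc m) \<notin> I"
  proof
    assume "A (Suc m) \<in> I"
    then have "fgen X2 * A (Suc m) \<in> I" by (rule ideal_simps)
    then have "scale (1 - q ^ i / q ^ Suc m) (C m) \<in> I" using eqv_mem_iff[OF X2_AC(2)] by blast
    moreover have "1 - q ^ i / q ^ Suc m \<noteq> 0" using q_ratio_eq_one[of i "Suc m"] ij Suc.prems i0 by auto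
    ultimately show False using left_ideal_scaleD[OF left_ideal] Suc by auto
  qed
  moreover have "C (Suc m) \<notin> I"
  proof
    assume "C (Suc m) \<in> I"
    then have "fgen X1 * C (Suc m) \<in> I" by (rule ideal_simps)
    then have "scale (1 - q ^ j / q ^ Suc m) (A (Suc m)) - scale (\<alpha> m) (B (Suc m)) \<in> I"
      using eqv_mem_iff[OF X1_C] by blast
    moreover have "scale (\<alpha> m) (B (Suc m)) \<in> I" by (intro left_ideal_scale[OF left_ideal] B_zero i0)
    ultimately have "scale (1 - q ^ j / q ^ Suc m) (A (Suc m)) \<in> I"
      using ideal_simps(2) by fastforce
    moreover have "1 - q ^ j / q ^ Suc m \<noteq> 0" using q_ratio_eq_one[of j "Suc m"] ij Suc.prems by auto
    ultimately show False using left_ideal_scaleD[OF left_ideal] \<open>A (Suc m) \<notin> I\<close> by blast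
  qed
  ultimately show ?case ..
qed

lemma left_chain_last: "A j \<notin> I"
proof
  obtain j' where j': "j = Suc j'" using j0 by (cases j) auto
  assume "A j \<in> I"
  then have "fgen X2 * A j \<in> I" by (rule ideal_simps)
  then have "scale (1 - q ^ i / q ^ Suc j') (C j') \<in> I" using eqv_mem_iff[OF X2_AC(2)[of j']] unfolding j' by blast
  moreover have "1 - q ^ i / q ^ Suc j' \<noteq> 0" using q_ratio_eq_one[of i "Suc j'"] ij i0 j' by auto
  ultimately show False using left_ideal_scaleD[OF left_ideal] left_chain_nonzero[of j'] j' by auto
qed

lemma wA_nonzero:
  assumes "s \<in> {0..2 * j}"
  shows "wA s \<notin> I"
proof (cases "s = 2 * j")
  case False
  then have "s div 2 < j" using assms by auto
  then show ?thesis using left_chain_nonzero[of "s div 2"] by (simp add: wA_def)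
qed (simp add: wA_simps left_chain_last)

lemma left_chain_spanning: "p \<in> fspan {0..2 * j} wA"
proof (rule fspan_UNIV)
  show "1 \<in> fspan {0..2 * j} wA" using fspan_base[of "{0..2 * j}" 0 wA] by (simp add: wA_simps)
  fix s assume s: "s \<in> {0..2 * j}"
  show "fgen Y1 * wA s \<in> fspan {0..2 * j} wA"
  proof (cases "even s")
    case True
    then obtain m where m: "s = 2 * m" by auto
    show ?thesis
      using s fspan_base[of "{0..2 * j}" "Suc s" wA] left_chain_end
      by (cases "m = j") (auto simp: m wA_simps intro: fspan_zero)
  qed (use Y_zero(1) in \<open>auto simp: wA_def eqv_zero_iff intro: fspan_zero\<close>)
  show "fgen Y2 * wA s \<in> fspan {0..2 * j} wA"
  proof (cases "even s")
    case True
    then obtain m where m: "s = 2 * m" by auto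
    show ?thesis
      using D_zero[OF i0, of 0] Y_zero(4)[unfolded eqv_zero_iff]
      unfolding m wA_simps by (cases m) (auto simp del: power_Suc intro: fspan_zero)
  next
    case False
    then obtain m where m: "s = Suc (2 * m)" by (auto elim: oddE)
    have "fgen Y2 * wA s = wA (2 * Suc m)" unfolding m wA_simps A_Suc ..
    moreover have "2 * Suc m \<le> 2 * j" using s unfolding m atLeastAtMost_iff by presburger
    ultimately show ?thesis using fspan_base[of "{0..2 * j}" "2 * Suc m" wA] by simp
  qed
qed simp

text \<open>All 2j + 1 weights differ: the second coordinate determines half the index because j <
  N, and the first then its parity because q is not 1.\<close>

lemma left_chain_independent:
  assumes "(\<Sum>s\<in>{0..2 * j}. scale (c s) (wA s)) \<in> I" "s \<in> {0..2 * j}"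
  shows "c s = 0"
proof (rule independentI[OF _ _ K_wA wA_nonzero assms])
  show "inj_on (\<lambda>s. wt (eA s)) {0..2 * j}"
  proof (rule inj_onI)
    fix s t assume st: "s \<in> {0..2 * j}" "t \<in> {0..2 * j}" "wt (eA s) = wt (eA t)"
    then have "q ^ snd (eA s) = q ^ snd (eA t)" "q ^ fst (eA s) = q ^ fst (eA t)" 
      using q_nonzero by (auto simp: wt_def)
    moreover have snd: "snd (eA s) = s div 2" "snd (eA t) = t div 2" by (auto simp: eA_def)
    moreover have "s div 2 < N" "t div 2 < N" using st ij by auto
    ultimately have eq: "s div 2 = t div 2" using q_power_eq_iff by auto
    have "q \<noteq> 1" using q_prim[of 1] N_gt by auto
    then have "even s = even t"
      using \<open>q ^ fst (eA s) = q ^ fst (eA t)\<close> eq q_nonzero by (auto simp: eA_def split: if_splits)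
    with eq show "s = t" by (metis even_two_times_div_two odd_two_times_div_two_succ)
  qed
qed auto

end

section \<open>The case j = 0: the mirror chain\<close>

context
  assumes i0: "0 < i" and j0: "j = 0"
begin

lemma right_chain_end: "D i \<in> I"
proof -
  obtain i' where i': "i = Suc i'" using i0 by (cases i) auto
  have "fgen X2 * D i \<approx> scale (1 - q ^ i / q ^ i) (B i) - scale (\<beta> i') (A i)"
    using X2_D[of i'] by (simp only: i')
  moreover have "scale (1 - q ^ i / q ^ i) (B i) - scale (\<beta> i') (A i) \<in> I"
    using A_zero[OF j0, of i'] q_nonzero
    by (simp only: i') (simp add: ideal_simps left_ideal_scale[OF left_ideal])
  ultimately have "fgen X2 * D i \<in> I" by (rule eqv_mem)
  moreover have "fgen X1 * D i \<in> I" using X1_BD(1)[of i] by (simp add: eqv_zero_iff)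
  ultimately show ?thesis by (rule singular_mem[OF maximal spanned_words(2) _ _ K_D, rotated])
qed

text \<open>Here x1 climbs from \<open>B (Suc m)\<close> to \<open>D m\<close> and x2 from
  \<open>D (Suc m)\<close> to \<open>B (Suc m)\<close>, the extra term with \<open>A (Suc m)\<close>
  being zero for \<open>j = 0\<close>.\<close>

lemma right_chain_nonzero: "m < i \<Longrightarrow> B m \<notin> I \<and> D m \<notin> I"
proof (induction m)
  case 0
  have "q ^ i \<noteq> 1" using q_power_eq_iff[of i 0] ij i0 by auto
  then show ?case using one_notin eqv_mem_iff[OF X2_D0] scale_one_mem ideal_simps(3)[of "D 0" "fgen X2"] by auto
next
  case (Suc m)
  have "B (Suc m) \<notin> I"
  proof
    assume "B (Suc m) \<in> I"
    then have "fgen X1 * B (Suc m) \<in> I" by (rule ideal_simps)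
    then have "scale (1 - q ^ j / q ^ Suc m) (D m) \<in> I" using eqv_mem_iff[OF X1_BD(2)] by blast
    moreover have "1 - q ^ j / q ^ Suc m \<noteq> 0" using q_ratio_eq_one[of j "Suc m"] ij Suc.prems j0 by auto
    ultimately show False using left_ideal_scaleD[OF left_ideal] Suc by auto
  qed
  moreover have "D (Suc m) \<notin> I"
  proof
    assume "D (Suc m) \<in> I"
    then have "fgen X2 * D (Suc m) \<in> I" by (rule ideal_simps)
    then have "scale (1 - q ^ i / q ^ Suc m) (B (Suc m)) - scale (\<beta> m) (A (Suc m)) \<in> I"
      using eqv_mem_iff[OF X2_D] by blast
    moreover have "scale (\<beta> m) (A (Suc m)) \<in> I" by (intro left_ideal_scale[OF left_ideal] A_zero j0)
    ultimately have "scale (1 - q ^ i / q ^ Suc m) (B (Suc m)) \<in> I"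
      using ideal_simps(2) by fastforce
    moreover have "1 - q ^ i / q ^ Suc m \<noteq> 0" using q_ratio_eq_one[of i "Suc m"] ij Suc.prems by auto
    ultimately show False using left_ideal_scaleD[OF left_ideal] \<open>B (Suc m) \<notin> I\<close> by blast
  qed
  ultimately show ?case ..
qed

lemma right_chain_last: "B i \<notin> I"
proof
  obtain i' where i': "i = Suc i'" using i0 by (cases i) auto
  assume "B i \<in> I"
  then have "fgen X1 * B i \<in> I" by (rule ideal_simps)
  then have "scale (1 - q ^ j / q ^ Suc i') (D i') \<in> I" using eqv_mem_iff[OF X1_BD(2)[of i']] unfolding i' by blast
  moreover have "1 - q ^ j / q ^ Suc i' \<noteq> 0" using q_ratio_eq_one[of j "Suc i'"] ij j0 i' by auto
  ultimately show False using left_ideal_scaleD[OF left_ideal] right_chain_nonzero[of i'] i' by auto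
qed

lemma wB_nonzero:
  assumes "s \<in> {0..2 * i}"
  shows "wB s \<notin> I"
proof (cases "s = 2 * i")
  case False
  then have "s div 2 < i" using assms by auto
  then show ?thesis using right_chain_nonzero[of "s div 2"] by (simp add: wB_def)
qed (simp add: wB_simps right_chain_last)

lemma right_chain_spanning: "p \<in> fspan {0..2 * i} wB"
proof (rule fspan_UNIV)
  show "1 \<in> fspan {0..2 * i} wB" using fspan_base[of "{0..2 * i}" 0 wB] by (simp add: wB_simps)
  fix s assume s: "s \<in> {0..2 * i}"
  show "fgen Y2 * wB s \<in> fspan {0..2 * i} wB"
  proof (cases "even s")
    case True
    then obtain m where m: "s = 2 * m" by auto
    show ?thesis
      using s fspan_base[of "{0..2 * i}" "Suc s" wB] right_chain_end
      by (cases "m = i") (auto simp: m wB_simps intro: fspan_zero)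
  qed (use Y_zero(2) in \<open>auto simp: wB_def eqv_zero_iff intro: fspan_zero\<close>)
  show "fgen Y1 * wB s \<in> fspan {0..2 * i} wB"
  proof (cases "even s")
    case True
    then obtain m where m: "s = 2 * m" by auto
    show ?thesis
      using C_zero[OF j0, of 0] Y_zero(3)[unfolded eqv_zero_iff]
      unfolding m wB_simps by (cases m) (auto simp del: power_Suc intro: fspan_zero)
  next
    case False
    then obtain m where m: "s = Suc (2 * m)" by (auto elim: oddE)
    have "fgen Y1 * wB s = wB (2 * Suc m)" unfolding m wB_simps B_Suc ..
    moreover have "2 * Suc m \<le> 2 * i" using s unfolding m atLeastAtMost_iff by presburger
    ultimately show ?thesis using fspan_base[of "{0..2 * i}" "2 * Suc m" wB] by simp
  qed
qed simp

lemma right_chain_independent: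
  assumes "(\<Sum>s\<in>{0..2 * i}. scale (c s) (wB s)) \<in> I" "s \<in> {0..2 * i}"
  shows "c s = 0"
proof (rule independentI[OF _ _ K_wB wB_nonzero assms])
  show "inj_on (\<lambda>s. wt (eB s)) {0..2 * i}"
  proof (rule inj_onI)
    fix s t assume st: "s \<in> {0..2 * i}" "t \<in> {0..2 * i}" "wt (eB s) = wt (eB t)"
    then have "q ^ fst (eB s) = q ^ fst (eB t)" "q ^ snd (eB s) = q ^ snd (eB t)" 
      using q_nonzero by (auto simp: wt_def)
    moreover have "fst (eB s) = s div 2" "fst (eB t) = t div 2" by (auto simp: eB_def)
    moreover have "s div 2 < N" "t div 2 < N" using st ij by auto
    ultimately have eq: "s div 2 = t div 2" using q_power_eq_iff by auto
    have "q \<noteq> 1" using q_prim[of 1] N_gt by auto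
    then have "even s = even t"
      using \<open>q ^ snd (eB s) = q ^ snd (eB t)\<close> eq q_nonzero by (auto simp: eB_def split: if_splits)
    with eq show "s = t" by (metis even_two_times_div_two odd_two_times_div_two_succ)
  qed
qed auto

end

end

section \<open>The case i, j > 0: two chains closing to a diamond\<close>

lemma diamond_index_cases:
  assumes "t \<in> {0..2 * k} <+> {1..2 * k - 1}" "0 < k"
  obtains m where "t = Inl (2 * m)" "m \<le> k" | m where "t = Inl (Suc (2 * m))" "m < k"
    | m where "t = Inr (2 * m)" "0 < m" "m < k" | m where "t = Inr (Suc (2 * m))" "m < k"
proof -
  consider s where "t = Inl s" "s \<le> 2 * k" | s where "t = Inr s" "1 \<le> s" "s < 2 * k" using assms by auto
  then show thesis
  proof cases
    case (1 s)
    then show thesis using that(1,2)[of "s div 2"]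
      by (cases "even s") (auto elim!: evenE oddE)
  next
    case (2 s)
    then show thesis using that(3,4)[of "s div 2"]
      by (cases "even s") (auto elim!: evenE oddE)
  qed
qed

context uq_hw
begin

text \<open>\<open>Inl\<close> tags the first chain and \<open>Inr\<close> the second. The value
  \<open>B k\<close> at \<open>Inr (2 * k)\<close>, outside the index set, realises the convention
  that both chains end in the same vector.\<close>

definition wAB :: "nat \<Rightarrow> nat + nat \<Rightarrow> 'k falg" where
  "wAB k t = (case t of Inl s \<Rightarrow> if even s then B (s div 2) else D (s div 2)
     | Inr s \<Rightarrow> if s = 2 * k then B k else if even s then A (s div 2) else C (s div 2))"

text \<open>The two congruences at level \<open>k\<close> close the chains. They hold in the simple
  quotient for k congruent to i + j, and in every highest weight left ideal for k = N, which is how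
  standard modules are reached.\<close>

lemma diamond_spanning:
  assumes k: "0 < k" and DB: "D k \<in> I" and AB: "A k \<approx> scale \<mu> (B k)"
  shows "p \<in> fspan ({0..2 * k} <+> {1..2 * k - 1}) (wAB k)"
proof -
  let ?S = "{0..2 * k} <+> {1..2 * k - 1}"
  note base = fspan_base[of ?S _ "wAB k"]
  have InlS: "Inl s \<in> ?S" if "s \<le> 2 * k" for s using that by (intro InlI) simp
  have InrS: "Inr s \<in> ?S" if "0 < s" "s < 2 * k" for s using that by (intro InrI) auto
  have B: "B m \<in> fspan ?S (wAB k)" if "m \<le> k" for m
    using base[OF _ InlS[of "2 * m"]] that by (simp add: wAB_def)
  have D: "D m \<in> fspan ?S (wAB k)" if "m \<le> k" for m
    using base[OF _ InlS[of "Suc (2 * m)"]] that DB by (cases "m = k") (simp_all add: wAB_def fspan_zero)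
  have A: "A m \<in> fspan ?S (wAB k)" if m: "m \<le> k" for m
  proof -
    consider "m = 0" | "m = k" | "0 < m" "m < k" using m by linarith
    then show ?thesis
    proof cases
      case 1
      then show ?thesis using B[of 0] by simp
    next
      case 2
      then show ?thesis using fspan_eqv[OF AB fspan_scale[OF B]] by simp
    next
      case 3
      then have "Inr (2 * m) \<in> ?S" by (intro InrS) auto
      from base[OF _ this] show ?thesis using 3 by (simp add: wAB_def)
    qed
  qed
  have C: "C m \<in> fspan ?S (wAB k)" if "m < k" for m
  proof -
    have "Suc (2 * m) \<noteq> 2 * k" by presburger
    then show ?thesis using base[OF _ InrS[of "Suc (2 * m)"]] that by (simp add: wAB_def)
  qed
  note zero = Y_zero[unfolded eqv_zero_iff, THEN fspan_zero]
  have YB: "fgen Y1 * B m \<in> fspan ?S (wAB k)" "fgen Y2 * B m \<in> fspan ?S (wAB k)" if "m \<le> k" for m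
    using zero(3)[of "m - 1"] C[of 0] k D[OF that] by (cases m, simp_all del: power_Suc)
  show ?thesis
  proof (rule fspan_UNIV)
    show "1 \<in> fspan ?S (wAB k)" using B[of 0] by simp
    fix t assume t: "t \<in> ?S"
    from t k have "fgen Y1 * wAB k t \<in> fspan ?S (wAB k) \<and> fgen Y2 * wAB k t \<in> fspan ?S (wAB k)"
    proof (cases rule: diamond_index_cases)
      case (1 m)
      then show ?thesis using YB by (simp add: wAB_def)
    next
      case (2 m)
      then have "wAB k t = D m" by (simp add: wAB_def)
      then show ?thesis using B[of "Suc m"] zero(2)[of m] 2 unfolding B_Suc by simp
    next
      case (3 m)
      then have "wAB k t = A m" by (simp add: wAB_def)
      then show ?thesis using C[of m] zero(4)[of "m - 1"] 3 by (simp del: power_Suc)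
    next
      case (4 m)
      then have "Suc (2 * m) \<noteq> 2 * k" by presburger
      then have "wAB k t = C m" using 4 by (simp add: wAB_def)
      then show ?thesis using A[of "Suc m"] zero(1)[of m] 4 unfolding A_Suc by simp
    qed
    then show "fgen Y1 * wAB k t \<in> fspan ?S (wAB k)" "fgen Y2 * wAB k t \<in> fspan ?S (wAB k)" by auto
  qed simp
qed

end

context uq_simple
begin

context
  fixes k
  assumes i0: "0 < i" and j0: "0 < j" and k: "0 < k" "k \<le> N" and kij: "k mod N = (i + j) mod N"
begin

lemma q_k: "q ^ k = q ^ i * q ^ j"
  using kij q_power_mod[of k] q_power_mod[of "i + j"] by (simp add: power_add)

lemma q_ij: "q ^ i \<noteq> 1" "q ^ j \<noteq> 1"
  using q_power_eq_iff[of i 0] q_power_eq_iff[of j 0] ij i0 j0 by auto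

lemma ratio_k: "1 - q ^ j / q ^ k \<noteq> 0" "1 - q ^ i / q ^ k \<noteq> 0"
  using q_ij q_nonzero by (auto simp: q_k)

lemma \<alpha>_nonzero: "\<alpha> m \<noteq> 0" and \<beta>_nonzero: "\<beta> m \<noteq> 0"
  using q_ij q_nonzero by (auto simp: \<alpha>_def \<beta>_def)

text \<open>At level \<open>k\<close> the determinant vanishes, so x1 and x2 have a common kernel
  vector on the span of \<open>A k\<close> and \<open>B k\<close>. Being singular, it is zero in the
  simple quotient.\<close>

lemma AB_k: "\<exists>\<mu>. \<mu> \<noteq> 0 \<and> A k \<approx> scale \<mu> (B k)"
proof -
  obtain l where l: "k = Suc l" using k by (cases k) auto
  define x where "x = 1 - q ^ j / q ^ k"
  \<comment> \<open>Chosen so that x1 kills it; that x2 kills it too is the vanishing of the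
    determinant.\<close>
  let ?v = "scale (\<alpha> l) (B k) - scale x (A k)"
  have det: "\<alpha> l * \<beta> l = x * (1 - q ^ i / q ^ k)"
    using AB_det[of l] q_nonzero unfolding x_def l[symmetric] by (simp add: q_k)
  have "fgen X1 * ?v \<approx> scale (\<alpha> l) (scale x (D l)) - scale x (scale (\<alpha> l) (D l))"
    unfolding right_diff_distrib scale_mult_right x_def
    using X1_BD(2)[of l] X1_A[of l] by (intro eqv_diff eqv_scale) (simp_all only: l)
  then have 1: "fgen X1 * ?v \<in> I" by (simp add: eqv_zero_iff mult.commute)
  have "fgen X2 * ?v \<approx> scale (\<alpha> l) (scale (\<beta> l) (C l)) - scale x (scale (1 - q ^ i / q ^ k) (C l))"
    unfolding right_diff_distrib scale_mult_right
    using X2_B[of l] X2_AC(2)[of l] by (intro eqv_diff eqv_scale) (simp_all only: l)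
  then have 2: "fgen X2 * ?v \<in> I" by (simp add: eqv_zero_iff det)
  have K: "fgen K1 * ?v \<approx> scale (q ^ i / q ^ k) ?v" "fgen K2 * ?v \<approx> scale (q ^ j / q ^ k) ?v"
  proof -
    have "fgen K1 * ?v \<approx> scale (\<alpha> l) (scale (q ^ i / q ^ k) (B k)) - scale x (scale (q ^ i / q ^ k) (A k))"
      "fgen K2 * ?v \<approx> scale (\<alpha> l) (scale (q ^ j / q ^ k) (B k)) - scale x (scale (q ^ j / q ^ k) (A k))"
      unfolding right_diff_distrib scale_mult_right by (intro eqv_diff eqv_scale K_A K_B)+
    then show "fgen K1 * ?v \<approx> scale (q ^ i / q ^ k) ?v" "fgen K2 * ?v \<approx> scale (q ^ j / q ^ k) ?v"
      by (simp_all add: mult.commute)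
  qed
  have "?v \<in> spanned 1"
    unfolding l by (intro spanned_diff spanned_scale spanned_words)
  then have "?v \<in> I" by (rule singular_mem[OF maximal _ 1 2 K])
  then have "scale (- inverse x) ?v \<in> I" by (rule left_ideal_scale[OF left_ideal])
  moreover have "scale (- inverse x) ?v = A k - scale (\<alpha> l / x) (B k)"
    using ratio_k(1) unfolding x_def[symmetric] by (simp add: divide_inverse mult.commute)
  ultimately have "A k \<approx> scale (\<alpha> l / x) (B k)" by (simp add: eqv_def)
  moreover have "\<alpha> l / x \<noteq> 0" using ratio_k(1) \<alpha>_nonzero by (simp add: x_def)
  ultimately show ?thesis by blast
qed

text \<open>Multiplying the proportionality of \<open>A k\<close> and \<open>B k\<close> by y1 or y2
  creates a square on one side.\<close>

lemma C_k: "C k \<in> I" and D_k: "D k \<in> I"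
proof -
  obtain l where l: "k = Suc l" using k by (cases k) auto
  obtain \<mu> where \<mu>: "\<mu> \<noteq> 0" "A k \<approx> scale \<mu> (B k)" using AB_k by blast
  have "C k \<approx> scale \<mu> (fgen Y1 * B k)" using eqv_mult[OF \<mu>(2)] by (simp add: scale_mult_right)
  moreover have "scale \<mu> (fgen Y1 * B k) \<in> I"
    using Y_zero(3)[of l] unfolding l by (intro left_ideal_scale[OF left_ideal]) (simp only: eqv_zero_iff)
  ultimately show "C k \<in> I" by (rule eqv_mem)
  have "fgen Y2 * A k \<approx> scale \<mu> (D k)" using eqv_mult[OF \<mu>(2), of "fgen Y2"] by (simp add: scale_mult_right)
  moreover have "fgen Y2 * A k \<in> I" using Y_zero(4)[of l] unfolding l by (simp only: eqv_zero_iff)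
  ultimately have "scale \<mu> (D k) \<in> I" using eqv_mem_iff by blast
  then show "D k \<in> I" using \<mu>(1) by (rule left_ideal_scaleD[OF left_ideal])
qed

text \<open>Applying x1 and x2 gives two linear equations for \<open>x\<close> and \<open>y\<close>,
  whose determinant is non-zero strictly before level \<open>k\<close>.\<close>

lemma AB_independent:
  assumes m: "Suc l < k" "C l \<notin> I" "D l \<notin> I" and mem: "scale x (A (Suc l)) + scale y (B (Suc l)) \<in> I"
  shows "x = 0 \<and> y = 0"
proof -
  let ?b = "1 - q ^ j / q ^ Suc l" and ?a = "1 - q ^ i / q ^ Suc l"
  have "fgen X1 * (scale x (A (Suc l)) + scale y (B (Suc l))) \<approx> scale x (scale (\<alpha> l) (D l)) + scale y (scale ?b (D l))"
    unfolding distrib_left scale_mult_right by (intro eqv_add eqv_scale X1_A X1_BD)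
  moreover have "fgen X1 * (scale x (A (Suc l)) + scale y (B (Suc l))) \<in> I" by (rule ideal_simps(3)[OF mem])
  ultimately have "scale x (scale (\<alpha> l) (D l)) + scale y (scale ?b (D l)) \<in> I" using eqv_mem_iff by blast
  then have "scale (x * \<alpha> l + y * ?b) (D l) \<in> I" by (simp only: scale_simps scale_add_left)
  then have 1: "x * \<alpha> l + y * ?b = 0" using left_ideal_scaleD[OF left_ideal] m(3) by blast
  have "fgen X2 * (scale x (A (Suc l)) + scale y (B (Suc l))) \<approx> scale x (scale ?a (C l)) + scale y (scale (\<beta> l) (C l))"
    unfolding distrib_left scale_mult_right by (intro eqv_add eqv_scale X2_AC X2_B)
  moreover have "fgen X2 * (scale x (A (Suc l)) + scale y (B (Suc l))) \<in> I" by (rule ideal_simps(3)[OF mem])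
  ultimately have "scale x (scale ?a (C l)) + scale y (scale (\<beta> l) (C l)) \<in> I" using eqv_mem_iff by blast
  then have "scale (x * ?a + y * \<beta> l) (C l) \<in> I" by (simp only: scale_simps scale_add_left)
  then have 2: "x * ?a + y * \<beta> l = 0" using left_ideal_scaleD[OF left_ideal] m(2) by blast
  have "q ^ Suc l \<noteq> 1" using q_prim[of "Suc l"] m(1) k by auto
  moreover have "q ^ k \<noteq> q ^ Suc l"
  proof (cases "k = N")
    case True
    then show ?thesis using \<open>q ^ Suc l \<noteq> 1\<close> q_N by simp
  next
    case False
    then show ?thesis using q_power_eq_iff[of k "Suc l"] m(1) k by simp
  qed
  ultimately have "(1 / q ^ Suc l - 1) * (1 - q ^ i * q ^ j / q ^ Suc l) \<noteq> 0"
    using q_nonzero unfolding q_k[symmetric] by (simp add: divide_eq_1_iff del: power_Suc)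
  then have det: "\<alpha> l * \<beta> l - ?b * ?a \<noteq> 0" using AB_det[of l] by simp
  \<comment> \<open>Cramer's rule as a polynomial identity.\<close>
  have "x * (e * f - b * a) = f * (x * e + y * b) - b * (x * a + y * f)" for a b e f :: 'k
    by (simp add: algebra_simps)
  from this[of "\<alpha> l" "\<beta> l" ?b ?a]
  have "x * (\<alpha> l * \<beta> l - ?b * ?a) = \<beta> l * (x * \<alpha> l + y * ?b) - ?b * (x * ?a + y * \<beta> l)" .
  then have "x = 0" using 1 2 det by simp
  then show ?thesis using 2 \<beta>_nonzero by simp
qed

text \<open>If \<open>C (Suc l)\<close> or \<open>D (Suc l)\<close> vanished, applying x1 or x2
  would give a relation between \<open>A (Suc l)\<close> and \<open>B (Suc l)\<close> with a
  coefficient \<open>- \<alpha> l\<close> or \<open>- \<beta> l\<close>, which is non-zero.\<close>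

lemma CD_nonzero: "m < k \<Longrightarrow> C m \<notin> I \<and> D m \<notin> I"
proof (induction m)
  case 0
  have "scale (1 - q ^ i) 1 \<notin> I" "scale (1 - q ^ j) 1 \<notin> I" using q_ij scale_one_mem by auto
  then show ?case
    using eqv_mem_iff[OF X2_D0] eqv_mem_iff[OF X1_C0] ideal_simps(3) by blast
next
  case (Suc l)
  note indep = AB_independent[OF Suc.prems]
  have CD: "C l \<notin> I" "D l \<notin> I" using Suc by auto
  show ?case
  proof
    show "C (Suc l) \<notin> I"
    proof
      assume "C (Suc l) \<in> I"
      then have "scale (1 - q ^ j / q ^ Suc l) (A (Suc l)) - scale (\<alpha> l) (B (Suc l)) \<in> I"
        using eqv_mem_iff[OF X1_C] ideal_simps(3) by blast
      then have "scale (1 - q ^ j / q ^ Suc l) (A (Suc l)) + scale (- \<alpha> l) (B (Suc l)) \<in> I"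
        by (simp only: scale_simps diff_conv_add_uminus)
      from indep[OF CD this] show False using \<alpha>_nonzero by simp
    qed
    show "D (Suc l) \<notin> I"
    proof
      assume "D (Suc l) \<in> I"
      then have "scale (1 - q ^ i / q ^ Suc l) (B (Suc l)) - scale (\<beta> l) (A (Suc l)) \<in> I"
        using eqv_mem_iff[OF X2_D] ideal_simps(3) by blast
      then have "scale (- \<beta> l) (A (Suc l)) + scale (1 - q ^ i / q ^ Suc l) (B (Suc l)) \<in> I"
        by (simp only: scale_simps diff_conv_add_uminus add.commute)
      from indep[OF CD this] show False using \<beta>_nonzero by simp
    qed
  qed
qed

lemma B_k: "B k \<notin> I"
proof
  obtain l where l: "k = Suc l" using k by (cases k) auto
  assume "B k \<in> I"
  then have "scale (1 - q ^ j / q ^ k) (D l) \<in> I"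
    using eqv_mem_iff[OF X1_BD(2)[of l]] ideal_simps(3) unfolding l by blast
  then show False using left_ideal_scaleD[OF left_ideal _ ratio_k(1)] CD_nonzero[of l] l by blast
qed

lemma diamond_spanned: "p \<in> fspan ({0..2 * k} <+> {1..2 * k - 1}) (wAB k)"
  using diamond_spanning[OF k(1) D_k] AB_k by blast

definition eAB :: "nat + nat \<Rightarrow> nat \<times> nat" where
  "eAB t = (case t of Inl s \<Rightarrow> eB s | Inr s \<Rightarrow> eA s)"

lemma eAB_simps: "eAB (Inl (2 * m)) = (m, m)" "eAB (Inl (Suc (2 * m))) = (m, Suc m)"
  "eAB (Inr (2 * m)) = (m, m)" "eAB (Inr (Suc (2 * m))) = (Suc m, m)"
  by (simp_all add: eAB_def eA_def eB_def)

lemma wAB_simps: "wAB k (Inl (2 * m)) = B m" "wAB k (Inl (Suc (2 * m))) = D m"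
  "m < k \<Longrightarrow> wAB k (Inr (2 * m)) = A m" "wAB k (Inr (Suc (2 * m))) = C m"
proof -
  have "Suc (2 * m) \<noteq> 2 * k" by presburger
  then show "wAB k (Inr (Suc (2 * m))) = C m" by (simp add: wAB_def)
qed (simp_all add: wAB_def)

lemma q_power_eqD:
  assumes "q ^ a = q ^ b" "a \<le> N" "b \<le> N"
  shows "a = b \<or> a = 0 \<and> b = N \<or> a = N \<and> b = 0"
proof -
  have "a mod N = b mod N" using q_power_eq_iff[of "a mod N" "b mod N"] assms(1) N_gt by (simp add: q_power_mod)
  then show ?thesis using assms(2,3) by (cases "a = N"; cases "b = N") auto
qed

lemma wt_eqD: "wt e = wt e' \<Longrightarrow> q ^ fst e = q ^ fst e' \<and> q ^ snd e = q ^ snd e'"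
  using q_nonzero by (auto simp: wt_def)

text \<open>Odd positions have weight spaces of dimension one, and an inner even position is shared
  by \<open>A m\<close> and \<open>B m\<close>, which the determinant separates. For k = N also the
  two ends have the same weight.\<close>

lemma diamond_independent:
  assumes sum: "(\<Sum>t\<in>{0..2 * k} <+> {1..2 * k - 1}. scale (c t) (wAB k t)) \<in> I"
    and t: "t \<in> {0..2 * k} <+> {1..2 * k - 1}"
  shows "c t = 0"
proof -
  let ?S = "{0..2 * k} <+> {1..2 * k - 1}"
  have InlS: "Inl s \<in> ?S" if "s \<le> 2 * k" for s using that by (intro InlI) simp
  have InrS: "Inr s \<in> ?S" if "0 < s" "s < 2 * k" for s using that by (intro InrI) auto
  have K: "fgen K1 * wAB k t \<approx> scale (fst (wt (eAB t))) (wAB k t)"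
    "fgen K2 * wAB k t \<approx> scale (snd (wt (eAB t))) (wAB k t)" if "t \<in> ?S" for t
    using that k(1)
    by (cases rule: diamond_index_cases;
        simp only: wAB_simps eAB_simps wt_def fst_conv snd_conv K_A K_B K_C K_D)+
  have cls: "(\<Sum>t\<in>X. scale (c t) (wAB k t)) \<in> I"
    if "X \<subseteq> ?S" "\<And>t. t \<in> X \<Longrightarrow> wt (eAB t) = wt e" "\<And>t. t \<in> ?S \<Longrightarrow> wt (eAB t) = wt e \<Longrightarrow> t \<in> X" for X e
  proof -
    have "{t. t \<in> ?S \<and> wt (eAB t) = wt e} = X" using that by blast
    then show ?thesis using weight_classes[of ?S "wAB k" "\<lambda>t. wt (eAB t)" c "wt e", OF _ K sum] by simp
  qed
  have odd: "wt (eAB t) = wt e \<longrightarrow> t = t0"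
    if "t \<in> ?S" and e: "e = (m, Suc m) \<and> t0 = Inl (Suc (2 * m)) \<or> e = (Suc m, m) \<and> t0 = Inr (Suc (2 * m))"
      and m: "m < k" for t t0 e m
  proof
    assume eq: "wt (eAB t) = wt e"
    from that(1) k(1) show "t = t0"
    proof (cases rule: diamond_index_cases)
      case (1 l)
      then show ?thesis using wt_eqD[OF eq] q_power_eqD[of l m] q_power_eqD[of l "Suc m"] m k e N_gt
        by (auto simp: eAB_simps)
    next
      case (2 l)
      then show ?thesis using wt_eqD[OF eq] q_power_eqD[of l m] q_power_eqD[of l "Suc m"] q_power_eqD[of "Suc l" m]
          q_power_eqD[of "Suc l" "Suc m"] m k e N_gt
        by (auto simp: eAB_simps simp del: power_Suc)
    next
      case (3 l)
      then show ?thesis using wt_eqD[OF eq] q_power_eqD[of l m] q_power_eqD[of l "Suc m"] m k e N_gt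
        by (auto simp: eAB_simps simp del: power_Suc)
    next
      case (4 l)
      then show ?thesis using wt_eqD[OF eq] q_power_eqD[of l m] q_power_eqD[of l "Suc m"] q_power_eqD[of "Suc l" m]
          q_power_eqD[of "Suc l" "Suc m"] m k e N_gt
        by (auto simp: eAB_simps simp del: power_Suc)
    qed
  qed
  have even: "t = Inl (2 * m) \<or> t = Inr (2 * m) \<or> k = N \<and> (m = 0 \<and> t = Inl (2 * k) \<or> m = k \<and> t = Inl 0)"
    if "t \<in> ?S" "wt (eAB t) = wt (m, m)" and m: "m \<le> k" for t m
    using that(1) k(1)
  proof (cases rule: diamond_index_cases)
    case (1 l)
    then show ?thesis using wt_eqD[OF that(2)] q_power_eqD[of l m] m k N_gt
      by (auto simp: eAB_simps)
  next
    case (2 l)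
    then show ?thesis using wt_eqD[OF that(2)] q_power_eqD[of l m] q_power_eqD[of "Suc l" m] m k N_gt
      by (auto simp: eAB_simps simp del: power_Suc)
  next
    case (3 l)
    then show ?thesis using wt_eqD[OF that(2)] q_power_eqD[of l m] m k N_gt
      by (auto simp: eAB_simps)
  next
    case (4 l)
    then show ?thesis using wt_eqD[OF that(2)] q_power_eqD[of l m] q_power_eqD[of "Suc l" m] m k N_gt
      by (auto simp: eAB_simps simp del: power_Suc)
  qed
  have mid: "c (Inl (2 * m)) = 0 \<and> c (Inr (2 * m)) = 0" if m: "0 < m" "m < k" for m
  proof -
    obtain l where l: "m = Suc l" using m by (cases m) auto
    have "(\<Sum>t\<in>{Inl (2 * m), Inr (2 * m)}. scale (c t) (wAB k t)) \<in> I"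
    proof (rule cls)
      show "{Inl (2 * m), Inr (2 * m)} \<subseteq> ?S" using InlS[of "2 * m"] InrS[of "2 * m"] m by simp
      show "wt (eAB t) = wt (m, m)" if "t \<in> {Inl (2 * m), Inr (2 * m)}" for t using that by (auto simp: eAB_simps)
      show "t \<in> {Inl (2 * m), Inr (2 * m)}" if "t \<in> ?S" "wt (eAB t) = wt (m, m)" for t
        using even[OF that] m by auto
    qed
    then have "scale (c (Inr (2 * m))) (A m) + scale (c (Inl (2 * m))) (B m) \<in> I"
      using m(2) by (simp add: wAB_simps add.commute)
    then show ?thesis using AB_independent[of l, folded l] CD_nonzero[of l] m l by auto
  qed
  have bot: "c (Inl 0) = 0 \<and> c (Inl (2 * k)) = 0"
  proof -
    \<comment> \<open>Weights do not separate top and bottom when k = N; but \<open>B k\<close> has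
      no constant term, so nilpotency does.\<close>
    have unit: "c (Inl 0) = 0" if "scale (c (Inl 0)) 1 + scale (c (Inl (2 * k))) (B k) \<in> I"
    proof (rule scalar_plus_nilpotent[OF _ that one_notin])
      show "scale (c (Inl (2 * k))) (B k) \<in> word_span Y1 Y2 1"
      proof (intro word_span_scale word_span_le[of "B k" Y1 Y2 k 1] word_span_power)
        show "fgen Y1 * fgen Y2 \<in> word_span Y1 Y2 1"
          using word_span_word_of[of "[Y1, Y2]" Y1 Y2 1] by (simp add: word_of_Cons word_of_Nil)
      qed (use k(1) in simp)
    qed
    show ?thesis
    proof (cases "k = N")
      case True
      have "(\<Sum>t\<in>{Inl (2 * 0), Inl (2 * k)}. scale (c t) (wAB k t)) \<in> I"
      proof (rule cls)
        show "{Inl (2 * 0), Inl (2 * k)} \<subseteq> ?S" using InlS by simp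
        show "wt (eAB t) = wt (0, 0)" if "t \<in> {Inl (2 * 0), Inl (2 * k)}" for t
          using that True q_N by (auto simp only: eAB_simps wt_def insert_iff empty_iff fst_conv snd_conv power_0 simp_thms)
        show "t \<in> {Inl (2 * 0), Inl (2 * k)}" if "t \<in> ?S" "wt (eAB t) = wt (0, 0)" for t
          using even[OF that] that(1) k(1) by auto
      qed
      then have *: "scale (c (Inl 0)) 1 + scale (c (Inl (2 * k))) (B k) \<in> I"
        using k(1) wAB_simps(1)[of 0] by (simp add: wAB_simps)
      then have "c (Inl 0) = 0" by (rule unit)
      with * have "scale (c (Inl (2 * k))) (B k) \<in> I" by simp
      then show ?thesis using left_ideal_scaleD[OF left_ideal] B_k \<open>c (Inl 0) = 0\<close> by blast
    next
      case False
      have "(\<Sum>t\<in>{Inl (2 * m)}. scale (c t) (wAB k t)) \<in> I" if m: "m = 0 \<or> m = k" for m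
      proof (rule cls)
        show "{Inl (2 * m)} \<subseteq> ?S" using InlS[of "2 * m"] m by auto
        show "wt (eAB t) = wt (m, m)" if "t \<in> {Inl (2 * m)}" for t using that by (simp add: eAB_simps)
        show "t \<in> {Inl (2 * m)}" if "t \<in> ?S" "wt (eAB t) = wt (m, m)" for t
          using even[OF that] that(1) m False k(1) by auto
      qed
      from this[of 0] this[of k] show ?thesis
        using left_ideal_scaleD[OF left_ideal] B_k one_notin wAB_simps(1)[of 0] wAB_simps(1)[of k] by auto
    qed
  qed
  have sing: "c (Inl (Suc (2 * m))) = 0" "c (Inr (Suc (2 * m))) = 0" if m: "m < k" for m
  proof -
    have "(\<Sum>t\<in>{Inl (Suc (2 * m))}. scale (c t) (wAB k t)) \<in> I"
      by (rule cls[of _ "(m, Suc m)"]) (use InlS odd m in \<open>auto simp: eAB_simps\<close>)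
    then show "c (Inl (Suc (2 * m))) = 0"
      using left_ideal_scaleD[OF left_ideal] CD_nonzero[OF m] by (auto simp: wAB_simps)
    have "(\<Sum>t\<in>{Inr (Suc (2 * m))}. scale (c t) (wAB k t)) \<in> I"
      by (rule cls[of _ "(Suc m, m)"]) (use InrS odd m in \<open>auto simp: eAB_simps\<close>)
    then show "c (Inr (Suc (2 * m))) = 0"
      using left_ideal_scaleD[OF left_ideal] CD_nonzero[OF m] by (auto simp: wAB_simps)
  qed
  from t k(1) show ?thesis
  proof (cases rule: diamond_index_cases)
    case (1 m)
    then show ?thesis using mid[of m] bot by (cases "m = 0 \<or> m = k") auto
  qed (use mid sing in auto)
qed

end

end

section \<open>Quotient modules\<close>

text \<open>General enough for two uses: quotients of modules by submodules, and the free group on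
  pairs, which becomes a module only after division by the tensor relations.\<close>

locale module_quotient = abelian_subgroup H F + R: ring R
  for H and F :: "('r, 'v, 'n) module_scheme" and R :: "('r, 'm) ring_scheme" +
  assumes smult_closed: "\<lbrakk>a \<in> carrier R; v \<in> carrier F\<rbrakk> \<Longrightarrow> a \<odot>\<^bsub>F\<^esub> v \<in> carrier F"
    and smult_add: "\<lbrakk>a \<in> carrier R; v \<in> carrier F; w \<in> carrier F\<rbrakk> \<Longrightarrow>
      a \<odot>\<^bsub>F\<^esub> (v \<oplus>\<^bsub>F\<^esub> w) = a \<odot>\<^bsub>F\<^esub> v \<oplus>\<^bsub>F\<^esub> a \<odot>\<^bsub>F\<^esub> w"
    and smult_H: "\<lbrakk>a \<in> carrier R; h \<in> H\<rbrakk> \<Longrightarrow> a \<odot>\<^bsub>F\<^esub> h \<in> H"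
begin

abbreviation cls where "cls v \<equiv> H +>\<^bsub>F\<^esub> v"

lemma H_subset: "h \<in> H \<Longrightarrow> h \<in> carrier F"
  using a_subset by auto

lemma carrier_quot: "carrier (quot_module F H) = cls ` carrier F"
  by (auto simp: quot_module_def A_RCOSETS_def')

lemma zero_quot: "\<zero>\<^bsub>quot_module F H\<^esub> = H"
  by (simp add: quot_module_def)

lemma add_quot: "v \<in> carrier F \<Longrightarrow> w \<in> carrier F \<Longrightarrow> cls v \<oplus>\<^bsub>quot_module F H\<^esub> cls w = cls (v \<oplus>\<^bsub>F\<^esub> w)"
  by (simp add: quot_module_def a_rcos_sum)

lemma cls_mem: "v \<in> carrier F \<Longrightarrow> cls v = H \<longleftrightarrow> v \<in> H"
  using a_coset_join1[of H v] a_coset_join2[of v H] by (metis a_rcos_self a_rcos_const)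

lemma cls_add_left: "h \<in> H \<Longrightarrow> v \<in> carrier F \<Longrightarrow> cls (h \<oplus>\<^bsub>F\<^esub> v) = cls v"
proof -
  assume h: "h \<in> H" "v \<in> carrier F"
  have "h \<oplus>\<^bsub>F\<^esub> v \<in> cls v" using h by (auto simp: a_r_coset_def')
  then show ?thesis using a_repr_independence'[of "h \<oplus>\<^bsub>F\<^esub> v" v] h by simp
qed

lemma abelian_group_quot: "abelian_group (quot_module F H)"
proof (rule abelian_groupI)
  note simps = carrier_quot zero_quot
  have zero: "H = cls \<zero>\<^bsub>F\<^esub>" using a_coset_add_zero[OF a_subset] by simp
  show "\<zero>\<^bsub>quot_module F H\<^esub> \<in> carrier (quot_module F H)"
    unfolding simps by (subst zero) auto
  show "\<zero>\<^bsub>quot_module F H\<^esub> \<oplus>\<^bsub>quot_module F H\<^esub> x = x" if "x \<in> carrier (quot_module F H)" for x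
  proof -
    obtain v where v: "v \<in> carrier F" "x = cls v" using \<open>x \<in> carrier (quot_module F H)\<close> unfolding simps by auto
    have "cls \<zero>\<^bsub>F\<^esub> \<oplus>\<^bsub>quot_module F H\<^esub> cls v = cls v" using v by (subst add_quot) auto
    then show ?thesis unfolding simps v(2) by (simp flip: zero)
  qed
  show "\<exists>y\<in>carrier (quot_module F H). y \<oplus>\<^bsub>quot_module F H\<^esub> x = \<zero>\<^bsub>quot_module F H\<^esub>"
    if "x \<in> carrier (quot_module F H)" for x
  proof -
    obtain v where v: "v \<in> carrier F" "x = cls v" using \<open>x \<in> carrier (quot_module F H)\<close> unfolding simps by auto
    have "cls (\<ominus>\<^bsub>F\<^esub> v) \<oplus>\<^bsub>quot_module F H\<^esub> cls v = H"
      using v by (subst add_quot) (auto simp: l_neg simp flip: zero)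
    then show ?thesis unfolding simps v(2) using v(1) by blast
  qed
qed (auto simp: carrier_quot add_quot a_assoc a_comm a_lcomm)

lemma cls_eqI:
  assumes "v \<in> carrier F" "w \<in> carrier F" "v \<ominus>\<^bsub>F\<^esub> w \<in> H"
  shows "cls v = cls w"
proof -
  have "cls ((v \<ominus>\<^bsub>F\<^esub> w) \<oplus>\<^bsub>F\<^esub> w) = cls w" by (rule cls_add_left[OF assms(3,2)])
  moreover have "(v \<ominus>\<^bsub>F\<^esub> w) \<oplus>\<^bsub>F\<^esub> w = v"
    using assms(1,2) by (simp add: a_minus_def a_assoc l_neg)
  ultimately show ?thesis by simp
qed

text \<open>The union in \<open>quot_module\<close> runs over all representatives; stability of
  \<open>H\<close> makes them yield the same coset.\<close>

lemma smult_quot: "a \<in> carrier R \<Longrightarrow> v \<in> carrier F \<Longrightarrow> a \<odot>\<^bsub>quot_module F H\<^esub> cls v = cls (a \<odot>\<^bsub>F\<^esub> v)"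
proof -
  assume a: "a \<in> carrier R" and v: "v \<in> carrier F"
  have "cls (a \<odot>\<^bsub>F\<^esub> w) = cls (a \<odot>\<^bsub>F\<^esub> v)" if "w \<in> cls v" for w
  proof -
    obtain h where h: "h \<in> H" "w = h \<oplus>\<^bsub>F\<^esub> v" using \<open>w \<in> cls v\<close> by (auto simp: a_r_coset_def')
    then show ?thesis using a v smult_add[of a h v] by (simp add: H_subset cls_add_left smult_H smult_closed)
  qed
  then have "(\<Union>w\<in>cls v. cls (a \<odot>\<^bsub>F\<^esub> w)) = (\<Union>w\<in>cls v. cls (a \<odot>\<^bsub>F\<^esub> v))" by simp
  moreover have "v \<in> cls v" using v by (rule a_rcos_self)
  ultimately show ?thesis unfolding quot_module_def by (simp, blast)
qed

lemma left_module_quot: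
  assumes l_distr: "\<And>a b v. \<lbrakk>a \<in> carrier R; b \<in> carrier R; v \<in> carrier F\<rbrakk> \<Longrightarrow>
      cls ((a \<oplus>\<^bsub>R\<^esub> b) \<odot>\<^bsub>F\<^esub> v) = cls (a \<odot>\<^bsub>F\<^esub> v \<oplus>\<^bsub>F\<^esub> b \<odot>\<^bsub>F\<^esub> v)"
    and assoc: "\<And>a b v. \<lbrakk>a \<in> carrier R; b \<in> carrier R; v \<in> carrier F\<rbrakk> \<Longrightarrow>
      cls ((a \<otimes>\<^bsub>R\<^esub> b) \<odot>\<^bsub>F\<^esub> v) = cls (a \<odot>\<^bsub>F\<^esub> (b \<odot>\<^bsub>F\<^esub> v))"
    and one: "\<And>v. v \<in> carrier F \<Longrightarrow> cls (\<one>\<^bsub>R\<^esub> \<odot>\<^bsub>F\<^esub> v) = cls v"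
  shows "left_module R (quot_module F H)"
proof (intro left_module.intro left_module_axioms.intro)
  show "ring R" by (rule R.ring_axioms)
  show "abelian_group (quot_module F H)" by (rule abelian_group_quot)
qed (auto simp: carrier_quot smult_quot add_quot smult_closed smult_add l_distr assoc one)

end

lemma (in left_module) zero_smult: "x \<in> carrier M \<Longrightarrow> \<zero>\<^bsub>R\<^esub> \<odot>\<^bsub>M\<^esub> x = \<zero>\<^bsub>M\<^esub>"
proof -
  assume x: "x \<in> carrier M"
  have "\<zero>\<^bsub>R\<^esub> \<odot>\<^bsub>M\<^esub> x \<oplus>\<^bsub>M\<^esub> \<zero>\<^bsub>R\<^esub> \<odot>\<^bsub>M\<^esub> x = \<zero>\<^bsub>R\<^esub> \<odot>\<^bsub>M\<^esub> x"
    using smult_l_distr[of "\<zero>\<^bsub>R\<^esub>" "\<zero>\<^bsub>R\<^esub>" x] x by simp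
  then show ?thesis using x M.add.l_cancel_one smult_closed[of "\<zero>\<^bsub>R\<^esub>" x] by simp
qed

lemma (in left_module) smult_zero: "a \<in> carrier R \<Longrightarrow> a \<odot>\<^bsub>M\<^esub> \<zero>\<^bsub>M\<^esub> = \<zero>\<^bsub>M\<^esub>"
proof -
  assume a: "a \<in> carrier R"
  have "a \<odot>\<^bsub>M\<^esub> \<zero>\<^bsub>M\<^esub> \<oplus>\<^bsub>M\<^esub> a \<odot>\<^bsub>M\<^esub> \<zero>\<^bsub>M\<^esub> = a \<odot>\<^bsub>M\<^esub> \<zero>\<^bsub>M\<^esub>"
    using smult_r_distr[of a "\<zero>\<^bsub>M\<^esub>" "\<zero>\<^bsub>M\<^esub>"] a by simp
  then show ?thesis using a M.add.l_cancel_one smult_closed[of a "\<zero>\<^bsub>M\<^esub>"] by simp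
qed

lemma (in left_module) submodule_quotient:
  assumes "submodule H R M"
  shows "module_quotient H M R"
proof -
  interpret submodule H R M by fact
  show ?thesis
  proof (intro module_quotient.intro module_quotient_axioms.intro)
    show "abelian_subgroup H M"
      by (rule abelian_subgroupI3) (auto intro: additive_subgroup.intro subgroup_axioms M.abelian_group_axioms)
    show "ring R" by (rule R.ring_axioms)
  qed (auto simp: smult_r_distr submodule.smult_closed[OF assms])
qed

lemma (in left_module) left_module_quotient:
  assumes "submodule H R M"
  shows "left_module R (quot_module M H)"
proof -
  interpret module_quotient H M R by (rule submodule_quotient[OF assms])
  show ?thesis by (rule left_module_quot) (auto simp: smult_l_distr smult_assoc1)
qed

section \<open>Cyclic modules and left ideals\<close>

text \<open>Taken in the free algebra instead of \<open>uq\<close>, so that vectors become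
  congruence classes of polynomials in words and annihilators in different modules can be compared
  as sets.\<close>

definition annihilator :: "'k::field \<Rightarrow> nat \<Rightarrow> ('k falg set, 'v, 'm) module_scheme \<Rightarrow> 'v \<Rightarrow> 'k falg set" where
  "annihilator q n S v = {p. uq_of q n p \<odot>\<^bsub>S\<^esub> v = \<zero>\<^bsub>S\<^esub>}"

locale uq_module = left_module "uq q n" S
  for q :: "'k::field" and n and S :: "('k falg set, 'v, 'm) module_scheme"
begin

lemma act_closed [simp, intro]: "v \<in> carrier S \<Longrightarrow> uq_of q n p \<odot>\<^bsub>S\<^esub> v \<in> carrier S"
  by (rule smult_closed) auto

lemma act_add: "v \<in> carrier S \<Longrightarrow> uq_of q n (a + b) \<odot>\<^bsub>S\<^esub> v = uq_of q n a \<odot>\<^bsub>S\<^esub> v \<oplus>\<^bsub>S\<^esub> uq_of q n b \<odot>\<^bsub>S\<^esub> v"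
  unfolding uq_of_add by (rule smult_l_distr) auto

lemma act_mult: "v \<in> carrier S \<Longrightarrow> uq_of q n (a * b) \<odot>\<^bsub>S\<^esub> v = uq_of q n a \<odot>\<^bsub>S\<^esub> (uq_of q n b \<odot>\<^bsub>S\<^esub> v)"
  unfolding uq_of_mult by (rule smult_assoc1) auto

lemma act_one: "v \<in> carrier S \<Longrightarrow> uq_of q n 1 \<odot>\<^bsub>S\<^esub> v = v"
  unfolding uq_of_one by (rule smult_one)

lemma act_zero: "v \<in> carrier S \<Longrightarrow> uq_of q n 0 \<odot>\<^bsub>S\<^esub> v = \<zero>\<^bsub>S\<^esub>"
  unfolding uq_of_zero by (rule zero_smult)

lemma act_eq_iff:
  assumes v: "v \<in> carrier S"
  shows "uq_of q n a \<odot>\<^bsub>S\<^esub> v = uq_of q n b \<odot>\<^bsub>S\<^esub> v \<longleftrightarrow> a - b \<in> annihilator q n S v"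
proof -
  have "uq_of q n a \<odot>\<^bsub>S\<^esub> v = uq_of q n (a - b) \<odot>\<^bsub>S\<^esub> v \<oplus>\<^bsub>S\<^esub> uq_of q n b \<odot>\<^bsub>S\<^esub> v"
    using act_add[OF v, of "a - b" b] by simp
  then show ?thesis using v M.add.r_cancel_one[of "uq_of q n b \<odot>\<^bsub>S\<^esub> v" "uq_of q n (a - b) \<odot>\<^bsub>S\<^esub> v"]
    by (simp add: annihilator_def)
qed

text \<open>One half of the correspondence between submodules and left ideals along p -> p v;
  \<open>submodule_image\<close> is the other.\<close>

lemma left_ideal_preimage:
  assumes v: "v \<in> carrier S" and H: "submodule H (uq q n) S"
  shows "left_ideal {p. uq_of q n p \<odot>\<^bsub>S\<^esub> v \<in> H}"
proof -
  interpret H: submodule H "uq q n" S by fact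
  show ?thesis
    unfolding left_ideal_def using v H.one_closed H.m_closed H.smult_closed
    by (auto simp: act_zero act_add act_mult)
qed

lemma submodule_image:
  assumes v: "v \<in> carrier S" and I: "left_ideal I"
  shows "submodule ((\<lambda>p. uq_of q n p \<odot>\<^bsub>S\<^esub> v) ` I) (uq q n) S"
proof (intro submodule.intro submodule_axioms.intro M.add.subgroupI)
  show "(\<lambda>p. uq_of q n p \<odot>\<^bsub>S\<^esub> v) ` I \<subseteq> carrier S" using v by auto
  show "(\<lambda>p. uq_of q n p \<odot>\<^bsub>S\<^esub> v) ` I \<noteq> {}" using left_idealD(1)[OF I] by auto
  show "\<ominus>\<^bsub>S\<^esub> a \<in> (\<lambda>p. uq_of q n p \<odot>\<^bsub>S\<^esub> v) ` I" if a: "a \<in> (\<lambda>p. uq_of q n p \<odot>\<^bsub>S\<^esub> v) ` I" for a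
  proof -
    obtain p where p: "p \<in> I" "a = uq_of q n p \<odot>\<^bsub>S\<^esub> v" using a by auto
    have "uq_of q n (- p) \<odot>\<^bsub>S\<^esub> v \<oplus>\<^bsub>S\<^esub> a = \<zero>\<^bsub>S\<^esub>" using act_add[OF v, of "- p" p] v by (simp add: p act_zero)
    then have "\<ominus>\<^bsub>S\<^esub> a = uq_of q n (- p) \<odot>\<^bsub>S\<^esub> v" using v p by (intro M.minus_equality) auto
    then show ?thesis using left_idealD(4)[OF I p(1)] by auto
  qed
  show "a \<oplus>\<^bsub>S\<^esub> b \<in> (\<lambda>p. uq_of q n p \<odot>\<^bsub>S\<^esub> v) ` I"
    if "a \<in> (\<lambda>p. uq_of q n p \<odot>\<^bsub>S\<^esub> v) ` I" "b \<in> (\<lambda>p. uq_of q n p \<odot>\<^bsub>S\<^esub> v) ` I" for a b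
    using that left_idealD(2)[OF I] act_add[OF v, symmetric] by auto
  show "a \<odot>\<^bsub>S\<^esub> x \<in> (\<lambda>p. uq_of q n p \<odot>\<^bsub>S\<^esub> v) ` I"
    if "a \<in> carrier (uq q n)" "x \<in> (\<lambda>p. uq_of q n p \<odot>\<^bsub>S\<^esub> v) ` I" for a x
    using that left_idealD(3)[OF I] act_mult[OF v, symmetric] by (auto simp: carrier_uq)
qed

lemma left_ideal_annihilator: "v \<in> carrier S \<Longrightarrow> left_ideal (annihilator q n S v)"
  using act_zero[of v] smult_zero by (auto simp: left_ideal_def annihilator_def act_add act_mult)

lemma uq_ideal_annihilator: "v \<in> carrier S \<Longrightarrow> uq_ideal q n \<subseteq> annihilator q n S v"
  using act_eq_iff[of v _ 0] act_zero[of v] uq_of_eq_iff[of q n _ 0]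
  unfolding annihilator_def subset_iff mem_Collect_eq by (metis diff_zero)

lemma one_annihilator: "v \<in> carrier S \<Longrightarrow> 1 \<in> annihilator q n S v \<longleftrightarrow> v = \<zero>\<^bsub>S\<^esub>"
  by (simp add: annihilator_def act_one)

lemma annihilator_act: "v \<in> carrier S \<Longrightarrow> annihilator q n S (uq_of q n p \<odot>\<^bsub>S\<^esub> v) = {r. r * p \<in> annihilator q n S v}"
  by (simp add: annihilator_def act_mult)

definition cyclic :: "'v \<Rightarrow> bool" where
  "cyclic v \<longleftrightarrow> v \<in> carrier S \<and> carrier S = range (\<lambda>p. uq_of q n p \<odot>\<^bsub>S\<^esub> v)"

lemma generates_iff_cyclic: "generates_module (uq q n) S v \<longleftrightarrow> cyclic v"
  by (auto simp: generates_module_def cyclic_def carrier_uq)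

lemma simple_cyclic:
  assumes "simple_module (uq q n) S" "v \<in> carrier S" "v \<noteq> \<zero>\<^bsub>S\<^esub>"
  shows "cyclic v"
proof -
  have "left_ideal UNIV" by (simp add: left_ideal_def)
  note H = submodule_image[OF assms(2) this]
  have "v \<in> range (\<lambda>p. uq_of q n p \<odot>\<^bsub>S\<^esub> v)" using act_one[OF assms(2)] by (metis rangeI)
  then show ?thesis using assms H by (auto simp: simple_module_def cyclic_def)
qed

text \<open>The image of a left ideal above the annihilator contains \<open>v\<close> only if the
  ideal contains 1; so a proper ideal has image zero and lies in the annihilator.\<close>

lemma simple_annihilator_maximal:
  assumes "simple_module (uq q n) S" "v \<in> carrier S" "v \<noteq> \<zero>\<^bsub>S\<^esub>"
  shows "maximal_left_ideal (annihilator q n S v)"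
  unfolding maximal_left_ideal_def
proof (intro conjI allI impI)
  show "left_ideal (annihilator q n S v)" by (rule left_ideal_annihilator) fact
  show "1 \<notin> annihilator q n S v" using assms by (simp add: one_annihilator)
  fix I assume I: "left_ideal I \<and> annihilator q n S v \<subseteq> I \<and> 1 \<notin> I"
  let ?H = "(\<lambda>p. uq_of q n p \<odot>\<^bsub>S\<^esub> v) ` I"
  have "submodule ?H (uq q n) S" using submodule_image[OF assms(2)] I by auto
  then have "?H = {\<zero>\<^bsub>S\<^esub>} \<or> ?H = carrier S" using assms(1) by (simp add: simple_module_def)
  moreover have "v \<notin> ?H"
  proof
    assume "v \<in> ?H"
    then obtain p where p: "p \<in> I" "uq_of q n p \<odot>\<^bsub>S\<^esub> v = uq_of q n 1 \<odot>\<^bsub>S\<^esub> v"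
      using act_one[OF assms(2)] by auto
    then have "p - 1 \<in> I" using act_eq_iff[OF assms(2)] I by auto
    then have "p - (p - 1) \<in> I" using p(1) I left_idealD(5) by blast
    then show False using I by simp
  qed
  ultimately have "?H = {\<zero>\<^bsub>S\<^esub>}" using assms(2) by auto
  then show "I = annihilator q n S v" using I by (auto simp: annihilator_def)
qed

text \<open>In a cyclic module a submodule is recovered from its preimage under p -> p v, and
  maximality leaves only the annihilator and the whole algebra as preimages.\<close>

lemma cyclic_simple:
  assumes v: "cyclic v" and max: "maximal_left_ideal (annihilator q n S v)"
  shows "simple_module (uq q n) S"
  unfolding simple_module_def
proof (intro conjI allI impI)
  have vS: "v \<in> carrier S" using v unfolding cyclic_def by (rule conjunct1)
  show "left_module (uq q n) S" by (rule left_module_axioms)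
  have "v \<noteq> \<zero>\<^bsub>S\<^esub>" using max one_annihilator[OF vS] by (auto simp: maximal_left_ideal_def)
  then show "carrier S \<noteq> {\<zero>\<^bsub>S\<^esub>}" using vS by auto
  fix H assume H: "submodule H (uq q n) S"
  interpret H: submodule H "uq q n" S by fact
  let ?I = "{p. uq_of q n p \<odot>\<^bsub>S\<^esub> v \<in> H}"
  have I: "left_ideal ?I" by (rule left_ideal_preimage[OF vS H])
  have "annihilator q n S v \<subseteq> ?I" using H.one_closed by (auto simp: annihilator_def)
  then have "?I = annihilator q n S v \<or> 1 \<in> ?I" using max I by (auto simp: maximal_left_ideal_def)
  then show "H = {\<zero>\<^bsub>S\<^esub>} \<or> H = carrier S"
  proof
    assume eq: "?I = annihilator q n S v"
    have zero: "h = \<zero>\<^bsub>S\<^esub>" if "h \<in> H" for h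
    proof -
      have "h \<in> carrier S" using \<open>h \<in> H\<close> H.subset by auto
      then obtain p where p: "h = uq_of q n p \<odot>\<^bsub>S\<^esub> v" using v unfolding cyclic_def by blast
      then have "p \<in> annihilator q n S v" using eq \<open>h \<in> H\<close> by blast
      then show ?thesis by (simp add: p annihilator_def)
    qed
    have "\<zero>\<^bsub>S\<^esub> \<in> H" using H.one_closed by simp
    then show ?thesis using zero by blast
  next
    assume "1 \<in> ?I"
    then have "uq_of q n p \<odot>\<^bsub>S\<^esub> v \<in> H" for p using left_ideal_UNIV[OF I, of p] by blast
    then have "range (\<lambda>p. uq_of q n p \<odot>\<^bsub>S\<^esub> v) \<subseteq> H" by blast
    then have "carrier S \<subseteq> H" using v unfolding cyclic_def by (metis (no_types))
    then show ?thesis using H.subset by auto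
  qed
qed

lemma finsum_act:
  assumes "v \<in> carrier S" "finite F"
  shows "(\<Oplus>\<^bsub>S\<^esub>s\<in>F. uq_of q n (f s) \<odot>\<^bsub>S\<^esub> v) = uq_of q n (\<Sum>s\<in>F. f s) \<odot>\<^bsub>S\<^esub> v"
  using assms(2)
proof (induction F rule: finite_induct)
  case (insert s F)
  then show ?case using assms(1) by (subst M.finsum_insert) (auto simp: act_add)
qed (use assms act_zero in simp)

lemma act_scalar: "v \<in> carrier S \<Longrightarrow> uq_scalar q n c \<odot>\<^bsub>S\<^esub> (uq_of q n p \<odot>\<^bsub>S\<^esub> v) = uq_of q n (scale c p) \<odot>\<^bsub>S\<^esub> v"
  by (simp add: uq_scalar_eq act_mult[symmetric] scale_mult_left)

lemma act_gen: "v \<in> carrier S \<Longrightarrow> act q n S g (uq_of q n p \<odot>\<^bsub>S\<^esub> v) = uq_of q n (fgen g * p) \<odot>\<^bsub>S\<^esub> v"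
  by (simp add: act_def uq_gen_def act_mult)

lemma has_weight_act:
  assumes "v \<in> carrier S"
  shows "has_weight q n S (uq_of q n p \<odot>\<^bsub>S\<^esub> v) d \<longleftrightarrow>
    fgen K1 * p - scale (q powi fst d) p \<in> annihilator q n S v \<and>
    fgen K2 * p - scale (q powi snd d) p \<in> annihilator q n S v"
  using assms by (simp add: has_weight_def act_gen act_scalar act_eq_iff)

text \<open>Reduces a basis to spanning and independence modulo the annihilator;
  \<open>restrict\<close> produces the one extensional coefficient function.\<close>

lemma is_basisI:
  fixes w :: "'i \<Rightarrow> 'k falg"
  assumes v: "cyclic v" and fin: "finite F"
    and span: "\<And>p. \<exists>c. p - (\<Sum>s\<in>F. scale (c s) (w s)) \<in> annihilator q n S v"
    and indep: "\<And>c s. (\<Sum>s\<in>F. scale (c s) (w s)) \<in> annihilator q n S v \<Longrightarrow> s \<in> F \<Longrightarrow> c s = 0"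
  shows "is_basis q n S F (\<lambda>s. uq_of q n (w s) \<odot>\<^bsub>S\<^esub> v)"
  unfolding is_basis_def
proof (intro conjI ballI)
  have vS: "v \<in> carrier S" using v unfolding cyclic_def by (rule conjunct1)
  note I = left_idealD[OF left_ideal_annihilator[OF vS]]
  show "finite F" by fact
  show "(\<lambda>s. uq_of q n (w s) \<odot>\<^bsub>S\<^esub> v) \<in> F \<rightarrow> carrier S" using vS by auto
  fix x assume "x \<in> carrier S"
  then obtain p where p: "x = uq_of q n p \<odot>\<^bsub>S\<^esub> v" using v by (auto simp: cyclic_def)
  have eq: "x = (\<Oplus>\<^bsub>S\<^esub>s\<in>F. uq_scalar q n (c s) \<odot>\<^bsub>S\<^esub> (uq_of q n (w s) \<odot>\<^bsub>S\<^esub> v)) \<longleftrightarrow>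
      p - (\<Sum>s\<in>F. scale (c s) (w s)) \<in> annihilator q n S v" for c
    by (simp only: p act_scalar[OF vS] finsum_act[OF vS fin] act_eq_iff[OF vS])
  obtain c where c: "p - (\<Sum>s\<in>F. scale (c s) (w s)) \<in> annihilator q n S v" using span by blast
  show "\<exists>!c. c \<in> extensional F \<and> x = (\<Oplus>\<^bsub>S\<^esub>s\<in>F. uq_scalar q n (c s) \<odot>\<^bsub>S\<^esub> (uq_of q n (w s) \<odot>\<^bsub>S\<^esub> v))"
    unfolding eq
  proof (intro ex1I conjI)
    show "restrict c F \<in> extensional F" by simp
    show "p - (\<Sum>s\<in>F. scale (restrict c F s) (w s)) \<in> annihilator q n S v" using c by simp
    fix d assume d: "d \<in> extensional F \<and> p - (\<Sum>s\<in>F. scale (d s) (w s)) \<in> annihilator q n S v"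
    have "(p - (\<Sum>s\<in>F. scale (d s) (w s))) - (p - (\<Sum>s\<in>F. scale (c s) (w s))) \<in> annihilator q n S v"
      using d c I(5) by blast
    also have "(p - (\<Sum>s\<in>F. scale (d s) (w s))) - (p - (\<Sum>s\<in>F. scale (c s) (w s)))
        = (\<Sum>s\<in>F. scale (c s - d s) (w s))" by (simp add: scale_diff_left sum_subtractf)
    finally have "c s = d s" if "s \<in> F" for s using indep[of "\<lambda>s. c s - d s" s] that by simp
    then show "d = restrict c F" using d by (intro extensionalityI[of _ F]) auto
  qed
qed

end

text \<open>Equality of the annihilators is what makes p v -> p w both well defined and
  injective.\<close>

lemma isomorphic_cyclic:
  assumes "uq_module q n S" "uq_module q n T" "uq_module.cyclic q n S v" "uq_module.cyclic q n T w"
    and ann: "annihilator q n S v = annihilator q n T w"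
  shows "isomorphic_modules (uq q n) S T"
proof -
  interpret S: uq_module q n S by fact
  interpret T: uq_module q n T by fact
  have v: "v \<in> carrier S" "carrier S = range (\<lambda>p. uq_of q n p \<odot>\<^bsub>S\<^esub> v)" using assms(3) by (auto simp: S.cyclic_def)
  have w: "w \<in> carrier T" "carrier T = range (\<lambda>p. uq_of q n p \<odot>\<^bsub>T\<^esub> w)" using assms(4) by (auto simp: T.cyclic_def)
  define f where "f x = uq_of q n (SOME p. x = uq_of q n p \<odot>\<^bsub>S\<^esub> v) \<odot>\<^bsub>T\<^esub> w" for x
  have f: "f (uq_of q n p \<odot>\<^bsub>S\<^esub> v) = uq_of q n p \<odot>\<^bsub>T\<^esub> w" for p
  proof -
    have "uq_of q n p \<odot>\<^bsub>S\<^esub> v = uq_of q n (SOME r. uq_of q n p \<odot>\<^bsub>S\<^esub> v = uq_of q n r \<odot>\<^bsub>S\<^esub> v) \<odot>\<^bsub>S\<^esub> v"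
      by (rule someI[of _ p]) simp
    then have "p - (SOME r. uq_of q n p \<odot>\<^bsub>S\<^esub> v = uq_of q n r \<odot>\<^bsub>S\<^esub> v) \<in> annihilator q n T w"
      unfolding S.act_eq_iff[OF v(1)] ann .
    then show ?thesis unfolding f_def T.act_eq_iff[OF w(1), symmetric] by (rule sym)
  qed
  have "f \<in> module_isos (uq q n) S T"
    unfolding module_isos_def
  proof (intro CollectI conjI ballI)
    show "bij_betw f (carrier S) (carrier T)"
      unfolding bij_betw_def
    proof
      show "inj_on f (carrier S)"
        unfolding inj_on_def v(2) using S.act_eq_iff[OF v(1)] T.act_eq_iff[OF w(1)] ann by (auto simp: f)
      show "f ` carrier S = carrier T" unfolding v(2) w(2) by (auto simp: f image_image)
    qed
    show "f (x \<oplus>\<^bsub>S\<^esub> y) = f x \<oplus>\<^bsub>T\<^esub> f y" if "x \<in> carrier S" "y \<in> carrier S" for x y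
      using that unfolding v(2) by (auto simp: f S.act_add[OF v(1), symmetric] T.act_add[OF w(1), symmetric])
    show "f (a \<odot>\<^bsub>S\<^esub> x) = a \<odot>\<^bsub>T\<^esub> f x" if "a \<in> carrier (uq q n)" "x \<in> carrier S" for a x
      using that unfolding v(2) carrier_uq
      by (auto simp: f S.act_mult[OF v(1), symmetric] T.act_mult[OF w(1), symmetric])
  qed
  then show ?thesis by (auto simp: isomorphic_modules_def)
qed

lemma annihilator_iso:
  assumes "uq_module q n S" "uq_module q n T" "f \<in> module_isos (uq q n) S T" "v \<in> carrier S"
  shows "f v \<in> carrier T" "annihilator q n T (f v) = annihilator q n S v"
proof -
  interpret S: uq_module q n S by fact
  interpret T: uq_module q n T by fact
  have f: "bij_betw f (carrier S) (carrier T)"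
    "\<And>a x. a \<in> carrier (uq q n) \<Longrightarrow> x \<in> carrier S \<Longrightarrow> f (a \<odot>\<^bsub>S\<^esub> x) = a \<odot>\<^bsub>T\<^esub> f x"
    using assms(3) by (auto simp: module_isos_def)
  show fv: "f v \<in> carrier T" using f(1) assms(4) by (auto simp: bij_betw_def)
  have "f \<zero>\<^bsub>S\<^esub> = \<zero>\<^bsub>T\<^esub>"
    using f(2)[of "uq_of q n 0" v] assms(4) fv by (simp add: S.act_zero T.act_zero)
  then have "f x = \<zero>\<^bsub>T\<^esub> \<longleftrightarrow> x = \<zero>\<^bsub>S\<^esub>" if "x \<in> carrier S" for x
    using f(1) that inj_onD[of f "carrier S" x "\<zero>\<^bsub>S\<^esub>"] by (auto simp: bij_betw_def)
  then show "annihilator q n T (f v) = annihilator q n S v"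
    using f(2)[symmetric] assms(4) by (auto simp: annihilator_def)
qed

section \<open>Induced modules\<close>

locale induction_data = R: ring R
  for R :: "('r, 'm) ring_scheme" and S :: "'r set" and V :: "('r, 'v, 'n) module_scheme" +
  assumes S_subset: "S \<subseteq> carrier R"
    and V_add: "v \<in> carrier V \<Longrightarrow> w \<in> carrier V \<Longrightarrow> v \<oplus>\<^bsub>V\<^esub> w \<in> carrier V"
    and V_smult: "s \<in> S \<Longrightarrow> v \<in> carrier V \<Longrightarrow> s \<odot>\<^bsub>V\<^esub> v \<in> carrier V"
begin

abbreviation F where "F \<equiv> free_on_pairs R V"
definition H where "H = generate (add_monoid F) (tensor_rels R S V)"

lemma F_simps: "carrier F = {c. Poly_Mapping.keys c \<subseteq> carrier R \<times> carrier V}" "\<zero>\<^bsub>F\<^esub> = 0" "c \<oplus>\<^bsub>F\<^esub> d = c + d"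
  "r \<odot>\<^bsub>F\<^esub> c = frag_extend (\<lambda>(a, v). frag_of (r \<otimes>\<^bsub>R\<^esub> a, v)) c"
  by (simp_all add: free_on_pairs_def)

lemma abelian_group_F: "abelian_group F"
proof (rule abelian_groupI)
  show "x \<oplus>\<^bsub>F\<^esub> y \<in> carrier F" if "x \<in> carrier F" "y \<in> carrier F" for x y
    using that keys_add[of x y] by (auto simp: F_simps)
  show "\<exists>y\<in>carrier F. y \<oplus>\<^bsub>F\<^esub> x = \<zero>\<^bsub>F\<^esub>" if "x \<in> carrier F" for x
    using that by (intro bexI[of _ "- x"]) (auto simp: F_simps)
qed (auto simp: F_simps add_ac)

sublocale F: abelian_group F by (rule abelian_group_F)

lemma a_inv_F: "c \<in> carrier F \<Longrightarrow> \<ominus>\<^bsub>F\<^esub> c = - c"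
  by (rule F.minus_equality) (auto simp: F_simps)

lemma frag_of_F: "a \<in> carrier R \<Longrightarrow> v \<in> carrier V \<Longrightarrow> frag_of (a, v) \<in> carrier F"
  by (simp add: F_simps keys_frag_of)

lemma diff_F: "c \<in> carrier F \<Longrightarrow> d \<in> carrier F \<Longrightarrow> c - d \<in> carrier F"
  using F.a_closed[of c "- d"] by (simp add: F_simps)

lemma rels_subset: "tensor_rels R S V \<subseteq> carrier F"
  unfolding tensor_rels_def using S_subset V_add V_smult
  by (auto intro!: diff_F frag_of_F)

lemma additive_subgroup_H: "additive_subgroup H F"
  unfolding H_def by (intro additive_subgroup.intro F.add.generate_is_subgroup) (use rels_subset in simp)

lemma H_closed: "0 \<in> H" "c \<in> H \<Longrightarrow> d \<in> H \<Longrightarrow> c + d \<in> H" "c \<in> H \<Longrightarrow> - c \<in> H" "c \<in> H \<Longrightarrow> d \<in> H \<Longrightarrow> c - d \<in> H"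
proof -
  interpret H: additive_subgroup H F by (rule additive_subgroup_H)
  show 0: "0 \<in> H" using H.zero_closed by (simp add: F_simps)
  show add: "c \<in> H \<Longrightarrow> d \<in> H \<Longrightarrow> c + d \<in> H" for c d using H.a_closed[of c d] by (simp add: F_simps)
  show minus: "- c \<in> H" if c: "c \<in> H" for c
  proof -
    have "c \<in> carrier F" using c H.a_subset by auto
    then show ?thesis using H.a_subgroup a_inv_F[of c] subgroup.m_inv_closed[OF H.a_subgroup c] by (simp add: a_inv_def)
  qed
  show "c \<in> H \<Longrightarrow> d \<in> H \<Longrightarrow> c - d \<in> H" using add[of c "- d"] minus[of d] by simp
qed

lemma H_induct [consumes 1, case_names zero rel uminus add]:
  assumes "c \<in> H" and zero: "P 0" and rel: "\<And>c. c \<in> tensor_rels R S V \<Longrightarrow> P c"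
    and uminus: "\<And>c. c \<in> carrier F \<Longrightarrow> P c \<Longrightarrow> P (- c)"
    and add: "\<And>c d. c \<in> carrier F \<Longrightarrow> d \<in> carrier F \<Longrightarrow> P c \<Longrightarrow> P d \<Longrightarrow> P (c + d)"
  shows "P c"
proof -
  have "c \<in> carrier F \<and> P c"
    using assms(1) unfolding H_def
  proof (induction rule: generate.induct)
    case one
    then show ?case using zero by (simp add: F_simps)
  next
    case (incl h)
    then show ?case using rels_subset rel by auto
  next
    case (inv h)
    then have h: "h \<in> carrier F" using rels_subset by auto
    have "inv\<^bsub>add_monoid F\<^esub> h = - h" using a_inv_F[OF h] by (simp add: a_inv_def)
    then show ?case using h uminus[OF h rel[OF inv]] by (simp add: F_simps)
  next
    case (eng h1 h2)
    then show ?case using add[of h1 h2] F.a_closed[of h1 h2] by (simp add: F_simps(2,3))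
  qed
  then show ?thesis ..
qed

lemma rel_H: "c \<in> tensor_rels R S V \<Longrightarrow> c \<in> H"
  unfolding H_def by (rule generate.incl)

lemma rel_left: "\<lbrakk>a \<in> carrier R; b \<in> carrier R; v \<in> carrier V\<rbrakk> \<Longrightarrow>
    frag_of (a \<oplus>\<^bsub>R\<^esub> b, v) - frag_of (a, v) - frag_of (b, v) \<in> H"
  and rel_right: "\<lbrakk>a \<in> carrier R; v \<in> carrier V; w \<in> carrier V\<rbrakk> \<Longrightarrow>
    frag_of (a, v \<oplus>\<^bsub>V\<^esub> w) - frag_of (a, v) - frag_of (a, w) \<in> H"
  and rel_balanced: "\<lbrakk>a \<in> carrier R; s \<in> S; v \<in> carrier V\<rbrakk> \<Longrightarrow>
    frag_of (a \<otimes>\<^bsub>R\<^esub> s, v) - frag_of (a, s \<odot>\<^bsub>V\<^esub> v) \<in> H"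
  by (rule rel_H; unfold tensor_rels_def; blast)+

text \<open>Multiplication by \<open>r\<close> sends each tensor relation to one of the same kind,
  with the first factor multiplied by \<open>r\<close>.\<close>

lemma smult_H_closed:
  assumes r: "r \<in> carrier R" and c: "c \<in> H"
  shows "r \<odot>\<^bsub>F\<^esub> c \<in> H"
  using c
proof (induction rule: H_induct)
  case (rel c)
  then show ?case
    unfolding tensor_rels_def
  proof (elim UnE CollectE exE conjE)
    fix a b v
    assume "c = frag_of (a \<oplus>\<^bsub>R\<^esub> b, v) - frag_of (a, v) - frag_of (b, v)"
      "a \<in> carrier R" "b \<in> carrier R" "v \<in> carrier V"
    then show ?thesis using rel_left[of "r \<otimes>\<^bsub>R\<^esub> a" "r \<otimes>\<^bsub>R\<^esub> b" v] r
      by (simp add: F_simps frag_extend_diff R.r_distr)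
  next
    fix a v w
    assume "c = frag_of (a, v \<oplus>\<^bsub>V\<^esub> w) - frag_of (a, v) - frag_of (a, w)"
      "a \<in> carrier R" "v \<in> carrier V" "w \<in> carrier V"
    then show ?thesis using rel_right[of "r \<otimes>\<^bsub>R\<^esub> a" v w] r
      by (simp add: F_simps frag_extend_diff)
  next
    fix a s v
    assume "c = frag_of (a \<otimes>\<^bsub>R\<^esub> s, v) - frag_of (a, s \<odot>\<^bsub>V\<^esub> v)" "a \<in> carrier R" "s \<in> S" "v \<in> carrier V"
    moreover from this have "s \<in> carrier R" using S_subset by auto
    ultimately show ?thesis using rel_balanced[of "r \<otimes>\<^bsub>R\<^esub> a" s v] r
      by (simp add: F_simps frag_extend_diff R.m_assoc)
  qed
qed (auto simp: F_simps frag_extend_add frag_extend_minus H_closed)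

sublocale Q: module_quotient H F R
proof (intro module_quotient.intro module_quotient_axioms.intro)
  show "abelian_subgroup H F" by (rule abelian_subgroupI3[OF additive_subgroup_H abelian_group_F])
  show "ring R" by (rule R.ring_axioms)
  show "a \<odot>\<^bsub>F\<^esub> c \<in> carrier F" if "a \<in> carrier R" "c \<in> carrier F" for a c
    using that keys_frag_extend[of "\<lambda>(b, v). frag_of (a \<otimes>\<^bsub>R\<^esub> b, v)" c]
    by (fastforce simp: F_simps keys_frag_of)
qed (simp_all add: F_simps(3,4) frag_extend_add smult_H_closed[unfolded F_simps(4)])

lemma frag_F_induct [consumes 1, case_names zero one diff]:
  assumes "c \<in> carrier F" "P 0" "\<And>a v. a \<in> carrier R \<Longrightarrow> v \<in> carrier V \<Longrightarrow> P (frag_of (a, v))"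
    "\<And>c d. P c \<Longrightarrow> P d \<Longrightarrow> P (c - d)"
  shows "P c"
  by (rule frag_induction[of c "carrier R \<times> carrier V" P]) (use assms in \<open>auto simp: F_simps\<close>)

lemma a_minus_F: "c \<in> carrier F \<Longrightarrow> d \<in> carrier F \<Longrightarrow> c \<ominus>\<^bsub>F\<^esub> d = c - d"
  by (simp add: a_minus_def a_inv_F F_simps(3))

lemma induced_module_eq: "induced_module R S V = quot_module F H"
  by (simp add: induced_module_def H_def)

text \<open>Distributivity over a sum of scalars holds only modulo \<open>H\<close>, by additivity
  in the first factor; associativity and the unit law hold already in the free group.\<close>

lemma left_module_induced: "left_module R (induced_module R S V)"
  unfolding induced_module_eq
proof (rule Q.left_module_quot)
  fix a b c assume ab: "a \<in> carrier R" "b \<in> carrier R" and c: "c \<in> carrier F"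
  have "(a \<oplus>\<^bsub>R\<^esub> b) \<odot>\<^bsub>F\<^esub> c - (a \<odot>\<^bsub>F\<^esub> c + b \<odot>\<^bsub>F\<^esub> c) \<in> H"
    using c
  proof (induction rule: frag_F_induct)
    case (one d v)
    then show ?case using rel_left[of "a \<otimes>\<^bsub>R\<^esub> d" "b \<otimes>\<^bsub>R\<^esub> d" v] ab by (simp add: F_simps R.l_distr diff_diff_add)
  next
    case (diff c d)
    from H_closed(4)[OF this] show ?case by (simp add: F_simps frag_extend_diff algebra_simps)
  qed (simp add: F_simps H_closed)
  then show "Q.cls ((a \<oplus>\<^bsub>R\<^esub> b) \<odot>\<^bsub>F\<^esub> c) = Q.cls (a \<odot>\<^bsub>F\<^esub> c \<oplus>\<^bsub>F\<^esub> b \<odot>\<^bsub>F\<^esub> c)"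
    using ab c Q.smult_closed F.a_closed by (intro Q.cls_eqI) (auto simp: a_minus_F F_simps(3))
  have "(a \<otimes>\<^bsub>R\<^esub> b) \<odot>\<^bsub>F\<^esub> c = a \<odot>\<^bsub>F\<^esub> (b \<odot>\<^bsub>F\<^esub> c)"
    using c by (induction rule: frag_F_induct) (use ab in \<open>auto simp: F_simps R.m_assoc frag_extend_diff\<close>)
  then show "Q.cls ((a \<otimes>\<^bsub>R\<^esub> b) \<odot>\<^bsub>F\<^esub> c) = Q.cls (a \<odot>\<^bsub>F\<^esub> (b \<odot>\<^bsub>F\<^esub> c))" by simp
next
  fix c assume "c \<in> carrier F"
  then have "\<one>\<^bsub>R\<^esub> \<odot>\<^bsub>F\<^esub> c = c"
    by (induction rule: frag_F_induct) (auto simp: F_simps frag_extend_diff)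
  then show "Q.cls (\<one>\<^bsub>R\<^esub> \<odot>\<^bsub>F\<^esub> c) = Q.cls c" by simp
qed

end

section \<open>Characters\<close>

text \<open>Provides the uniqueness behind the definite descriptions of
  \<open>weight_character\<close> and \<open>counit\<close>; extensionality settles the values off
  the subalgebra.\<close>

lemma character_eqI:
  assumes "\<chi> \<in> characters q n (generate_ring (uq q n) G)" "\<chi>' \<in> characters q n (generate_ring (uq q n) G)"
    and G: "G \<subseteq> carrier (uq q n)" and eq: "\<And>g. g \<in> G \<Longrightarrow> \<chi> g = \<chi>' g"
  shows "\<chi> = \<chi>'"
proof -
  interpret ring "uq q n" by (rule ring_uq)
  let ?A = "generate_ring (uq q n) G"
  have hom: "\<phi> (a \<oplus>\<^bsub>uq q n\<^esub> b) = \<phi> a + \<phi> b" "\<phi> (a \<otimes>\<^bsub>uq q n\<^esub> b) = \<phi> a * \<phi> b" "\<phi> \<one>\<^bsub>uq q n\<^esub> = 1"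
    if "\<phi> \<in> characters q n ?A" "a \<in> ?A" "b \<in> ?A" for \<phi> a b
    using that ring_hom_add[of \<phi> "(uq q n)\<lparr>carrier := ?A\<rparr>" type_ring a b]
      ring_hom_mult[of \<phi> "(uq q n)\<lparr>carrier := ?A\<rparr>" type_ring a b]
      ring_hom_one[of \<phi> "(uq q n)\<lparr>carrier := ?A\<rparr>" type_ring]
    by (auto simp: characters_def)
  have neg: "\<phi> (\<ominus>\<^bsub>uq q n\<^esub> a) = - \<phi> a" if \<phi>: "\<phi> \<in> characters q n ?A" and a: "a \<in> ?A" for \<phi> a
  proof -
    have aU: "a \<in> carrier (uq q n)" using a by (rule generate_ring_in_carrier[OF G])
    have z: "\<zero>\<^bsub>uq q n\<^esub> \<in> ?A" by (rule zero_in_generate)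
    have "\<phi> \<zero>\<^bsub>uq q n\<^esub> = 0" using hom(1)[OF \<phi> z z] by (metis add_cancel_right_right l_zero zero_closed)
    moreover have "\<phi> (a \<oplus>\<^bsub>uq q n\<^esub> \<ominus>\<^bsub>uq q n\<^esub> a) = \<phi> a + \<phi> (\<ominus>\<^bsub>uq q n\<^esub> a)"
      by (rule hom(1)[OF \<phi> a generate_ring.a_inv[OF a]])
    ultimately show ?thesis using aU by (simp add: r_neg eq_neg_iff_add_eq_0 add.commute)
  qed
  have "\<chi> a = \<chi>' a" if "a \<in> ?A" for a
    using that
  proof (induction rule: generate_ring.induct)
    case one
    show ?case using hom(3)[OF assms(1)] hom(3)[OF assms(2)] generate_ring.one by metis
  next
    case (a_inv h)
    then show ?case using neg[OF assms(1)] neg[OF assms(2)] by simp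
  next
    case (eng_add h1 h2)
    then show ?case using hom(1)[OF assms(1)] hom(1)[OF assms(2)] by simp
  next
    case (eng_mult h1 h2)
    then show ?case using hom(2)[OF assms(1)] hom(2)[OF assms(2)] by simp
  qed (use eq in simp)
  moreover have "\<chi> \<in> extensional ?A" "\<chi>' \<in> extensional ?A" using assms(1,2) by (auto simp: characters_def)
  ultimately show ?thesis by (intro extensionalityI[of _ ?A]) auto
qed

lemma uq_plus_gens: "range (uq_scalar q n) \<union> uq_gen q n ` {X1, X2, K1, K2} \<subseteq> carrier (uq q n)"
  by (auto simp: uq_scalar_def uq_gen_def)

lemma uq_plus_subset: "uq_plus q n \<subseteq> carrier (uq q n)"
  unfolding uq_plus_def by (rule ring.generate_ring_incl[OF ring_uq uq_plus_gens])

lemma uq_plus_mem: "uq_scalar q n c \<in> uq_plus q n" "g \<in> {X1, X2, K1, K2} \<Longrightarrow> uq_gen q n g \<in> uq_plus q n"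
  unfolding uq_plus_def by (rule generate_ring.incl; auto)+

text \<open>The coefficient functional descends to \<open>uq\<close>, and its restriction to
  \<open>uq_plus\<close> is the weight character. Multiplicativity with an arbitrary left factor is
  what balancedness of the tensor product will ask for.\<close>

lemma (in uq_root) weight_functional:
  obtains ev :: "'k falg set \<Rightarrow> 'k" where
    "\<And>a b. a \<in> carrier (uq q n) \<Longrightarrow> b \<in> carrier (uq q n) \<Longrightarrow> ev (a \<oplus>\<^bsub>uq q n\<^esub> b) = ev a + ev b"
    "ev \<one>\<^bsub>uq q n\<^esub> = 1"
    "\<And>a s. a \<in> carrier (uq q n) \<Longrightarrow> s \<in> uq_plus q n \<Longrightarrow> ev (a \<otimes>\<^bsub>uq q n\<^esub> s) = ev a * ev s"
    "\<And>s. s \<in> uq_plus q n \<Longrightarrow> ev s = weight_character q n i j s"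
    "weight_character q n i j \<in> characters q n (uq_plus q n)"
    "weight_character q n i j (uq_gen q n X1) = 0" "weight_character q n i j (uq_gen q n X2) = 0"
    "weight_character q n i j (uq_gen q n K1) = q ^ i" "weight_character q n i j (uq_gen q n K2) = q ^ j"
proof -
  have N_pos: "N > 0" using N_gt by simp
  obtain \<epsilon> :: "'k falg \<Rightarrow> 'k" where \<epsilon>:
    "\<And>a b. \<epsilon> (a + b) = \<epsilon> a + \<epsilon> b" "\<And>c a. \<epsilon> (scale c a) = c * \<epsilon> a"
    "\<And>a. a \<in> uq_ideal q n \<Longrightarrow> \<epsilon> a = 0" "\<epsilon> 1 = 1"
    "\<And>a. \<epsilon> (a * fgen X1) = 0" "\<And>a. \<epsilon> (a * fgen X2) = 0"
    "\<And>a. \<epsilon> (a * fgen K1) = q ^ i * \<epsilon> a" "\<And>a. \<epsilon> (a * fgen K2) = q ^ j * \<epsilon> a"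
  proof (rule highest_weight_functional[OF N_eq N_pos q_N, of i j], goal_cases)
    case (1 e)
    show ?case by (rule 1(1)) (fact 1(2-))+
  qed
  define ev where "ev A = \<epsilon> (SOME p. uq_of q n p = A)" for A
  have ev: "ev (uq_of q n p) = \<epsilon> p" for p
  proof -
    have "uq_of q n (SOME r. uq_of q n r = uq_of q n p) = uq_of q n p" by (rule someI[of _ p]) simp
    then have "(SOME r. uq_of q n r = uq_of q n p) - p \<in> uq_ideal q n" by (simp add: uq_of_eq_iff)
    from \<epsilon>(3)[OF this] \<epsilon>(1)[of "(SOME r. uq_of q n r = uq_of q n p) - p" p] show ?thesis by (simp add: ev_def)
  qed
  interpret ring "uq q n" by (rule ring_uq)
  have add: "ev (a \<oplus>\<^bsub>uq q n\<^esub> b) = ev a + ev b" if "a \<in> carrier (uq q n)" "b \<in> carrier (uq q n)" for a b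
    using that by (auto simp: carrier_uq ev \<epsilon> simp flip: uq_of_add)
  have one: "ev \<one>\<^bsub>uq q n\<^esub> = 1" by (simp add: ev \<epsilon> flip: uq_of_one)
  \<comment> \<open>The induction is general in the left factor, so that in a product of two
    elements of \<open>uq_plus\<close> the first can be absorbed into \<open>a\<close>.\<close>
  have mult: "ev (a \<otimes>\<^bsub>uq q n\<^esub> s) = ev a * ev s" if "a \<in> carrier (uq q n)" "s \<in> uq_plus q n" for a s
    using that(2,1) unfolding uq_plus_def
  proof (induction arbitrary: a rule: generate_ring.induct)
    case (incl h)
    have \<epsilon>': "\<epsilon> (fgen X1) = 0" "\<epsilon> (fgen X2) = 0" "\<epsilon> (fgen K1) = q ^ i" "\<epsilon> (fgen K2) = q ^ j"
      using \<epsilon>(4) \<epsilon>(5-8)[of 1] by simp_all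
    obtain p where p: "a = uq_of q n p" using incl by (auto simp: carrier_uq)
    show ?case
      using incl(1) unfolding p
      by (auto simp: uq_scalar_eq uq_gen_def ev \<epsilon> \<epsilon>' scale_mult_right simp flip: uq_of_mult)
  next
    case (a_inv h)
    have h: "h \<in> carrier (uq q n)" using a_inv(1) uq_plus_subset by (auto simp: uq_plus_def)
    have neg: "ev (\<ominus>\<^bsub>uq q n\<^esub> x) = - ev x" if "x \<in> carrier (uq q n)" for x
      using that \<epsilon>(2)[of "- 1"] by (auto simp: carrier_uq ev simp flip: uq_of_uminus)
    show ?case using a_inv.IH[OF a_inv.prems] h a_inv.prems by (simp add: r_minus neg)
  next
    case (eng_add h1 h2)
    have h: "h1 \<in> carrier (uq q n)" "h2 \<in> carrier (uq q n)"
      using eng_add(1,2) uq_plus_subset by (auto simp: uq_plus_def)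
    then show ?case using eng_add by (simp add: r_distr add algebra_simps)
  next
    case (eng_mult h1 h2)
    have h: "h1 \<in> carrier (uq q n)" "h2 \<in> carrier (uq q n)"
      using eng_mult(1,2) uq_plus_subset by (auto simp: uq_plus_def)
    have "ev (a \<otimes>\<^bsub>uq q n\<^esub> (h1 \<otimes>\<^bsub>uq q n\<^esub> h2)) = ev (a \<otimes>\<^bsub>uq q n\<^esub> h1) * ev h2"
      using eng_mult.IH(2)[of "a \<otimes>\<^bsub>uq q n\<^esub> h1"] h eng_mult.prems by (simp add: m_assoc)
    then show ?case using eng_mult.IH(1)[OF eng_mult.prems] eng_mult.IH(2)[OF h(1)] by simp
  qed (use one in simp)
  define \<chi> where "\<chi> = restrict ev (uq_plus q n)"
  have sub: "a \<in> uq_plus q n \<Longrightarrow> a \<in> carrier (uq q n)" for a using uq_plus_subset by auto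
  have \<chi>: "\<chi> \<in> characters q n (uq_plus q n)"
    unfolding characters_def
  proof (intro CollectI conjI IntI allI ring_hom_memI)
    show "\<chi> (uq_scalar q n c) = c" for c
      using uq_plus_mem(1)[of q n c] \<epsilon>(2)[of c 1] by (simp add: \<chi>_def uq_scalar_eq ev \<epsilon>)
    show "\<chi> (x \<otimes>\<^bsub>(uq q n)\<lparr>carrier := uq_plus q n\<rparr>\<^esub> y) = \<chi> x \<otimes>\<^bsub>type_ring\<^esub> \<chi> y"
      if "x \<in> carrier ((uq q n)\<lparr>carrier := uq_plus q n\<rparr>)" "y \<in> carrier ((uq q n)\<lparr>carrier := uq_plus q n\<rparr>)" for x y
    proof -
      have xy: "x \<in> uq_plus q n" "y \<in> uq_plus q n" "x \<otimes>\<^bsub>uq q n\<^esub> y \<in> uq_plus q n"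
        using that by (auto simp: uq_plus_def intro: generate_ring.eng_mult)
      then show ?thesis using mult[OF sub] by (simp add: \<chi>_def)
    qed
    show "\<chi> (x \<oplus>\<^bsub>(uq q n)\<lparr>carrier := uq_plus q n\<rparr>\<^esub> y) = \<chi> x \<oplus>\<^bsub>type_ring\<^esub> \<chi> y"
      if "x \<in> carrier ((uq q n)\<lparr>carrier := uq_plus q n\<rparr>)" "y \<in> carrier ((uq q n)\<lparr>carrier := uq_plus q n\<rparr>)" for x y
    proof -
      have xy: "x \<in> uq_plus q n" "y \<in> uq_plus q n" "x \<oplus>\<^bsub>uq q n\<^esub> y \<in> uq_plus q n"
        using that by (auto simp: uq_plus_def intro: generate_ring.eng_add)
      then show ?thesis using add[OF sub sub] by (simp add: \<chi>_def)
    qed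
    show "\<chi> \<one>\<^bsub>(uq q n)\<lparr>carrier := uq_plus q n\<rparr>\<^esub> = \<one>\<^bsub>type_ring\<^esub>"
      using one by (simp add: \<chi>_def uq_plus_def generate_ring.one)
  qed (auto simp: \<chi>_def)
  have gens: "\<chi> (uq_gen q n X1) = 0 \<and> \<chi> (uq_gen q n X2) = 0 \<and> \<chi> (uq_gen q n K1) = q ^ i \<and> \<chi> (uq_gen q n K2) = q ^ j"
  proof -
    have "\<chi> (uq_gen q n g) = \<epsilon> (fgen g)" if "g \<in> {X1, X2, K1, K2}" for g
      using uq_plus_mem(2)[OF that, of q n] by (simp add: \<chi>_def uq_gen_def ev)
    then show ?thesis using \<epsilon>(4) \<epsilon>(5-8)[of 1] by simp
  qed
  have weight: "weight_character q n i j = \<chi>"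
    unfolding weight_character_def
  proof (rule the_equality)
    fix \<phi> assume \<phi>: "\<phi> \<in> characters q n (uq_plus q n) \<and> \<phi> (uq_gen q n X1) = 0 \<and> \<phi> (uq_gen q n X2) = 0 \<and>
      \<phi> (uq_gen q n K1) = q ^ i \<and> \<phi> (uq_gen q n K2) = q ^ j"
    show "\<phi> = \<chi>"
    proof (rule character_eqI[OF _ _ uq_plus_gens, folded uq_plus_def])
      fix g assume "g \<in> range (uq_scalar q n) \<union> uq_gen q n ` {X1, X2, K1, K2}"
      then show "\<phi> g = \<chi> g" using \<phi> \<chi> gens by (auto simp: characters_def)
    qed (use \<phi> \<chi> in auto)
  qed (use \<chi> gens in auto)
  have "ev s = \<chi> s" if "s \<in> uq_plus q n" for s using that by (simp add: \<chi>_def)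
  from that[unfolded weight, OF add one mult this \<chi>] gens show thesis by blast
qed

section \<open>Standard modules and their simple quotients\<close>

context uq_module
begin

text \<open>Every proper submodule has a proper left ideal as preimage, which lies in the greatest
  one \<open>R\<close>; so the image of \<open>R\<close> contains all proper submodules.\<close>

lemma unique_maximal_submodule:
  assumes v: "cyclic v" and R: "left_ideal R" "annihilator q n S v \<subseteq> R" "1 \<notin> R"
    and greatest: "\<And>I. left_ideal I \<Longrightarrow> annihilator q n S v \<subseteq> I \<Longrightarrow> 1 \<notin> I \<Longrightarrow> I \<subseteq> R"
  shows "maximal_submodule (uq q n) S H \<longleftrightarrow> H = (\<lambda>p. uq_of q n p \<odot>\<^bsub>S\<^esub> v) ` R"
proof -
  have vS: "v \<in> carrier S" and S: "carrier S = range (\<lambda>p. uq_of q n p \<odot>\<^bsub>S\<^esub> v)"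
    using v unfolding cyclic_def by blast+
  let ?R = "(\<lambda>p. uq_of q n p \<odot>\<^bsub>S\<^esub> v) ` R"
  have sub: "submodule ?R (uq q n) S" by (rule submodule_image[OF vS R(1)])
  have small: "H \<subseteq> ?R" if H: "submodule H (uq q n) S" "H \<noteq> carrier S" for H
  proof -
    interpret H: submodule H "uq q n" S by (rule H)
    let ?I = "{p. uq_of q n p \<odot>\<^bsub>S\<^esub> v \<in> H}"
    have I: "left_ideal ?I" by (rule left_ideal_preimage[OF vS H(1)])
    moreover have "annihilator q n S v \<subseteq> ?I" using H.one_closed by (auto simp: annihilator_def)
    moreover have "1 \<notin> ?I"
    proof
      assume "1 \<in> ?I"
      from left_ideal_UNIV[OF I this] have "range (\<lambda>p. uq_of q n p \<odot>\<^bsub>S\<^esub> v) \<subseteq> H" by auto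
      then show False using H(2) H.subset unfolding S by auto
    qed
    ultimately have "?I \<subseteq> R" by (rule greatest)
    moreover have "H \<subseteq> range (\<lambda>p. uq_of q n p \<odot>\<^bsub>S\<^esub> v)" using H.subset S by simp
    ultimately show ?thesis by blast
  qed
  have proper: "?R \<noteq> carrier S"
  proof
    assume "?R = carrier S"
    then obtain p where p: "p \<in> R" "v = uq_of q n p \<odot>\<^bsub>S\<^esub> v" using vS by blast
    then have "1 - p \<in> annihilator q n S v" using act_eq_iff[OF vS, of 1 p] act_one[OF vS] by simp
    then have "(1 - p) + p \<in> R" using R p(1) left_idealD(2) by blast
    then show False using R by simp
  qed
  show ?thesis
    unfolding maximal_submodule_def using sub small proper by blast
qed

lemma cyclic_quotient:
  assumes v: "cyclic v" and R: "left_ideal R" "annihilator q n S v \<subseteq> R"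
    and H: "H = (\<lambda>p. uq_of q n p \<odot>\<^bsub>S\<^esub> v) ` R"
  shows "uq_module q n (quot_module S H)" "uq_module.cyclic q n (quot_module S H) (H +>\<^bsub>S\<^esub> v)"
    "annihilator q n (quot_module S H) (H +>\<^bsub>S\<^esub> v) = R"
proof -
  have vS: "v \<in> carrier S" and S: "carrier S = range (\<lambda>p. uq_of q n p \<odot>\<^bsub>S\<^esub> v)"
    using v unfolding cyclic_def by blast+
  have sub: "submodule H (uq q n) S" unfolding H by (rule submodule_image[OF vS R(1)])
  interpret Q: module_quotient H S "uq q n" by (rule submodule_quotient[OF sub])
  show L: "uq_module q n (quot_module S H)" by (intro uq_module.intro left_module_quotient sub)
  interpret L: uq_module q n "quot_module S H" by (rule L)
  show "L.cyclic (H +>\<^bsub>S\<^esub> v)"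
  proof -
    have "range (\<lambda>p. uq_of q n p \<odot>\<^bsub>quot_module S H\<^esub> (H +>\<^bsub>S\<^esub> v)) = Q.cls ` range (\<lambda>p. uq_of q n p \<odot>\<^bsub>S\<^esub> v)"
      using vS by (simp add: Q.smult_quot image_image)
    then show ?thesis unfolding L.cyclic_def Q.carrier_quot S[symmetric] using vS by auto
  qed
  have "uq_of q n p \<odot>\<^bsub>S\<^esub> v \<in> H \<longleftrightarrow> p \<in> R" for p
  proof
    assume "uq_of q n p \<odot>\<^bsub>S\<^esub> v \<in> H"
    then obtain r where r: "r \<in> R" "uq_of q n p \<odot>\<^bsub>S\<^esub> v = uq_of q n r \<odot>\<^bsub>S\<^esub> v" unfolding H by auto
    then have "p - r \<in> R" using act_eq_iff[OF vS] R(2) by auto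
    then have "(p - r) + r \<in> R" using left_idealD(2)[OF R(1)] r(1) by blast
    then show "p \<in> R" by simp
  qed (auto simp: H)
  then show "annihilator q n (quot_module S H) (H +>\<^bsub>S\<^esub> v) = R"
    using vS by (auto simp: annihilator_def Q.smult_quot Q.zero_quot Q.cls_mem)
qed

end

context uq_root
begin

text \<open>The generator is 1 tensor 1. It is non-zero because some additive functional on the free
  group respects all tensor relations and does not vanish on it.\<close>

lemma standard_module_cyclic:
  obtains v where "uq_module q n (standard_module q n i j)" "uq_module.cyclic q n (standard_module q n i j) v"
    "uq_hw q n N (annihilator q n (standard_module q n i j) v) (q ^ i) (q ^ j)"
    "1 \<notin> annihilator q n (standard_module q n i j) v"
proof -
  let ?\<chi> = "weight_character q n i j" and ?U = "uq q n"
  let ?M = "standard_module q n i j"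
  obtain ev where ev:
    "\<And>a b. a \<in> carrier ?U \<Longrightarrow> b \<in> carrier ?U \<Longrightarrow> ev (a \<oplus>\<^bsub>?U\<^esub> b) = ev a + ev b" "ev \<one>\<^bsub>?U\<^esub> = 1"
    "\<And>a s. a \<in> carrier ?U \<Longrightarrow> s \<in> uq_plus q n \<Longrightarrow> ev (a \<otimes>\<^bsub>?U\<^esub> s) = ev a * ev s"
    "\<And>s. s \<in> uq_plus q n \<Longrightarrow> ev s = ?\<chi> s"
    and \<chi>: "?\<chi> \<in> characters q n (uq_plus q n)" "?\<chi> (uq_gen q n X1) = 0" "?\<chi> (uq_gen q n X2) = 0"
      "?\<chi> (uq_gen q n K1) = q ^ i" "?\<chi> (uq_gen q n K2) = q ^ j"
  proof (rule weight_functional[of i j], goal_cases)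
    case (1 e)
    show ?case by (rule 1(1)) (fact 1(2-))+
  qed
  have \<chi>_scalar: "?\<chi> (uq_scalar q n c) = c" for c using \<chi>(1) by (simp add: characters_def)
  let ?V = "character_module ?\<chi> :: ('k falg set, 'k) module"
  have V: "carrier ?V = UNIV" "v \<oplus>\<^bsub>?V\<^esub> w = v + w" "a \<odot>\<^bsub>?V\<^esub> v = ?\<chi> a * v" for v w a
    by (auto simp: character_module_def)
  interpret R: ring ?U by (rule ring_uq)
  interpret D: induction_data ?U "uq_plus q n" ?V
    by (intro induction_data.intro induction_data_axioms.intro ring_uq uq_plus_subset) (simp_all add: V)
  have M: "?M = quot_module D.F D.H" by (simp add: standard_module_def D.induced_module_eq)
  have mod: "uq_module q n ?M"
    unfolding uq_module_def standard_module_def by (rule D.left_module_induced)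
  interpret M: uq_module q n ?M by (rule mod)
  define m where "m = D.Q.cls (frag_of (\<one>\<^bsub>?U\<^esub>, 1))"
  have fragF: "a \<in> carrier ?U \<Longrightarrow> frag_of (a, c) \<in> carrier D.F" for a c
    by (rule D.frag_of_F) (simp_all add: V)
  have smult: "a \<odot>\<^bsub>?M\<^esub> m = D.Q.cls (frag_of (a, 1))" if "a \<in> carrier ?U" for a
    using that unfolding M m_def by (subst D.Q.smult_quot) (auto simp: fragF D.F_simps(4))
  have mM: "m \<in> carrier ?M" unfolding M D.Q.carrier_quot m_def by (auto simp: fragF)
  have s_act: "s \<odot>\<^bsub>?M\<^esub> m = uq_scalar q n (?\<chi> s) \<odot>\<^bsub>?M\<^esub> m" if s: "s \<in> uq_plus q n" for s
  proof -
    have sU: "s \<in> carrier ?U" using s uq_plus_subset by auto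
    have *: "D.Q.cls (frag_of (t, 1)) = D.Q.cls (frag_of (\<one>\<^bsub>?U\<^esub>, ?\<chi> t))" if t: "t \<in> uq_plus q n" for t
    proof (rule D.Q.cls_eqI)
      have tU: "t \<in> carrier ?U" using t uq_plus_subset by auto
      then show "frag_of (t, 1) \<in> carrier D.F" "frag_of (\<one>\<^bsub>?U\<^esub>, ?\<chi> t) \<in> carrier D.F" by (auto simp: fragF)
      then show "frag_of (t, 1) \<ominus>\<^bsub>D.F\<^esub> frag_of (\<one>\<^bsub>?U\<^esub>, ?\<chi> t) \<in> D.H"
        using D.rel_balanced[of "\<one>\<^bsub>?U\<^esub>" t 1] t tU by (simp add: V D.a_minus_F)
    qed
    have sc: "uq_scalar q n (?\<chi> s) \<in> uq_plus q n" by (rule uq_plus_mem)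
    then have "uq_scalar q n (?\<chi> s) \<in> carrier ?U" using uq_plus_subset by auto
    then show ?thesis using *[OF s] *[OF sc] smult[OF sU] smult by (simp add: \<chi>_scalar)
  qed
  have cyc: "M.cyclic m"
    unfolding M.cyclic_def
  proof (intro conjI equalityI subsetI)
    fix x assume "x \<in> carrier ?M"
    then obtain c where c: "c \<in> carrier D.F" "x = D.Q.cls c" unfolding M D.Q.carrier_quot by auto
    \<comment> \<open>Balancedness moves the scalar of a pure tensor into its first factor, and
      additivity in that factor merges differences into a single tensor with 1.\<close>
    have "\<exists>p. c - frag_of (uq_of q n p, 1) \<in> D.H"
      using c(1)
    proof (induction rule: D.frag_F_induct)
      case zero
      \<comment> \<open>Additivity for 0 + 0 shows that 0 tensor 1 vanishes.\<close>
      have "frag_of (uq_of q n (0 + 0), 1) - frag_of (uq_of q n 0, 1) - frag_of (uq_of q n 0, 1) \<in> D.H"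
        unfolding uq_of_add by (rule D.rel_left) (auto simp: V)
      then show ?case by (intro exI[of _ 0]) simp
    next
      case (one a c)
      obtain p where p: "a = uq_of q n p" using one(1) by (auto simp: carrier_uq)
      have "frag_of (a \<otimes>\<^bsub>?U\<^esub> uq_scalar q n c, 1) - frag_of (a, uq_scalar q n c \<odot>\<^bsub>?V\<^esub> 1) \<in> D.H"
        by (rule D.rel_balanced) (use one uq_plus_mem in \<open>auto simp: V\<close>)
      from D.H_closed(3)[OF this] show ?case
        by (intro exI[of _ "p * scale c 1"]) (simp add: p V \<chi>_scalar uq_of_mult flip: uq_scalar_eq)
    next
      case (diff c d)
      then obtain p r where pr: "c - frag_of (uq_of q n p, 1) \<in> D.H" "d - frag_of (uq_of q n r, 1) \<in> D.H" by auto
      have rel: "frag_of (uq_of q n ((p - r) + r), 1) - frag_of (uq_of q n (p - r), 1) - frag_of (uq_of q n r, 1) \<in> D.H"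
        unfolding uq_of_add by (rule D.rel_left) (auto simp: V)
      have eq: "c - d - frag_of (uq_of q n (p - r), 1) =
        ((c - frag_of (uq_of q n p, 1)) - (d - frag_of (uq_of q n r, 1))) +
        (frag_of (uq_of q n ((p - r) + r), 1) - frag_of (uq_of q n (p - r), 1) - frag_of (uq_of q n r, 1))"
        by simp
      show ?case unfolding eq by (intro exI[of _ "p - r"]) (unfold eq, intro D.H_closed(2,4) pr rel)
    qed
    then obtain p where p: "c - frag_of (uq_of q n p, 1) \<in> D.H" by blast
    have "x = D.Q.cls (frag_of (uq_of q n p, 1))"
      unfolding c(2) by (rule D.Q.cls_eqI) (use c p in \<open>auto simp: fragF D.a_minus_F\<close>)
    then show "x \<in> range (\<lambda>p. uq_of q n p \<odot>\<^bsub>?M\<^esub> m)" by (simp add: smult)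
  qed (use mM in auto)
  let ?I = "annihilator q n ?M m"
  have gen: "fgen g - fconst (?\<chi> (uq_gen q n g)) \<in> ?I" if "g \<in> {X1, X2, K1, K2}" for g
    using s_act[OF uq_plus_mem(2)[OF that]] M.act_eq_iff[OF mM] by (simp add: uq_gen_def uq_scalar_def)
  have hw: "uq_hw q n N ?I (q ^ i) (q ^ j)"
  proof
    show "left_ideal ?I" by (rule M.left_ideal_annihilator[OF mM])
    show "uq_ideal q n \<subseteq> ?I" by (rule M.uq_ideal_annihilator[OF mM])
  qed (use gen[of X1] gen[of X2] gen[of K1] gen[of K2] in \<open>simp_all add: \<chi> fconst_simps\<close>)
  \<comment> \<open>The additive extension of a tensor c -> \<open>ev a * c\<close>; it takes the
    value 1 on the generator.\<close>
  define \<Phi> where "\<Phi> c = (\<Sum>x\<in>Poly_Mapping.keys c. of_int (Poly_Mapping.lookup c x) * (ev (fst x) * snd x))"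
    for c :: "('k falg set \<times> 'k) \<Rightarrow>\<^sub>0 int"
  have \<Phi>_sup: "\<Phi> c = (\<Sum>x\<in>T. of_int (Poly_Mapping.lookup c x) * (ev (fst x) * snd x))"
    if "finite T" "Poly_Mapping.keys c \<subseteq> T" for c T
    unfolding \<Phi>_def by (rule sum.mono_neutral_left) (use that in \<open>auto simp: in_keys_iff\<close>)
  have \<Phi>_add: "\<Phi> (c + d) = \<Phi> c + \<Phi> d" for c d
  proof -
    let ?T = "Poly_Mapping.keys c \<union> Poly_Mapping.keys d"
    show ?thesis using keys_add[of c d]
      by (simp add: \<Phi>_sup[of ?T] lookup_add distrib_right sum.distrib)
  qed
  have \<Phi>_0: "\<Phi> 0 = 0" by (simp add: \<Phi>_def)
  have \<Phi>_minus: "\<Phi> (- c) = - \<Phi> c" for c using \<Phi>_add[of c "- c"] \<Phi>_0 by (simp add: eq_neg_iff_add_eq_0 add.commute)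
  have \<Phi>_diff: "\<Phi> (c - d) = \<Phi> c - \<Phi> d" for c d using \<Phi>_add[of c "- d"] by (simp add: \<Phi>_minus)
  have \<Phi>_of: "\<Phi> (frag_of (a, c)) = ev a * c" for a c by (simp add: \<Phi>_def keys_frag_of)
  have \<Phi>_H: "\<Phi> c = 0" if "c \<in> D.H" for c
    using that
  proof (induction rule: D.H_induct)
    case (rel c)
    then show ?case
      unfolding tensor_rels_def
    proof (elim UnE CollectE exE conjE)
      fix a s c' assume *: "c = frag_of (a \<otimes>\<^bsub>?U\<^esub> s, c') - frag_of (a, s \<odot>\<^bsub>?V\<^esub> c')" "a \<in> carrier ?U" "s \<in> uq_plus q n"
      then show ?thesis by (simp add: \<Phi>_diff \<Phi>_of V ev)
    qed (simp_all add: \<Phi>_diff \<Phi>_of V ev distrib_left distrib_right)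
  qed (simp_all add: \<Phi>_add \<Phi>_minus \<Phi>_0)
  have "1 \<notin> ?I"
  proof
    assume "1 \<in> ?I"
    then have "m = \<zero>\<^bsub>?M\<^esub>" by (simp add: M.one_annihilator mM)
    then have "frag_of (\<one>\<^bsub>?U\<^esub>, 1) \<in> D.H"
      unfolding M D.Q.zero_quot m_def by (subst (asm) D.Q.cls_mem) (auto simp: fragF)
    from \<Phi>_H[OF this] show False by (simp add: \<Phi>_of ev)
  qed
  then show thesis using that mod cyc hw by blast
qed

end

section \<open>The tensor unit\<close>

text \<open>The trivial representation on functions on a single point; its matrix entry is an
  algebra map to the field.\<close>

lemma counit_functional:
  fixes q :: "'k::field"
  assumes "n > 0"
  obtains e :: "'k falg \<Rightarrow> 'k" where "\<And>a b. e (a + b) = e a + e b" "\<And>a b. e (a * b) = e a * e b"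
    "\<And>c. e (fconst c) = c" "\<And>a. a \<in> uq_ideal q n \<Longrightarrow> e a = 0"
    "\<And>g. e (fgen g) = (if g \<in> {K1, K2} then 1 else 0)"
proof -
  define \<rho> :: "gen \<Rightarrow> (unit \<Rightarrow> 'k) \<Rightarrow> unit \<Rightarrow> 'k" where "\<rho> g f = (if g \<in> {K1, K2} then f else (\<lambda>_. 0))" for g f
  interpret falg_rep \<rho> by unfold_locales (auto simp: \<rho>_def)
  define e where "e a = falg_act \<rho> a (\<lambda>_. 1) ()" for a
  have e: "falg_act \<rho> a f = (\<lambda>_. e a * f ())" for a f
  proof -
    have "falg_act \<rho> a f = falg_act \<rho> (a * fconst (f ())) (\<lambda>_. 1)" by (simp add: act_mult falg_act_fconst)
    also have "\<dots> = falg_act \<rho> (fconst (f ()) * a) (\<lambda>_. 1)" by (simp add: fconst_central)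
    finally show ?thesis by (simp add: act_mult falg_act_fconst e_def mult.commute fun_eq_iff)
  qed
  have add: "e (a + b) = e a + e b" for a b by (simp add: e_def falg_act_add)
  have diff: "e (a - b) = e a - e b" for a b by (simp add: e_def falg_act_diff)
  have mult: "e (a * b) = e a * e b" for a b
    using act_mult[of a b "\<lambda>_. 1"] by (simp add: e fun_eq_iff)
  have one: "e 1 = 1" by (simp add: e_def falg_act_one)
  have const: "e (fconst c) = c" for c by (simp add: e_def falg_act_fconst)
  have gen: "e (fgen g) = (if g \<in> {K1, K2} then 1 else 0)" for g by (simp add: e_def falg_act_fgen \<rho>_def)
  have pow: "e (a ^ k) = e a ^ k" for a k by (induction k) (simp_all add: one mult)
  have "e r = 0" if "r \<in> uq_rels q n" for r
    using that assms unfolding uq_rels_def Let_def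
    by (auto simp: add diff mult one const gen pow zero_power)
  then have "e a = 0" if "a \<in> uq_ideal q n" for a
    using act_uq_ideal[of q n a "\<lambda>_. 1"] that by (simp add: e fun_eq_iff)
  then show thesis using that[of e] add mult const gen by simp
qed

lemma uq_generated: "carrier (uq q n) = generate_ring (uq q n) (range (uq_scalar q n) \<union> range (uq_gen q n))"
proof
  interpret ring "uq q n" by (rule ring_uq)
  let ?G = "range (uq_scalar q n) \<union> range (uq_gen q n)"
  show "generate_ring (uq q n) ?G \<subseteq> carrier (uq q n)"
    by (rule generate_ring_incl) (auto simp: uq_scalar_def uq_gen_def)
  have "uq_of q n (p * 1) \<in> generate_ring (uq q n) ?G" for p
  proof (rule falg_left_induct)
    show "uq_of q n 1 \<in> generate_ring (uq q n) ?G" unfolding uq_of_one by (rule generate_ring.one)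
    show "uq_of q n (scale c a) \<in> generate_ring (uq q n) ?G" if "uq_of q n a \<in> generate_ring (uq q n) ?G" for c a
    proof -
      have "uq_of q n (scale c a) = uq_scalar q n c \<otimes>\<^bsub>uq q n\<^esub> uq_of q n a"
        by (simp add: uq_scalar_def scale_def uq_of_mult)
      moreover have "uq_scalar q n c \<otimes>\<^bsub>uq q n\<^esub> uq_of q n a \<in> generate_ring (uq q n) ?G"
        by (rule generate_ring.eng_mult[OF generate_ring.incl that]) simp
      ultimately show ?thesis by simp
    qed
    show "uq_of q n (fgen g * a) \<in> generate_ring (uq q n) ?G" if "uq_of q n a \<in> generate_ring (uq q n) ?G" for g a
    proof -
      have "uq_of q n (fgen g * a) = uq_gen q n g \<otimes>\<^bsub>uq q n\<^esub> uq_of q n a"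
        by (simp add: uq_gen_def uq_of_mult)
      moreover have "uq_gen q n g \<otimes>\<^bsub>uq q n\<^esub> uq_of q n a \<in> generate_ring (uq q n) ?G"
        by (rule generate_ring.eng_mult[OF generate_ring.incl that]) simp
      ultimately show ?thesis by simp
    qed
  qed (auto simp: uq_of_add intro: generate_ring.eng_add)
  then show "carrier (uq q n) \<subseteq> generate_ring (uq q n) ?G" by (auto simp: carrier_uq)
qed

lemma (in uq_root) counit_obtain:
  obtains e :: "'k falg \<Rightarrow> 'k" where "\<And>a b. e (a + b) = e a + e b" "\<And>a b. e (a * b) = e a * e b"
    "\<And>c. e (fconst c) = c" "\<And>g. e (fgen g) = (if g \<in> {K1, K2} then 1 else 0)"
    "\<And>p. counit q n (uq_of q n p) = e p"
proof -
  have "n > 0" using N_gt N_eq by simp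
  then obtain e :: "'k falg \<Rightarrow> 'k" where e: "\<And>a b. e (a + b) = e a + e b" "\<And>a b. e (a * b) = e a * e b"
    "\<And>c. e (fconst c) = c" "\<And>a. a \<in> uq_ideal q n \<Longrightarrow> e a = 0"
    "\<And>g. e (fgen g) = (if g \<in> {K1, K2} then 1 else 0)"
    using counit_functional[of n q] by blast
  have one: "e 1 = 1" using e(3)[of 1] by (simp add: fconst_simps)
  have pow: "e (a ^ k) = e a ^ k" for a k by (induction k) (simp_all add: one e)
  have eq: "e a = e b" if "uq_of q n a = uq_of q n b" for a b
    using that e(4)[of "a - b"] e(1)[of "a - b" b] by (simp add: uq_of_eq_iff)
  define \<epsilon> where "\<epsilon> = restrict (\<lambda>A. e (SOME p. uq_of q n p = A)) (carrier (uq q n))"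
  have \<epsilon>: "\<epsilon> (uq_of q n p) = e p" for p
  proof -
    have "uq_of q n (SOME r. uq_of q n r = uq_of q n p) = uq_of q n p" by (rule someI[of _ p]) simp
    from eq[OF this] show ?thesis by (simp add: \<epsilon>_def)
  qed
  have \<epsilon>_char: "\<epsilon> \<in> characters q n (carrier (uq q n))"
    unfolding characters_def
  proof (intro CollectI conjI IntI allI ring_hom_memI)
    show "\<epsilon> (uq_scalar q n c) = c" for c by (simp add: uq_scalar_def \<epsilon> e)
    show "\<epsilon> \<in> extensional (carrier (uq q n))" by (simp add: \<epsilon>_def)
  qed (auto simp: carrier_uq \<epsilon> e one simp flip: uq_of_add uq_of_mult uq_of_one)
  let ?C = "\<lambda>\<phi>. \<forall>g. uq_of q n (\<Sum>(a, b)\<leftarrow>coproduct_gen n g. fconst (\<phi> (uq_of q n a)) * b) = uq_gen q n g \<and>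
      uq_of q n (\<Sum>(a, b)\<leftarrow>coproduct_gen n g. fconst (\<phi> (uq_of q n b)) * a) = uq_gen q n g"
  have C: "?C \<epsilon>"
  proof
    fix g
    show "uq_of q n (\<Sum>(a, b)\<leftarrow>coproduct_gen n g. fconst (\<epsilon> (uq_of q n a)) * b) = uq_gen q n g \<and>
      uq_of q n (\<Sum>(a, b)\<leftarrow>coproduct_gen n g. fconst (\<epsilon> (uq_of q n b)) * a) = uq_gen q n g"
      by (cases g) (simp_all add: \<epsilon> e pow one fconst_simps uq_gen_def)
  qed
  have unique: "\<phi> = \<epsilon>" if \<phi>: "\<phi> \<in> characters q n (carrier (uq q n))" and "?C \<phi>" for \<phi>
  proof (rule character_eqI[where G = "range (uq_scalar q n) \<union> range (uq_gen q n)"])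
    show "\<phi> \<in> characters q n (generate_ring (uq q n) (range (uq_scalar q n) \<union> range (uq_gen q n)))"
      "\<epsilon> \<in> characters q n (generate_ring (uq q n) (range (uq_scalar q n) \<union> range (uq_gen q n)))"
      unfolding uq_generated[symmetric] by (rule \<phi> \<epsilon>_char)+
    have gen: "\<phi> (uq_of q n (fgen g)) = e (fgen g)" for g
    proof -
      \<comment> \<open>Applying \<open>e\<close> to the left counit identity isolates
        \<open>\<phi>\<close>: it gives 1 for the kappas, and for the other generators the second
        tensor dies under \<open>e\<close>.\<close>
      have "uq_of q n (\<Sum>(a, b)\<leftarrow>coproduct_gen n g. fconst (\<phi> (uq_of q n a)) * b) = uq_of q n (fgen g)"
        using \<open>?C \<phi>\<close> by (simp add: uq_gen_def)
      from eq[OF this] show ?thesis by (cases g) (simp_all add: e pow one)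
    qed
    fix h assume "h \<in> range (uq_scalar q n) \<union> range (uq_gen q n)"
    then show "\<phi> h = \<epsilon> h" using \<phi> \<epsilon>_char by (auto simp: characters_def uq_gen_def gen \<epsilon>)
  qed (auto simp: uq_scalar_def uq_gen_def)
  have "counit q n = \<epsilon>"
    unfolding counit_def using \<epsilon>_char C unique by (intro the_equality) blast+
  then show thesis using that[of e] e(1-3,5) \<epsilon> by simp
qed

text \<open>The annihilator of 1 is the kernel of an algebra map onto the field, so it has
  codimension one and is maximal.\<close>

lemma (in uq_root) tensor_unit_cyclic:
  "uq_module q n (tensor_unit q n)" "uq_module.cyclic q n (tensor_unit q n) 1"
  "uq_hw q n N (annihilator q n (tensor_unit q n) 1) (q ^ 0) (q ^ 0)"
  "maximal_left_ideal (annihilator q n (tensor_unit q n) 1)"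
proof -
  obtain e :: "'k falg \<Rightarrow> 'k" where e: "\<And>a b. e (a + b) = e a + e b" "\<And>a b. e (a * b) = e a * e b"
    "\<And>c. e (fconst c) = c" "\<And>g. e (fgen g) = (if g \<in> {K1, K2} then 1 else 0)"
    and counit: "\<And>p. counit q n (uq_of q n p) = e p"
    by (rule counit_obtain) blast
  let ?T = "tensor_unit q n"
  have one: "e 1 = 1" using e(3)[of 1] by (simp add: fconst_simps)
  have T: "carrier ?T = UNIV" "v \<oplus>\<^bsub>?T\<^esub> w = v + w" "\<zero>\<^bsub>?T\<^esub> = 0" "uq_of q n p \<odot>\<^bsub>?T\<^esub> v = e p * v" for v w p
    by (auto simp: tensor_unit_def character_module_def counit)
  have "abelian_group ?T"
    by (rule abelian_groupI) (auto simp: T add_ac intro: exI[of _ "- x" for x])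
  then show mod: "uq_module q n ?T"
    by (intro uq_module.intro left_module.intro left_module_axioms.intro ring_uq)
      (auto simp: carrier_uq T e one algebra_simps simp flip: uq_of_add uq_of_mult uq_of_one)
  interpret uq_module q n ?T by (rule mod)
  have "c = e (fconst c) * 1" for c by (simp add: e)
  then show "cyclic 1" unfolding cyclic_def T by (metis UNIV_I UNIV_eq_I rangeI)
  have ann: "annihilator q n ?T 1 = {p. e p = 0}" by (simp add: annihilator_def T)
  have one_T: "1 \<in> carrier ?T" by (simp add: T)
  note I = left_ideal_annihilator[OF one_T]
  have minus: "e (a - b) = e a - e b" for a b using e(1)[of "a - b" b] by simp
  show "uq_hw q n N (annihilator q n ?T 1) (q ^ 0) (q ^ 0)"
    by unfold_locales
      (use I uq_ideal_annihilator[OF one_T] in \<open>auto simp: ann e one minus fconst_simps\<close>)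
  show "maximal_left_ideal (annihilator q n ?T 1)"
    unfolding maximal_left_ideal_def
  proof (intro conjI allI impI)
    show "1 \<notin> annihilator q n ?T 1" by (simp add: ann one)
    fix I' assume I': "left_ideal I' \<and> annihilator q n ?T 1 \<subseteq> I' \<and> 1 \<notin> I'"
    have "e p = 0" if "p \<in> I'" for p
    proof (rule ccontr)
      assume "e p \<noteq> 0"
      have "p - fconst (e p) \<in> I'" using I' by (auto simp: ann minus e)
      then have "p - (p - fconst (e p)) \<in> I'" using I' that left_idealD(5) by blast
      then have "scale (e p) 1 \<in> I'" by (simp add: scale_def)
      then show False using left_ideal_scaleD \<open>e p \<noteq> 0\<close> I' by blast
    qed
    then show "I' = annihilator q n ?T 1" using I' by (auto simp: ann)
  qed (rule I)
qed

section \<open>The classification\<close>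

text \<open>A simple module with a chosen highest weight generator. Every simple module is brought
  to this form, after which only \<open>i\<close> and \<open>j\<close> matter.\<close>

locale simple_weight_module = uq_module q n S + uq_simple q n N "annihilator q n S v" i j
  for q :: "'k::field_char_0" and n N :: nat and S :: "('k falg set, 'v, 'm) module_scheme" and v i j +
  assumes cyc: "cyclic v"
begin

notation eqv (infix "\<approx>" 50)

abbreviation el where "el p \<equiv> uq_of q n p \<odot>\<^bsub>S\<^esub> v"

lemma v_closed: "v \<in> carrier S"
  using cyc unfolding cyclic_def by (rule conjunct1)

lemma el_one: "el 1 = v"
  by (rule act_one[OF v_closed])

lemma el_zero: "el p = \<zero>\<^bsub>S\<^esub> \<longleftrightarrow> p \<in> annihilator q n S v"
  by (simp add: annihilator_def)

lemma el_eq: "el p = el r \<longleftrightarrow> p \<approx> r"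
  by (simp add: act_eq_iff[OF v_closed] eqv_def)

lemma act_el: "act q n S g (el p) = el (fgen g * p)"
  by (rule act_gen[OF v_closed])

lemma q_powi: "q powi (int a - int b) = q ^ a / q ^ b"
  using q_nonzero by (simp add: power_int_diff)

lemma weightI:
  assumes "fgen K1 * p \<approx> scale (q ^ a / q ^ a') p" "fgen K2 * p \<approx> scale (q ^ b / q ^ b') p"
    "fst d = int a - int a'" "snd d = int b - int b'"
  shows "has_weight q n S (el p) d"
  using assms by (simp add: has_weight_act[OF v_closed] q_powi eqv_def)

lemma weight_A: "fst d = int i - int m \<Longrightarrow> snd d = int j - int m \<Longrightarrow> has_weight q n S (el (A m)) d"
  and weight_B: "fst d = int i - int m \<Longrightarrow> snd d = int j - int m \<Longrightarrow> has_weight q n S (el (B m)) d"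
  and weight_C: "fst d = int i - int m - 1 \<Longrightarrow> snd d = int j - int m \<Longrightarrow> has_weight q n S (el (C m)) d"
  and weight_D: "fst d = int i - int m \<Longrightarrow> snd d = int j - int m - 1 \<Longrightarrow> has_weight q n S (el (D m)) d"
  by (rule weightI[OF K_A], simp_all) (rule weightI[OF K_B], simp_all, rule weightI[OF K_C], simp_all, rule weightI[OF K_D], simp_all)

lemma highest: "highest_weight_vector q n S (el 1)" "generates_module (uq q n) S (el 1)"
proof -
  have "has_weight q n S (el 1) (int i, int j)" using weight_A[of "(int i, int j)" 0] by simp
  moreover have "act q n S X1 (el 1) = \<zero>\<^bsub>S\<^esub>" "act q n S X2 (el 1) = \<zero>\<^bsub>S\<^esub>"
    unfolding act_el el_zero using X_mem by simp_all
  ultimately show "highest_weight_vector q n S (el 1)"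
    using one_notin by (auto simp: highest_weight_vector_def el_zero)
  show "generates_module (uq q n) S (el 1)" unfolding generates_iff_cyclic el_one by (rule cyc)
qed

lemma maps_nonzeroI:
  "fgen g * p \<notin> annihilator q n S v \<Longrightarrow> has_weight q n S (el (fgen g * p)) d \<Longrightarrow> maps_nonzero q n S g (el p) d"
  by (simp add: maps_nonzero_def act_el el_zero)

lemma is_basis_el:
  assumes "finite F" "\<And>p. p \<in> fspan F w" "\<And>c s. (\<Sum>s\<in>F. scale (c s) (w s)) \<in> annihilator q n S v \<Longrightarrow> s \<in> F \<Longrightarrow> c s = 0"
  shows "is_basis q n S F (\<lambda>s. el (w s))"
  by (rule is_basisI[OF cyc assms(1)]) (use assms(2,3) in \<open>auto simp: fspan_def eqv_def\<close>)

lemma trivial_case: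
  assumes "i = 0" "j = 0"
  shows "is_basis q n S {0::nat} (\<lambda>s. el 1)" "w \<in> carrier S \<Longrightarrow> has_weight q n S w (0, 0)"
proof -
  have span: "p \<in> fspan {0::nat} (\<lambda>s. 1)" for p
  proof (rule fspan_UNIV)
    show "1 \<in> fspan {0::nat} (\<lambda>s. 1)" using fspan_base[of "{0::nat}" 0 "\<lambda>s. 1"] by simp
    show "fgen Y1 * 1 \<in> fspan {0::nat} (\<lambda>s. 1)" "fgen Y2 * 1 \<in> fspan {0::nat} (\<lambda>s. 1)"
      using C_zero[OF assms(2), of 0] D_zero[OF assms(1), of 0] by (auto intro: fspan_zero)
  qed simp
  show "is_basis q n S {0::nat} (\<lambda>s. el 1)"
    using is_basis_el[of "{0::nat}" "\<lambda>s. 1", OF _ span] by (simp add: scale_one_mem)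
  assume "w \<in> carrier S"
  then obtain p where p: "w = el p" using cyc unfolding cyclic_def by blast
  obtain c where "p \<approx> scale c 1" using span[of p] by (auto simp: fspan_def)
  then have w: "w = el (scale c 1)" by (simp add: p el_eq)
  have "fgen K1 * scale c 1 \<approx> scale (q ^ i / q ^ 0) (scale c 1)" "fgen K2 * scale c 1 \<approx> scale (q ^ j / q ^ 0) (scale c 1)"
    using eqv_scale[OF K_one(1), of c] eqv_scale[OF K_one(2), of c] by (simp_all add: scale_mult_right mult.commute)
  then show "has_weight q n S w (0, 0)" unfolding w by (rule weightI) (use assms in auto)
qed

lemma left_chain:
  assumes i: "i = 0" and j: "0 < j"
  shows "\<exists>w. is_basis q n S {0..2*j} w \<and>
         (\<forall>m\<le>j. has_weight q n S (w (2*m)) (- int m, int j - int m)) \<and>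
         (\<forall>m<j. has_weight q n S (w (2*m+1)) (- int m - 1, int j - int m)) \<and>
         highest_weight_vector q n S (w 0) \<and> generates_module (uq q n) S (w 0) \<and>
         (\<forall>m<j. maps_nonzero q n S Y1 (w (2*m)) (- int m - 1, int j - int m)) \<and>
         (\<forall>m<j. maps_nonzero q n S Y2 (w (2*m+1)) (- int (m+1), int j - int (m+1))) \<and>
         has_weight q n S (w (2*j)) (- int j, 0) \<and>
         act q n S Y1 (w (2*j)) = \<zero>\<^bsub>S\<^esub> \<and>
         act q n S Y2 (w (2*j)) = \<zero>\<^bsub>S\<^esub>"
proof -
  have A: "A m \<notin> annihilator q n S v" if "m \<le> j" for m
    using wA_nonzero[OF i j, of "2 * m"] that by (simp add: wA_simps)
  have C: "C m \<notin> annihilator q n S v" if "m < j" for m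
    using wA_nonzero[OF i j, of "Suc (2 * m)"] that by (simp add: wA_simps)
  have Y2A: "fgen Y2 * A j \<in> annihilator q n S v"
    using Y_zero(4)[of "j - 1"] j by (simp add: eqv_zero_iff del: power_Suc)
  show ?thesis
  proof (intro exI[of _ "\<lambda>s. el (wA s)"] conjI allI impI; (unfold Suc_eq_plus1[symmetric] wA_simps act_el el_zero)?)
    show "is_basis q n S {0..2*j} (\<lambda>s. el (wA s))"
      by (rule is_basis_el[OF _ left_chain_spanning[OF i j]]) (use left_chain_independent[OF i j] in auto)
    show "maps_nonzero q n S Y1 (el (A m)) (- int m - 1, int j - int m)" if "m < j" for m
      by (rule maps_nonzeroI[OF C[OF that] weight_C]) (simp_all add: i)
    show "maps_nonzero q n S Y2 (el (C m)) (- int (Suc m), int j - int (Suc m))" if "m < j" for m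
      using that by (intro maps_nonzeroI; unfold A_Suc[symmetric]) (auto intro!: A weight_A simp: i simp del: power_Suc)
  qed (use left_chain_end[OF i j] Y2A in \<open>auto intro!: weight_A weight_C highest simp: i\<close>)
qed

lemma right_chain:
  assumes i: "0 < i" and j: "j = 0"
  shows "\<exists>w. is_basis q n S {0..2*i} w \<and>
         (\<forall>m\<le>i. has_weight q n S (w (2*m)) (int i - int m, - int m)) \<and>
         (\<forall>m<i. has_weight q n S (w (2*m+1)) (int i - int m, - int m - 1)) \<and>
         highest_weight_vector q n S (w 0) \<and> generates_module (uq q n) S (w 0) \<and>
         (\<forall>m<i. maps_nonzero q n S Y2 (w (2*m)) (int i - int m, - int m - 1)) \<and>
         (\<forall>m<i. maps_nonzero q n S Y1 (w (2*m+1)) (int i - int (m+1), - int (m+1))) \<and>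
         has_weight q n S (w (2*i)) (0, - int i) \<and>
         act q n S Y1 (w (2*i)) = \<zero>\<^bsub>S\<^esub> \<and>
         act q n S Y2 (w (2*i)) = \<zero>\<^bsub>S\<^esub>"
proof -
  have B: "B m \<notin> annihilator q n S v" if "m \<le> i" for m
    using wB_nonzero[OF i j, of "2 * m"] that by (simp add: wB_simps)
  have D: "D m \<notin> annihilator q n S v" if "m < i" for m
    using wB_nonzero[OF i j, of "Suc (2 * m)"] that by (simp add: wB_simps)
  have Y1B: "fgen Y1 * B i \<in> annihilator q n S v"
    using Y_zero(3)[of "i - 1"] i by (simp add: eqv_zero_iff del: power_Suc)
  show ?thesis
  proof (intro exI[of _ "\<lambda>s. el (wB s)"] conjI allI impI; (unfold Suc_eq_plus1[symmetric] wB_simps act_el el_zero)?)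
    show "is_basis q n S {0..2*i} (\<lambda>s. el (wB s))"
      by (rule is_basis_el[OF _ right_chain_spanning[OF i j]]) (use right_chain_independent[OF i j] in auto)
    show "maps_nonzero q n S Y2 (el (B m)) (int i - int m, - int m - 1)" if "m < i" for m
      by (rule maps_nonzeroI[OF D[OF that] weight_D]) (simp_all add: j)
    show "maps_nonzero q n S Y1 (el (D m)) (int i - int (Suc m), - int (Suc m))" if "m < i" for m
      using that by (intro maps_nonzeroI; unfold B_Suc[symmetric]) (auto intro!: B weight_B simp: j simp del: power_Suc)
  qed (use right_chain_end[OF i j] Y1B in \<open>auto intro!: weight_B weight_D highest simp: j\<close>)
qed

lemma diamond:
  assumes ij0: "0 < i" "0 < j" and k: "1 \<le> k" "k \<le> N" "k mod N = (i + j) mod N"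
  shows "\<exists>w w'. w' 0 = w 0 \<and> w' (2*k) = w (2*k) \<and>
         is_basis q n S ({0..2*k} <+> {1..2*k-1}) (case_sum w w') \<and>
         (\<forall>m\<le>k. has_weight q n S (w (2*m)) (int i - int m, int j - int m) \<and>
                has_weight q n S (w' (2*m)) (int i - int m, int j - int m)) \<and>
         (\<forall>m<k. has_weight q n S (w (2*m+1)) (int i - int m, int j - int m - 1) \<and>
                has_weight q n S (w' (2*m+1)) (int i - int m - 1, int j - int m)) \<and>
         highest_weight_vector q n S (w 0) \<and> generates_module (uq q n) S (w 0) \<and>
         (\<forall>m<k. maps_nonzero q n S Y2 (w (2*m)) (int i - int m, int j - int m - 1) \<and>
                maps_nonzero q n S Y1 (w (2*m+1)) (int i - int (m+1), int j - int (m+1))) \<and>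
         (\<forall>m<k. maps_nonzero q n S Y1 (w' (2*m)) (int i - int m - 1, int j - int m) \<and>
                maps_nonzero q n S Y2 (w' (2*m+1)) (int i - int (m+1), int j - int (m+1))) \<and>
         has_weight q n S (w (2*k)) (int i - int k, int j - int k) \<and>
         has_weight q n S (w (2*k)) (- int j, - int i) \<and>
         act q n S Y1 (w (2*k)) = \<zero>\<^bsub>S\<^esub> \<and>
         act q n S Y2 (w (2*k)) = \<zero>\<^bsub>S\<^esub>"
proof -
  have k0: "0 < k" using k(1) by simp
  note hyps = ij0 k0 k(2,3)
  let ?w = "\<lambda>s. el (wAB k (Inl s))" and ?w' = "\<lambda>s. el (wAB k (Inr s))"
  have AB_nonzero: "A m \<notin> annihilator q n S v \<and> B m \<notin> annihilator q n S v" if "m \<le> k" for m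
  proof -
    consider "m = 0" | l where "m = Suc l" "m < k" | "m = k" using \<open>m \<le> k\<close> by (cases m) force+
    then show ?thesis
    proof cases
      case 1
      then show ?thesis using one_notin by simp
    next
      case (2 l)
      then have CD: "C l \<notin> annihilator q n S v" "D l \<notin> annihilator q n S v" using CD_nonzero[OF hyps, of l] by auto
      show ?thesis
        using AB_independent[OF hyps _ CD, of 1 0] AB_independent[OF hyps _ CD, of 0 1] 2 by auto
    next
      case 3
      obtain \<mu> where "\<mu> \<noteq> 0" "A k \<approx> scale \<mu> (B k)" using AB_k[OF hyps] by blast
      then show ?thesis using B_k[OF hyps] eqv_mem_iff left_ideal_scaleD[OF left_ideal] 3 by blast
    qed
  qed
  have w: "?w (2 * m) = el (B m)" "?w (Suc (2 * m)) = el (D m)" "?w' (Suc (2 * m)) = el (C m)" for m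
    by (simp_all add: wAB_simps[OF hyps])
  have w'_A: "?w' (2 * m) = el (A m)" if "m < k" for m using that by (simp add: wAB_simps[OF hyps])
  have w'_k: "?w' (2 * k) = el (B k)" by (simp add: wAB_def)
  have w'_weight: "has_weight q n S (?w' (2 * m)) (int i - int m, int j - int m)" if "m \<le> k" for m
    using that by (cases "m = k") (auto simp: w'_A w'_k intro!: weight_A weight_B)
  have basis: "is_basis q n S ({0..2*k} <+> {1..2*k-1}) (case_sum ?w ?w')"
  proof -
    have "case_sum ?w ?w' = (\<lambda>t. el (wAB k t))" by (auto simp: fun_eq_iff split: sum.split)
    moreover have "is_basis q n S ({0..2*k} <+> {1..2*k-1}) (\<lambda>t. el (wAB k t))"
      by (rule is_basis_el[OF _ diamond_spanned[OF hyps]], simp, erule (1) diamond_independent[OF hyps])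
    ultimately show ?thesis by simp
  qed
  have low: "has_weight q n S (el (B k)) (- int j, - int i)"
  proof (rule weightI[of _ 0 j 0 i])
    \<comment> \<open>Since k is congruent to i + j modulo N, (i - k, j - k) and (-j, -i) are the
      same weight.\<close>
    have "q ^ i / q ^ k = q ^ 0 / q ^ j" "q ^ j / q ^ k = q ^ 0 / q ^ i" using q_nonzero by (simp_all add: q_k[OF hyps])
    then show "fgen K1 * B k \<approx> scale (q ^ 0 / q ^ j) (B k)" "fgen K2 * B k \<approx> scale (q ^ 0 / q ^ i) (B k)"
      using K_B[of k] by simp_all
  qed simp_all
  have zero: "fgen Y1 * B k \<in> annihilator q n S v" "fgen Y2 * B k \<in> annihilator q n S v"
    using Y_zero(3)[of "k - 1"] k0 D_k[OF hyps] by (simp_all add: eqv_zero_iff del: power_Suc)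
  show ?thesis
  proof (rule exI[of _ ?w], rule exI[of _ ?w'], intro conjI allI impI)
    show "?w' 0 = ?w 0" using w(1)[of 0] w'_A[of 0] k0 by simp
    show "?w' (2 * k) = ?w (2 * k)" unfolding w w'_k ..
    show "is_basis q n S ({0..2*k} <+> {1..2*k-1}) (case_sum ?w ?w')" by (rule basis)
    show "has_weight q n S (?w (2 * k)) (- int j, - int i)" unfolding w by (rule low)
    show "act q n S Y1 (?w (2 * k)) = \<zero>\<^bsub>S\<^esub>" "act q n S Y2 (?w (2 * k)) = \<zero>\<^bsub>S\<^esub>"
      unfolding w act_el el_zero by (rule zero)+
    have w0: "?w 0 = el 1" using w(1)[of 0] by simp
    show "highest_weight_vector q n S (?w 0)" "generates_module (uq q n) S (?w 0)"
      unfolding w0 by (rule highest)+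
    show "has_weight q n S (?w (2 * k)) (int i - int k, int j - int k)" unfolding w by (rule weight_B) simp_all
    fix m
    show "m \<le> k \<Longrightarrow> has_weight q n S (?w (2 * m)) (int i - int m, int j - int m)"
      unfolding w by (rule weight_B) simp_all
    show "m \<le> k \<Longrightarrow> has_weight q n S (?w' (2 * m)) (int i - int m, int j - int m)" by (rule w'_weight)
    show "has_weight q n S (?w (2 * m + 1)) (int i - int m, int j - int m - 1)"
      unfolding Suc_eq_plus1[symmetric] w by (rule weight_D) simp_all
    show "has_weight q n S (?w' (2 * m + 1)) (int i - int m - 1, int j - int m)"
      unfolding Suc_eq_plus1[symmetric] w by (rule weight_C) simp_all
    assume m: "m < k"
    show "maps_nonzero q n S Y2 (?w (2 * m)) (int i - int m, int j - int m - 1)"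
      unfolding w using CD_nonzero[OF hyps m] by (intro maps_nonzeroI weight_D) auto
    show "maps_nonzero q n S Y1 (?w' (2 * m)) (int i - int m - 1, int j - int m)"
      unfolding w'_A[OF m] using CD_nonzero[OF hyps m] by (intro maps_nonzeroI weight_C) auto
    have AB: "A (Suc m) \<notin> annihilator q n S v" "B (Suc m) \<notin> annihilator q n S v" using AB_nonzero[of "Suc m"] m by auto
    show "maps_nonzero q n S Y1 (?w (2 * m + 1)) (int i - int (m + 1), int j - int (m + 1))"
      unfolding Suc_eq_plus1[symmetric] w
      by (rule maps_nonzeroI; unfold B_Suc[symmetric]) (rule AB, rule weight_B, simp_all)
    show "maps_nonzero q n S Y2 (?w' (2 * m + 1)) (int i - int (m + 1), int j - int (m + 1))"
      unfolding Suc_eq_plus1[symmetric] w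
      by (rule maps_nonzeroI; unfold A_Suc[symmetric]) (rule AB, rule weight_A, simp_all)
  qed
qed

text \<open>The highest weight vector spans the module, so y1 v = y2 v = 0; then x1 y1 v = (1 - q^j)
  v and x2 y2 v = (1 - q^i) v force both scalars to vanish.\<close>

lemma one_dimensional_weight:
  assumes "one_dimensional q n S"
  shows "i = 0 \<and> j = 0"
proof -
  obtain w where w: "is_basis q n S {0::nat} w" using assms by (auto simp: one_dimensional_def)
  then have "w 0 \<in> carrier S" by (auto simp: is_basis_def)
  then obtain p where p: "w 0 = el p" using cyc unfolding cyclic_def by blast
  have ex: "\<exists>c. r \<approx> scale c p" for r
  proof -
    have "el r \<in> carrier S" using v_closed by auto
    then obtain c where "el r = (\<Oplus>\<^bsub>S\<^esub>s\<in>{0::nat}. uq_scalar q n (c s) \<odot>\<^bsub>S\<^esub> w s)"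
      using w unfolding is_basis_def by blast
    also have "\<dots> = (\<Oplus>\<^bsub>S\<^esub>s\<in>{0::nat}. el (scale (c s) p))"
      using v_closed by (intro M.finsum_cong) (auto simp: p act_scalar)
    also have "\<dots> = el (scale (c 0) p)" by (subst finsum_act[OF v_closed]) simp_all
    finally show ?thesis unfolding el_eq by blast
  qed
  obtain c where c: "1 \<approx> scale c p" using ex by blast
  have "c \<noteq> 0" using c one_notin by (auto simp: eqv_def)
  have ex1: "\<exists>d. r \<approx> scale d 1" for r
  proof -
    obtain d where d: "r \<approx> scale d p" using ex by blast
    have "scale (d / c) 1 \<approx> scale (d / c) (scale c p)" by (rule eqv_scale[OF c])
    also have "scale (d / c) (scale c p) = scale d p" using \<open>c \<noteq> 0\<close> by simp
    finally show ?thesis using d eqv_sym eqv_trans by blast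
  qed
  have mem: "r \<in> annihilator q n S v" if "r \<in> spanned 1" for r
  proof -
    obtain d where d: "r \<approx> scale d 1" using ex1 by blast
    have "scale d 1 \<in> spanned 1" by (rule spanned_eqv[OF eqv_sym[OF d] that])
    then have "d = 0" using spanned_scale[of "scale d 1" 1 "inverse d"] one_notin_spanned one_notin by (cases "d = 0") auto
    then show ?thesis using d by (simp add: eqv_zero_iff)
  qed
  have "scale (1 - q ^ j) 1 \<in> annihilator q n S v"
    using eqv_mem_iff[OF X1_C0] ideal_simps(3) mem[OF spanned_words(1)] by blast
  moreover have "scale (1 - q ^ i) 1 \<in> annihilator q n S v"
    using eqv_mem_iff[OF X2_D0] ideal_simps(3) mem[OF spanned_words(2)] by blast
  ultimately have "q ^ j = q ^ 0" "q ^ i = q ^ 0" by (simp_all add: scale_one_mem)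
  moreover have "0 < N" using N_gt by simp
  ultimately show ?thesis using q_power_eq_iff[of j 0] q_power_eq_iff[of i 0] ij by blast
qed

end

text \<open>Modulo \<open>I\<close> the diamond for k = N already closes up, so its 4N vectors span;
  modulo the larger \<open>R\<close> they are independent. Hence an element of \<open>R\<close> has
  only zero coefficients.\<close>

lemma (in uq_hw) maximal_if_sum_N:
  assumes "a = q ^ i" "b = q ^ j" and ij: "0 < i" "0 < j" "i + j = N"
    and R: "maximal_left_ideal R" "I \<subseteq> R"
  shows "R = I"
proof
  interpret R: uq_simple q n N R i j
    by unfold_locales (use assms R uq_ideal X_mem K_mem in \<open>auto simp: maximal_left_ideal_def\<close>)
  have D: "D N \<in> I"
    using long_alternating_mem[of Y2 Y1 N] by simp
  have AB: "A N \<approx> scale (- 1) (B N)" using AB_N by (simp add: eqv_def)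
  have k: "0 < N" "N \<le> N" "N mod N = (i + j) mod N" using ij by simp_all
  show "R \<subseteq> I"
  proof
    fix p assume p: "p \<in> R"
    let ?S = "{0..2 * N} <+> {1..2 * N - 1}"
    obtain c where c: "p \<approx> (\<Sum>t\<in>?S. scale (c t) (wAB N t))"
      using diamond_spanning[OF k(1) D AB, of p] by (auto simp: fspan_def)
    then have "p - (\<Sum>t\<in>?S. scale (c t) (wAB N t)) \<in> R" using R(2) by (auto simp: eqv_def)
    then have "p - (p - (\<Sum>t\<in>?S. scale (c t) (wAB N t))) \<in> R" by (rule R.ideal_simps(5)[OF p])
    then have "(\<Sum>t\<in>?S. scale (c t) (wAB N t)) \<in> R" by simp
    then have "c t = 0" if "t \<in> ?S" for t
      using R.diamond_independent[OF ij(1,2) k] that unfolding R.wAB_def wAB_def by blast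
    then have "(\<Sum>t\<in>?S. scale (c t) (wAB N t)) = 0" by (intro sum.neutral) simp
    with c show "p \<in> I" by (simp add: eqv_zero_iff)
  qed
qed (rule R(2))

context uq_root
begin

lemma simple_L_structure:
  assumes ij: "i < N" "j < N"
  obtains l where "simple_weight_module q n N (simple_L q n i j) l i j"
    "0 < i \<Longrightarrow> 0 < j \<Longrightarrow> i + j = N \<Longrightarrow>
      standard_proj q n i j \<in> module_isos (uq q n) (standard_module q n i j) (simple_L q n i j)"
proof -
  let ?M = "standard_module q n i j" and ?L = "simple_L q n i j"
  obtain v where v: "uq_module q n ?M" "uq_module.cyclic q n ?M v"
    "uq_hw q n N (annihilator q n ?M v) (q ^ i) (q ^ j)" "1 \<notin> annihilator q n ?M v"
    by (rule standard_module_cyclic)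
  interpret M: uq_module q n ?M by (rule v)
  interpret I: uq_hw q n N "annihilator q n ?M v" "q ^ i" "q ^ j" by (rule v)
  have vM: "v \<in> carrier ?M" using v(2) unfolding M.cyclic_def by blast
  let ?R = "I.radical" and ?H = "(\<lambda>p. uq_of q n p \<odot>\<^bsub>?M\<^esub> v) ` I.radical"
  \<comment> \<open>The equivalence, not mere maximality, evaluates the definite description in
    \<open>standard_radical\<close>.\<close>
  have "maximal_submodule (uq q n) ?M H \<longleftrightarrow> H = ?H" for H
    by (rule M.unique_maximal_submodule[OF v(2) I.left_ideal_radical I.subset_radical I.radical_proper[OF v(4)]
        I.radical_greatest])
  then have H: "standard_radical q n i j = ?H" by (simp add: standard_radical_def)
  note L = M.cyclic_quotient[OF v(2) I.left_ideal_radical I.subset_radical H]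
  have L_eq: "?L = quot_module ?M (standard_radical q n i j)" by (simp add: simple_L_def)
  let ?l = "standard_radical q n i j +>\<^bsub>?M\<^esub> v"
  interpret L: uq_module q n ?L unfolding L_eq by (rule L)
  have ann: "annihilator q n ?L ?l = ?R" unfolding L_eq by (rule L)
  interpret R: uq_left_ideal q n N "annihilator q n ?L ?l"
    unfolding ann by unfold_locales (use I.left_ideal_radical I.uq_ideal I.subset_radical in auto)
  have "simple_weight_module q n N ?L ?l i j"
  proof
    show "L.cyclic ?l" unfolding L_eq by (rule L)
    show "maximal_left_ideal (annihilator q n ?L ?l)" unfolding ann by (rule I.maximal_radical[OF v(4)])
  qed (use I.X_mem I.K_mem I.subset_radical ij in \<open>auto simp: ann\<close>)
  moreover have "standard_proj q n i j \<in> module_isos (uq q n) ?M ?L" if ij0: "0 < i" "0 < j" "i + j = N"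
  proof -
    have "?R = annihilator q n ?M v"
      by (rule I.maximal_if_sum_N[OF refl refl ij0 I.maximal_radical[OF v(4)] I.subset_radical])
    then have H0: "standard_radical q n i j = {\<zero>\<^bsub>?M\<^esub>}"
      unfolding H using left_idealD(1)[OF I.left_ideal_radical] by (auto simp: annihilator_def)
    have sub: "submodule (standard_radical q n i j) (uq q n) ?M"
      unfolding H by (rule M.submodule_image[OF vM I.left_ideal_radical])
    interpret Q: module_quotient "standard_radical q n i j" ?M "uq q n" by (rule M.submodule_quotient[OF sub])
    have proj: "standard_proj q n i j = Q.cls" by (simp add: standard_proj_def fun_eq_iff)
    have "inj_on Q.cls (carrier ?M)"
    proof (rule inj_onI)
      fix x y assume xy: "x \<in> carrier ?M" "y \<in> carrier ?M" "Q.cls x = Q.cls y"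
      have "x \<in> Q.cls x" using xy by (intro Q.a_rcos_self)
      then have "x \<in> Q.cls y" using xy(3) by simp
      then show "x = y" using xy(2) by (auto simp: a_r_coset_def' H0)
    qed
    then show ?thesis
      unfolding proj L_eq module_isos_def bij_betw_def Q.carrier_quot
      by (auto simp: Q.add_quot Q.smult_quot)
  qed
  ultimately show thesis by (rule that)
qed

lemma simple_weight_module_iso:
  assumes "simple_weight_module q n N S v i j" "simple_weight_module q n N T w i j"
  shows "isomorphic_modules (uq q n) S T"
proof -
  interpret S: simple_weight_module q n N S v i j by fact
  interpret T: simple_weight_module q n N T w i j by fact
  have "annihilator q n S v = annihilator q n T w"
    by (rule maximal_hw_unique[OF S.uq_hw_axioms T.uq_hw_axioms S.maximal T.maximal])
  then show ?thesis
    by (rule isomorphic_cyclic[OF S.uq_module_axioms T.uq_module_axioms S.cyc T.cyc])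
qed

text \<open>An isomorphism preserves annihilators, so it takes the generator of \<open>S\<close> to
  a highest weight vector of \<open>T\<close>, and the highest weight in \<open>T\<close> is
  unique.\<close>

lemma simple_weight_module_iso_weight:
  assumes "simple_weight_module q n N S v i j" "simple_weight_module q n N T w i' j'"
    and iso: "isomorphic_modules (uq q n) S T"
  shows "i = i' \<and> j = j'"
proof -
  interpret S: simple_weight_module q n N S v i j by fact
  interpret T: simple_weight_module q n N T w i' j' by fact
  obtain f where f: "f \<in> module_isos (uq q n) S T" using iso by (auto simp: isomorphic_modules_def)
  note fv = annihilator_iso[OF S.uq_module_axioms T.uq_module_axioms f S.v_closed]
  obtain p where p: "f v = uq_of q n p \<odot>\<^bsub>T\<^esub> w" using fv(1) T.cyc unfolding T.cyclic_def by blast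
  have ann: "{r. r * p \<in> annihilator q n T w} = annihilator q n S v"
    using fv(2) T.annihilator_act[OF T.v_closed, of p] by (simp add: p)
  have "p \<notin> annihilator q n T w"
  proof
    assume "p \<in> annihilator q n T w"
    then have "1 \<in> {r. r * p \<in> annihilator q n T w}" by simp
    then show False unfolding ann using S.one_notin by simp
  qed
  moreover have "uq_hw q n N {r. r * p \<in> annihilator q n T w} (q ^ i) (q ^ j)"
    unfolding ann by (rule S.uq_hw_axioms)
  ultimately have "q ^ i = q ^ i' \<and> q ^ j = q ^ j'" by (rule T.weight_unique[OF T.maximal])
  then show ?thesis using q_power_eq_iff S.ij T.ij by simp
qed

text \<open>Any non-zero vector presents the module as a quotient by a left ideal, in which a
  highest weight vector is found; simplicity makes it a generator with maximal annihilator.\<close>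

lemma simple_module_weight:
  assumes S: "simple_module (uq q n) S"
  obtains v i j where "simple_weight_module q n N S v i j"
proof -
  interpret S: uq_module q n S using S by (auto simp: simple_module_def uq_module_def)
  obtain x where x: "x \<in> carrier S" "x \<noteq> \<zero>\<^bsub>S\<^esub>"
    using S S.M.zero_closed unfolding simple_module_def by blast
  interpret I: uq_left_ideal q n N "annihilator q n S x"
    by unfold_locales (use S.left_ideal_annihilator[OF x(1)] S.uq_ideal_annihilator[OF x(1)] in auto)
  have "1 \<notin> annihilator q n S x" using x by (simp add: S.one_annihilator)
  then obtain p i j where p: "p \<notin> annihilator q n S x" "i < N" "j < N"
    "uq_hw q n N {z. z * p \<in> annihilator q n S x} (q ^ i) (q ^ j)"
    by (rule I.exists_highest_weight)
  let ?v = "uq_of q n p \<odot>\<^bsub>S\<^esub> x"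
  have v: "?v \<in> carrier S" "?v \<noteq> \<zero>\<^bsub>S\<^esub>" using x p(1) by (auto simp: annihilator_def)
  have hw: "uq_hw q n N (annihilator q n S ?v) (q ^ i) (q ^ j)"
    using p(4) by (simp add: S.annihilator_act[OF x(1)])
  have "simple_weight_module q n N S ?v i j"
    by (intro simple_weight_module.intro uq_simple.intro uq_simple_axioms.intro simple_weight_module_axioms.intro
        S.uq_module_axioms hw S.simple_annihilator_maximal[OF S v] S.simple_cyclic[OF S v] p(2,3))
  then show thesis by (rule that)
qed

lemma tensor_unit_weight: "simple_weight_module q n N (tensor_unit q n) 1 0 0"
  using tensor_unit_cyclic N_gt
  by (intro simple_weight_module.intro uq_simple.intro uq_simple_axioms.intro simple_weight_module_axioms.intro) auto

lemma (in simple_weight_module) simple: "simple_module (uq q n) S"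
  by (rule cyclic_simple[OF cyc maximal])

end

theorem theorem6p9:
  fixes q :: "'k::{alg_closed_field, field_char_0}" and n N :: nat
  assumes "N = 2 * n" and "N > 2"
    and "q ^ N = 1" and "\<And>m. 0 < m \<Longrightarrow> m < N \<Longrightarrow> q ^ m \<noteq> 1"
  defines "U \<equiv> uq q n"
    and "L \<equiv> simple_L q n"
    and "M \<equiv> standard_module q n"
  shows
    "(\<forall>i<N. \<forall>j<N. simple_module U (L i j)) \<and>
     (\<forall>i<N. \<forall>j<N. \<forall>i'<N. \<forall>j'<N. isomorphic_modules U (L i j) (L i' j') \<longrightarrow> i = i' \<and> j = j') \<and>
     (\<forall>S :: ('k falg set, 'v) module.
        simple_module U S \<longrightarrow> (\<exists>i<N. \<exists>j<N. isomorphic_modules U S (L i j))) \<and>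
     \<comment> \<open>(1)\<close>
     (isomorphic_modules U (L 0 0) (tensor_unit q n) \<and>
      one_dimensional q n (L 0 0) \<and>
      (\<forall>v\<in>carrier (L 0 0). has_weight q n (L 0 0) v (0, 0)) \<and>
      (\<forall>S :: ('k falg set, 'v) module.
         simple_module U S \<and> one_dimensional q n S \<longrightarrow> isomorphic_modules U S (L 0 0))) \<and>
     \<comment> \<open>(2)\<close>
     (\<forall>j. 0 < j \<and> j < N \<longrightarrow>
       (\<exists>w. is_basis q n (L 0 j) {0..2*j} w \<and>
         (\<forall>m\<le>j. has_weight q n (L 0 j) (w (2*m)) (- int m, int j - int m)) \<and>
         (\<forall>m<j. has_weight q n (L 0 j) (w (2*m+1)) (- int m - 1, int j - int m)) \<and>
         highest_weight_vector q n (L 0 j) (w 0) \<and> generates_module U (L 0 j) (w 0) \<and>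
         (\<forall>m<j. maps_nonzero q n (L 0 j) Y1 (w (2*m)) (- int m - 1, int j - int m)) \<and>
         (\<forall>m<j. maps_nonzero q n (L 0 j) Y2 (w (2*m+1)) (- int (m+1), int j - int (m+1))) \<and>
         has_weight q n (L 0 j) (w (2*j)) (- int j, 0) \<and>
         act q n (L 0 j) Y1 (w (2*j)) = \<zero>\<^bsub>L 0 j\<^esub> \<and>
         act q n (L 0 j) Y2 (w (2*j)) = \<zero>\<^bsub>L 0 j\<^esub>)) \<and>
     \<comment> \<open>(3)\<close>
     (\<forall>i. 0 < i \<and> i < N \<longrightarrow>
       (\<exists>w. is_basis q n (L i 0) {0..2*i} w \<and>
         (\<forall>m\<le>i. has_weight q n (L i 0) (w (2*m)) (int i - int m, - int m)) \<and>
         (\<forall>m<i. has_weight q n (L i 0) (w (2*m+1)) (int i - int m, - int m - 1)) \<and>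
         highest_weight_vector q n (L i 0) (w 0) \<and> generates_module U (L i 0) (w 0) \<and>
         (\<forall>m<i. maps_nonzero q n (L i 0) Y2 (w (2*m)) (int i - int m, - int m - 1)) \<and>
         (\<forall>m<i. maps_nonzero q n (L i 0) Y1 (w (2*m+1)) (int i - int (m+1), - int (m+1))) \<and>
         has_weight q n (L i 0) (w (2*i)) (0, - int i) \<and>
         act q n (L i 0) Y1 (w (2*i)) = \<zero>\<^bsub>L i 0\<^esub> \<and>
         act q n (L i 0) Y2 (w (2*i)) = \<zero>\<^bsub>L i 0\<^esub>)) \<and>
     \<comment> \<open>(4)\<close>
     (\<forall>i j k. 0 < i \<and> i < N \<and> 0 < j \<and> j < N \<and> 1 \<le> k \<and> k \<le> N \<and> k mod N = (i + j) mod N \<longrightarrow>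
       (\<exists>w w'. w' 0 = w 0 \<and> w' (2*k) = w (2*k) \<and>
         is_basis q n (L i j) ({0..2*k} <+> {1..2*k-1}) (case_sum w w') \<and>
         (\<forall>m\<le>k. has_weight q n (L i j) (w (2*m)) (int i - int m, int j - int m) \<and>
                has_weight q n (L i j) (w' (2*m)) (int i - int m, int j - int m)) \<and>
         (\<forall>m<k. has_weight q n (L i j) (w (2*m+1)) (int i - int m, int j - int m - 1) \<and>
                has_weight q n (L i j) (w' (2*m+1)) (int i - int m - 1, int j - int m)) \<and>
         highest_weight_vector q n (L i j) (w 0) \<and> generates_module U (L i j) (w 0) \<and>
         (\<forall>m<k. maps_nonzero q n (L i j) Y2 (w (2*m)) (int i - int m, int j - int m - 1) \<and>
                maps_nonzero q n (L i j) Y1 (w (2*m+1)) (int i - int (m+1), int j - int (m+1))) \<and>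
         (\<forall>m<k. maps_nonzero q n (L i j) Y1 (w' (2*m)) (int i - int m - 1, int j - int m) \<and>
                maps_nonzero q n (L i j) Y2 (w' (2*m+1)) (int i - int (m+1), int j - int (m+1))) \<and>
         has_weight q n (L i j) (w (2*k)) (int i - int k, int j - int k) \<and>
         has_weight q n (L i j) (w (2*k)) (- int j, - int i) \<and>
         act q n (L i j) Y1 (w (2*k)) = \<zero>\<^bsub>L i j\<^esub> \<and>
         act q n (L i j) Y2 (w (2*k)) = \<zero>\<^bsub>L i j\<^esub>)) \<and>
     (\<forall>i j. 0 < i \<and> i < N \<and> 0 < j \<and> j < N \<and> i + j = N \<longrightarrow>
        standard_proj q n i j \<in> module_isos U (M i j) (L i j))"
proof -
  interpret uq_root q n N by unfold_locales (use assms in auto)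
  have ex: "\<exists>l. simple_weight_module q n N (L i j) l i j" if "i < N" "j < N" for i j
    using simple_L_structure[OF that] unfolding L_def by metis
  then obtain l where l: "\<And>i j. i < N \<Longrightarrow> j < N \<Longrightarrow> simple_weight_module q n N (L i j) (l i j) i j" by metis
  have N0: "0 < N" using assms(2) by simp
  have simple: "simple_module U (L i j)" if "i < N" "j < N" for i j
    unfolding U_def by (rule simple_weight_module.simple[OF l[OF that]])
  have distinct: "i = i' \<and> j = j'"
    if "i < N" "j < N" "i' < N" "j' < N" "isomorphic_modules U (L i j) (L i' j')" for i j i' j'
    using simple_weight_module_iso_weight[OF l l] that unfolding U_def by blast
  have complete: "\<exists>i<N. \<exists>j<N. isomorphic_modules U S (L i j)"
    if S: "simple_module U S" for S :: "('k falg set, 'v) module"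
  proof -
    obtain v i j where S: "simple_weight_module q n N S v i j"
      by (rule simple_module_weight[OF S[unfolded U_def]])
    interpret S: simple_weight_module q n N S v i j by (rule S)
    show ?thesis unfolding U_def using simple_weight_module_iso[OF S l[OF S.ij]] S.ij by blast
  qed
  \<comment> \<open>Both are simple with a highest weight generator of weight (0, 0), which
    determines the module.\<close>
  have unit: "isomorphic_modules U (L 0 0) (tensor_unit q n)"
    unfolding U_def by (rule simple_weight_module_iso[OF l[OF N0 N0] tensor_unit_weight])
  have one_dim: "isomorphic_modules U S (L 0 0)"
    if S: "simple_module U S \<and> one_dimensional q n S" for S :: "('k falg set, 'v) module"
  proof -
    obtain v i j where v: "simple_weight_module q n N S v i j"
      by (rule simple_module_weight[OF conjunct1[OF S, unfolded U_def]])
    have "i = 0 \<and> j = 0" using simple_weight_module.one_dimensional_weight[OF v] S by blast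
    then have "simple_weight_module q n N S v 0 0" using v by simp
    then show ?thesis unfolding U_def by (rule simple_weight_module_iso[OF _ l[OF N0 N0]])
  qed
  note trivial = simple_weight_module.trivial_case[OF l[OF N0 N0] refl refl]
  have trivial_dim: "one_dimensional q n (L 0 0)" unfolding one_dimensional_def using trivial(1) by blast
  have proj: "standard_proj q n i j \<in> module_isos U (M i j) (L i j)"
    if "0 < i \<and> i < N \<and> 0 < j \<and> j < N \<and> i + j = N" for i j
    using simple_L_structure[of i j] that unfolding U_def M_def L_def by metis
  note left = simple_weight_module.left_chain[OF l[OF N0] refl, folded U_def]
    and right = simple_weight_module.right_chain[OF l[OF _ N0] _ refl, folded U_def]
    and diamond = simple_weight_module.diamond[OF l, folded U_def]
  show ?thesis
    apply (intro conjI)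
           apply (intro allI impI, erule (1) simple)
          apply (intro allI impI, erule (4) distinct)
         apply (intro allI impI, erule complete)
        apply (rule unit)
       apply (rule trivial_dim)
      apply (intro ballI, erule trivial(2))
     apply (intro allI impI, erule one_dim)
    subgoal by (intro allI impI, elim conjE, rule left)
    subgoal by (intro allI impI, elim conjE, rule right)
    subgoal by (intro allI impI, elim conjE, rule diamond)
    subgoal by (intro allI impI, rule proj)
    done
qed

end
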